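(* Let $M$ be a $G$-graded $R$-module. Then $$\mathrm{Supp}_G(\mathrm{Tor}^R_j(M,S)) \subset \mathcal{E}_{j+1}+ \complement\, \mathrm{reg}_B (M)$$ for all $j\not= n$, and $\mathrm{Supp}_G(\mathrm{Tor}^R_n(M,S))\subseteq \mathrm{Supp}_G(H^0_B (M))+\mathcal{E}_n$.
   Context: $G$ is an abelian group, $S$ is a commutative ring, $R=S[X_1,\ldots,X_n]$ is $G$-graded with $\deg(X_i)=\gamma_i\in G$ and $\deg(s)=0$ for $s\in S$, $\mathcal{C}$ is the submonoid of $G$ generated by $\gamma_1,\ldots,\gamma_n$, and $B\subseteq (X_1,\ldots,X_n)$ is a finitely generated graded ideal. $S$ is viewed as $R/(X_1,\ldots,X_n)$. $H^i_B$ denotes Čech cohomology on a finite set of homogeneous generators of $B$; $\mathrm{Supp}_G(M):=\{\gamma\in G: M_\gamma\neq 0\}$; $\complement$ denotes the complement in $G$; sums of subsets of $G$ are Minkowski sums. $\mathcal{E}_0:=\{0\}$, $\mathcal{E}_l:=\{\gamma_{i_1}+\cdots+\gamma_{i_l} : i_1<\cdots<i_l\}$ for $l>0$. $\mathcal{F}_i:=\{\gamma_{j_1}+\cdots+\gamma_{j_i} : j_1\le\cdots\le j_i\}$ for $i>0$, $\mathcal{F}_0:=\{0\}$, $\mathcal{F}_{-1}:=-\mathcal{F}_1$. $M$ is weakly $\gamma$-regular if $\gamma\notin\bigcup_{i\ge0}(\mathrm{Supp}_G(H^i_B(M))+\mathcal{F}_{i-1})$, and $\gamma$-regular if it is weakly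 $\gamma'$-regular for all $\gamma'\in\gamma+\mathcal{C}$. $\mathrm{reg}_B(M):=\{\gamma\in G : M \text{ is } \gamma\text{-regular}\}$. *)

theory Defs
  imports
    "HOL-Algebra.Indexed_Polynomials"
    "HOL-Algebra.Free_Abelian_Groups"
    "HOL-Library.Set_Algebras"
begin

section \<open>Graded rings and graded modules\<close>

text \<open>The grading group is a type of class \<open>ab_group_add\<close>. As usual in HOL-Algebra, the fields
  \<open>mult\<close> and \<open>one\<close> that a module record inherits from \<open>ring\<close> carry no meaning.\<close>

record ('a, 'g) gring = "'a ring" +
  homog :: "'g \<Rightarrow> 'a set"

record ('r, 'a, 'g) gmodule = "('r, 'a) module" +
  grade :: "'g \<Rightarrow> 'a set"

definition direct_decomposition :: "('a, 'b) ring_scheme \<Rightarrow> ('g \<Rightarrow> 'a set) \<Rightarrow> bool" where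
  "direct_decomposition A D \<longleftrightarrow>
     (\<forall>\<gamma>. additive_subgroup (D \<gamma>) A) \<and>
     (\<forall>x\<in>carrier A. \<exists>!c. (\<forall>\<gamma>. c \<gamma> \<in> D \<gamma>) \<and> finite {\<gamma>. c \<gamma> \<noteq> \<zero>\<^bsub>A\<^esub>} \<and>
        x = (\<Oplus>\<^bsub>A\<^esub>\<gamma>\<in>{\<gamma>. c \<gamma> \<noteq> \<zero>\<^bsub>A\<^esub>}. c \<gamma>))"

definition graded_module ::
    "('r, 'g::ab_group_add) gring \<Rightarrow> ('r, 'm, 'g) gmodule \<Rightarrow> bool" where
  "graded_module R M \<longleftrightarrow> module R M \<and> direct_decomposition M (grade M) \<and>
     (\<forall>\<alpha> \<beta>. \<forall>r\<in>homog R \<alpha>. \<forall>x\<in>grade M \<beta>. r \<odot>\<^bsub>M\<^esub> x \<in> grade M (\<alpha> + \<beta>))"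

definition graded_hom ::
    "('r, 'g) gring \<Rightarrow> ('r, 'm, 'g) gmodule \<Rightarrow> ('r, 'k, 'g) gmodule \<Rightarrow> ('m \<Rightarrow> 'k) set" where
  "graded_hom R M N = {h \<in> carrier M \<rightarrow> carrier N.
     (\<forall>x\<in>carrier M. \<forall>y\<in>carrier M. h (x \<oplus>\<^bsub>M\<^esub> y) = h x \<oplus>\<^bsub>N\<^esub> h y) \<and>
     (\<forall>r\<in>carrier R. \<forall>x\<in>carrier M. h (r \<odot>\<^bsub>M\<^esub> x) = r \<odot>\<^bsub>N\<^esub> h x) \<and>
     (\<forall>\<gamma>. h ` grade M \<gamma> \<subseteq> grade N \<gamma>)}"

definition Supp :: "('r, 'm, 'g) gmodule \<Rightarrow> 'g set" where
  "Supp M = {\<gamma>. grade M \<gamma> \<noteq> {\<zero>\<^bsub>M\<^esub>}}"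

definition regular_gmodule :: "('r, 'g) gring \<Rightarrow> ('r, 'r, 'g) gmodule" where
  "regular_gmodule R = \<lparr>carrier = carrier R, monoid.mult = monoid.mult R, one = \<one>\<^bsub>R\<^esub>, ring.zero = \<zero>\<^bsub>R\<^esub>,
     add = add R, smult = monoid.mult R, grade = homog R\<rparr>"

definition gsub :: "('r, 'm, 'g) gmodule \<Rightarrow> 'm set \<Rightarrow> ('r, 'm, 'g) gmodule" where
  "gsub M Z = M\<lparr>carrier := Z, grade := (\<lambda>\<gamma>. grade M \<gamma> \<inter> Z)\<rparr>"

definition gquot :: "('r, 'm, 'g) gmodule \<Rightarrow> 'm set \<Rightarrow> ('r, 'm set, 'g) gmodule" where
  "gquot M N = \<lparr>carrier = a_rcosets\<^bsub>M\<^esub> N, monoid.mult = undefined, one = undefined, ring.zero = N,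
     add = set_add M, smult = (\<lambda>r U. \<Union>x\<in>U. N +>\<^bsub>M\<^esub> (r \<odot>\<^bsub>M\<^esub> x)),
     grade = (\<lambda>\<gamma>. (\<lambda>x. N +>\<^bsub>M\<^esub> x) ` grade M \<gamma>)\<rparr>"

definition gprod :: "'i set \<Rightarrow> ('i \<Rightarrow> ('r, 'm, 'g) gmodule) \<Rightarrow> ('r, 'i \<Rightarrow> 'm, 'g) gmodule" where
  \<comment> \<open>meant for finite index sets, where the product of graded modules is graded by degree\<close>
  "gprod A N = \<lparr>carrier = (\<Pi>\<^sub>E i\<in>A. carrier (N i)), monoid.mult = undefined, one = undefined,
     ring.zero = (\<lambda>i\<in>A. \<zero>\<^bsub>N i\<^esub>), add = (\<lambda>x y. \<lambda>i\<in>A. x i \<oplus>\<^bsub>N i\<^esub> y i),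
     smult = (\<lambda>r x. \<lambda>i\<in>A. r \<odot>\<^bsub>N i\<^esub> x i), grade = (\<lambda>\<gamma>. \<Pi>\<^sub>E i\<in>A. grade (N i) \<gamma>)\<rparr>"


section \<open>Homology of complexes of graded modules\<close>

text \<open>A chain complex has differentials \<open>d i\<close> from \<open>C (i + 1)\<close> to \<open>C i\<close>, a cochain complex has
  differentials \<open>d i\<close> from \<open>C i\<close> to \<open>C (i + 1)\<close>; both are zero in negative degrees.\<close>

definition chain_homology ::
    "(nat \<Rightarrow> ('r, 'm, 'g) gmodule) \<Rightarrow> (nat \<Rightarrow> 'm \<Rightarrow> 'm) \<Rightarrow> nat \<Rightarrow> ('r, 'm set, 'g) gmodule" where
  "chain_homology C d j = gquot
     (gsub (C j) {x \<in> carrier (C j). j = 0 \<or> d (j - 1) x = \<zero>\<^bsub>C (j - 1)\<^esub>})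
     (d j ` carrier (C (Suc j)))"

definition cochain_cohomology ::
    "(nat \<Rightarrow> ('r, 'm, 'g) gmodule) \<Rightarrow> (nat \<Rightarrow> 'm \<Rightarrow> 'm) \<Rightarrow> nat \<Rightarrow> ('r, 'm set, 'g) gmodule" where
  "cochain_cohomology C d j = gquot
     (gsub (C j) {x \<in> carrier (C j). d j x = \<zero>\<^bsub>C (Suc j)\<^esub>})
     (if j = 0 then {\<zero>\<^bsub>C 0\<^esub>} else d (j - 1) ` carrier (C (j - 1)))"


section \<open>Tensor products and Tor\<close>

text \<open>The tensor product is the free abelian group on \<open>carrier M \<times> carrier N\<close> modulo the subgroup
  generated by the additivity and balancing relators.\<close>

definition tensor_relators ::
    "('r, 'g) gring \<Rightarrow> ('r, 'm, 'g) gmodule \<Rightarrow> ('r, 'k, 'g) gmodule \<Rightarrow> ('m \<times> 'k \<Rightarrow>\<^sub>0 int) set" where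
  "tensor_relators R M N =
     {frag_of (x \<oplus>\<^bsub>M\<^esub> x', y) - frag_of (x, y) - frag_of (x', y) | x x' y.
        x \<in> carrier M \<and> x' \<in> carrier M \<and> y \<in> carrier N} \<union>
     {frag_of (x, y \<oplus>\<^bsub>N\<^esub> y') - frag_of (x, y) - frag_of (x, y') | x y y'.
        x \<in> carrier M \<and> y \<in> carrier N \<and> y' \<in> carrier N} \<union>
     {frag_of (r \<odot>\<^bsub>M\<^esub> x, y) - frag_of (x, r \<odot>\<^bsub>N\<^esub> y) | r x y.
        r \<in> carrier R \<and> x \<in> carrier M \<and> y \<in> carrier N}"

abbreviation tensor_free ::
    "('r, 'm, 'g) gmodule \<Rightarrow> ('r, 'k, 'g) gmodule \<Rightarrow> ('m \<times> 'k \<Rightarrow>\<^sub>0 int) monoid" where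
  "tensor_free M N \<equiv> free_Abelian_group (carrier M \<times> carrier N)"

definition tensor_class ::
    "('r, 'g) gring \<Rightarrow> ('r, 'm, 'g) gmodule \<Rightarrow> ('r, 'k, 'g) gmodule
      \<Rightarrow> ('m \<times> 'k \<Rightarrow>\<^sub>0 int) \<Rightarrow> ('m \<times> 'k \<Rightarrow>\<^sub>0 int) set" where
  "tensor_class R M N z =
     generate (tensor_free M N) (tensor_relators R M N) #>\<^bsub>tensor_free M N\<^esub> z"

definition gtensor ::
    "('r, 'g::ab_group_add) gring \<Rightarrow> ('r, 'm, 'g) gmodule \<Rightarrow> ('r, 'k, 'g) gmodule
      \<Rightarrow> ('r, ('m \<times> 'k \<Rightarrow>\<^sub>0 int) set, 'g) gmodule" where
  "gtensor R M N = \<lparr>carrier = tensor_class R M N ` carrier (tensor_free M N),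
     monoid.mult = undefined, one = undefined,
     ring.zero = tensor_class R M N 0,
     add = set_mult (tensor_free M N),
     smult = (\<lambda>r U. \<Union>z\<in>U. tensor_class R M N (frag_extend (\<lambda>(x, y). frag_of (r \<odot>\<^bsub>M\<^esub> x, y)) z)),
     grade = (\<lambda>\<gamma>. tensor_class R M N ` generate (tensor_free M N)
        {frag_of (x, y) | x y \<alpha> \<beta>. x \<in> grade M \<alpha> \<and> y \<in> grade N \<beta> \<and> \<alpha> + \<beta> = \<gamma>})\<rparr>"

text \<open>The map induced on tensor products with \<open>N\<close> by a homomorphism \<open>h\<close> into \<open>M'\<close>.\<close>

definition tensor_map ::
    "('r, 'g) gring \<Rightarrow> ('r, 'm, 'g) gmodule \<Rightarrow> ('r, 'k, 'g) gmodule \<Rightarrow> ('l \<Rightarrow> 'm)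
      \<Rightarrow> ('l \<times> 'k \<Rightarrow>\<^sub>0 int) set \<Rightarrow> ('m \<times> 'k \<Rightarrow>\<^sub>0 int) set" where
  "tensor_map R M' N h U =
     (\<Union>z\<in>U. tensor_class R M' N (frag_extend (\<lambda>(x, y). frag_of (h x, y)) z))"

definition is_basis :: "('r, 'g) gring \<Rightarrow> ('r, 'm, 'g) gmodule \<Rightarrow> 'm set \<Rightarrow> bool" where
  "is_basis R M E \<longleftrightarrow> E \<subseteq> carrier M \<and>
     (\<forall>x\<in>carrier M. \<exists>!c. (\<forall>b. c b \<in> carrier R) \<and> finite {b. c b \<noteq> \<zero>\<^bsub>R\<^esub>} \<and>
        {b. c b \<noteq> \<zero>\<^bsub>R\<^esub>} \<subseteq> E \<and> x = (\<Oplus>\<^bsub>M\<^esub>b\<in>{b. c b \<noteq> \<zero>\<^bsub>R\<^esub>}. c b \<odot>\<^bsub>M\<^esub> b))"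

definition graded_free :: "('r, 'g::ab_group_add) gring \<Rightarrow> ('r, 'm, 'g) gmodule \<Rightarrow> bool" where
  "graded_free R F \<longleftrightarrow> graded_module R F \<and> (\<exists>E. E \<subseteq> (\<Union>\<gamma>. grade F \<gamma>) \<and> is_basis R F E)"

text \<open>A graded free resolution with \<open>d i\<close> from \<open>F (i + 1)\<close> to \<open>F i\<close> and augmentation
  \<open>\<epsilon>\<close> from \<open>F 0\<close> onto \<open>M\<close>.\<close>

definition graded_free_resolution ::
    "('r, 'g::ab_group_add) gring \<Rightarrow> ('r, 'm, 'g) gmodule \<Rightarrow> (nat \<Rightarrow> ('r, 'f, 'g) gmodule)
      \<Rightarrow> (nat \<Rightarrow> 'f \<Rightarrow> 'f) \<Rightarrow> ('f \<Rightarrow> 'm) \<Rightarrow> bool" where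
  "graded_free_resolution R M F d \<epsilon> \<longleftrightarrow>
     (\<forall>i. graded_free R (F i)) \<and>
     (\<forall>i. d i \<in> graded_hom R (F (Suc i)) (F i)) \<and>
     \<epsilon> \<in> graded_hom R (F 0) M \<and> \<epsilon> ` carrier (F 0) = carrier M \<and>
     d 0 ` carrier (F 1) = {x \<in> carrier (F 0). \<epsilon> x = \<zero>\<^bsub>M\<^esub>} \<and>
     (\<forall>i. d (Suc i) ` carrier (F (Suc (Suc i))) =
        {x \<in> carrier (F (Suc i)). d i x = \<zero>\<^bsub>F i\<^esub>})"

text \<open>If \<open>(F, d)\<close> is a graded free resolution of \<open>M\<close>, this is the graded module
  \<open>Tor\<^sub>j(M, N)\<close>; up to isomorphism of graded modules it does not depend on the resolution.\<close>

definition gTor ::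
    "('r, 'g::ab_group_add) gring \<Rightarrow> (nat \<Rightarrow> ('r, 'f, 'g) gmodule) \<Rightarrow> (nat \<Rightarrow> 'f \<Rightarrow> 'f)
      \<Rightarrow> ('r, 'k, 'g) gmodule \<Rightarrow> nat \<Rightarrow> ('r, ('f \<times> 'k \<Rightarrow>\<^sub>0 int) set set, 'g) gmodule" where
  "gTor R F d N = chain_homology (\<lambda>i. gtensor R (F i) N) (\<lambda>i. tensor_map R (F i) N (d i))"


section \<open>Localization and Cech cohomology\<close>

text \<open>\<open>loc_frac R M f x a\<close> is the fraction \<open>x / f\<^sup>a\<close> in the localization of \<open>M\<close> at the powers of \<open>f\<close>,
  as an equivalence class of pairs.\<close>

definition loc_frac ::
    "('r, 'g) gring \<Rightarrow> ('r, 'm, 'g) gmodule \<Rightarrow> 'r \<Rightarrow> 'm \<Rightarrow> nat \<Rightarrow> ('m \<times> nat) set" where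
  "loc_frac R M f x a = {(y, b). y \<in> carrier M \<and>
     (\<exists>t::nat. (f [^]\<^bsub>R\<^esub> t) \<odot>\<^bsub>M\<^esub> ((f [^]\<^bsub>R\<^esub> b) \<odot>\<^bsub>M\<^esub> x) = (f [^]\<^bsub>R\<^esub> t) \<odot>\<^bsub>M\<^esub> ((f [^]\<^bsub>R\<^esub> a) \<odot>\<^bsub>M\<^esub> y))}"

text \<open>For homogeneous \<open>f\<close>, the degree of a fraction with homogeneous numerator is the degree of the
  numerator minus that of the denominator. The degree of \<open>f\<^sup>a\<close> is ambiguous only if \<open>f\<^sup>a = 0\<close>, and
  then the localization is zero.\<close>

definition gloc ::
    "('r, 'g::ab_group_add) gring \<Rightarrow> ('r, 'm, 'g) gmodule \<Rightarrow> 'r \<Rightarrow> ('r, ('m \<times> nat) set, 'g) gmodule" where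
  "gloc R M f = \<lparr>carrier = {loc_frac R M f x a | x a. x \<in> carrier M},
     monoid.mult = undefined, one = undefined,
     ring.zero = loc_frac R M f \<zero>\<^bsub>M\<^esub> 0,
     add = (\<lambda>U V. \<Union>(x, a)\<in>U. \<Union>(y, b)\<in>V.
        loc_frac R M f ((f [^]\<^bsub>R\<^esub> b) \<odot>\<^bsub>M\<^esub> x \<oplus>\<^bsub>M\<^esub> (f [^]\<^bsub>R\<^esub> a) \<odot>\<^bsub>M\<^esub> y) (a + b)),
     smult = (\<lambda>r U. \<Union>(x, a)\<in>U. loc_frac R M f (r \<odot>\<^bsub>M\<^esub> x) a),
     grade = (\<lambda>\<gamma>. {loc_frac R M f x a | x a \<delta>. f [^]\<^bsub>R\<^esub> a \<in> homog R \<delta> \<and> x \<in> grade M (\<gamma> + \<delta>)})\<rparr>"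

text \<open>The canonical map from the localization at \<open>f\<close> to the localization at \<open>f * g\<close>,
  sending \<open>x / f\<^sup>a\<close> to \<open>(g\<^sup>a * x) / (f * g)\<^sup>a\<close>.\<close>

definition loc_map ::
    "('r, 'g) gring \<Rightarrow> ('r, 'm, 'g) gmodule \<Rightarrow> 'r \<Rightarrow> 'r \<Rightarrow> ('m \<times> nat) set \<Rightarrow> ('m \<times> nat) set" where
  "loc_map R M f g U = (\<Union>(x, a)\<in>U. loc_frac R M (f \<otimes>\<^bsub>R\<^esub> g) ((g [^]\<^bsub>R\<^esub> a) \<odot>\<^bsub>M\<^esub> x) a)"

definition cech_index :: "'r list \<Rightarrow> nat \<Rightarrow> nat set set" where
  "cech_index fs p = {I. I \<subseteq> {..<length fs} \<and> card I = p}"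

definition cech_elem :: "('r, 'g) gring \<Rightarrow> 'r list \<Rightarrow> nat set \<Rightarrow> 'r" where
  "cech_elem R fs I = (\<Otimes>\<^bsub>R\<^esub>i\<in>I. fs ! i)"

text \<open>The empty product is \<open>\<one>\<close>, so the term in cohomological degree \<open>0\<close> is \<open>M\<close> localized at \<open>\<one>\<close>,
  that is, \<open>M\<close> up to the canonical isomorphism.\<close>

definition cech_complex ::
    "('r, 'g::ab_group_add) gring \<Rightarrow> 'r list \<Rightarrow> ('r, 'm, 'g) gmodule
      \<Rightarrow> nat \<Rightarrow> ('r, nat set \<Rightarrow> ('m \<times> nat) set, 'g) gmodule" where
  "cech_complex R fs M p = gprod (cech_index fs p) (\<lambda>I. gloc R M (cech_elem R fs I))"

definition cech_diff ::
    "('r, 'g::ab_group_add) gring \<Rightarrow> 'r list \<Rightarrow> ('r, 'm, 'g) gmodule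
      \<Rightarrow> nat \<Rightarrow> (nat set \<Rightarrow> ('m \<times> nat) set) \<Rightarrow> (nat set \<Rightarrow> ('m \<times> nat) set)" where
  "cech_diff R fs M p c = (\<lambda>I\<in>cech_index fs (Suc p).
     let L = gloc R M (cech_elem R fs I) in
     \<Oplus>\<^bsub>L\<^esub>k\<in>I. let y = loc_map R M (cech_elem R fs (I - {k})) (fs ! k) (c (I - {k}))
            in if even (card {i \<in> I. i < k}) then y else \<ominus>\<^bsub>L\<^esub> y)"

definition cech_cohomology ::
    "('r, 'g::ab_group_add) gring \<Rightarrow> 'r list \<Rightarrow> ('r, 'm, 'g) gmodule
      \<Rightarrow> nat \<Rightarrow> ('r, (nat set \<Rightarrow> ('m \<times> nat) set) set, 'g) gmodule" where
  "cech_cohomology R fs M = cochain_cohomology (cech_complex R fs M) (cech_diff R fs M)"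


section \<open>The graded polynomial ring\<close>

text \<open>\<open>S[X\<^sub>0, \<dots>, X\<^sub>n\<^sub>-\<^sub>1]\<close>, with \<open>X\<^sub>i\<close> of degree \<open>\<gamma> i\<close> and \<open>S\<close> in degree \<open>0\<close>. A polynomial is the function
  sending a monomial (a multiset of variable indices) to its coefficient.\<close>

definition mdegree :: "(nat \<Rightarrow> 'g::ab_group_add) \<Rightarrow> nat multiset \<Rightarrow> 'g" where
  "mdegree \<gamma> m = (\<Sum>i\<in>#m. \<gamma> i)"

definition graded_poly_ring ::
    "('s, 'b) ring_scheme \<Rightarrow> nat \<Rightarrow> (nat \<Rightarrow> 'g::ab_group_add) \<Rightarrow> (nat multiset \<Rightarrow> 's, 'g) gring" where
  "graded_poly_ring S n \<gamma> = \<lparr>carrier = ring.indexed_pset S {..<n} (carrier S),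
     monoid.mult = (\<lambda>p q m. \<Oplus>\<^bsub>S\<^esub>a\<in>{a. a \<subseteq># m}. p a \<otimes>\<^bsub>S\<^esub> q (m - a)),
     one = ring.indexed_const S \<one>\<^bsub>S\<^esub>,
     ring.zero = ring.indexed_const S \<zero>\<^bsub>S\<^esub>,
     add = ring.indexed_padd S,
     homog = (\<lambda>\<delta>. {p \<in> ring.indexed_pset S {..<n} (carrier S).
        \<forall>m. p m \<noteq> \<zero>\<^bsub>S\<^esub> \<longrightarrow> mdegree \<gamma> m = \<delta>})\<rparr>"

definition irrelevant_ideal ::
    "('s, 'b) ring_scheme \<Rightarrow> nat \<Rightarrow> (nat \<Rightarrow> 'g::ab_group_add) \<Rightarrow> (nat multiset \<Rightarrow> 's) set" where
  "irrelevant_ideal S n \<gamma> = Idl\<^bsub>graded_poly_ring S n \<gamma>\<^esub> (ring.indexed_var S ` {..<n})"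

definition base_gmodule ::
    "('s, 'b) ring_scheme \<Rightarrow> nat \<Rightarrow> (nat \<Rightarrow> 'g::ab_group_add)
      \<Rightarrow> (nat multiset \<Rightarrow> 's, (nat multiset \<Rightarrow> 's) set, 'g) gmodule" where
  \<comment> \<open>\<open>S\<close> viewed as the graded module \<open>R / (X\<^sub>0, \<dots>, X\<^sub>n\<^sub>-\<^sub>1)\<close>\<close>
  "base_gmodule S n \<gamma> = gquot (regular_gmodule (graded_poly_ring S n \<gamma>)) (irrelevant_ideal S n \<gamma>)"


section \<open>Regularity\<close>

text \<open>Sums of sets are Minkowski sums, whereas \<open>- A\<close> is the complement of a set \<open>A\<close>.\<close>

definition degree_monoid :: "nat \<Rightarrow> (nat \<Rightarrow> 'g::ab_group_add) \<Rightarrow> 'g set" where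
  "degree_monoid n \<gamma> = (\<lambda>H. 0 \<in> H \<and> (\<forall>a\<in>H. \<forall>b\<in>H. a + b \<in> H)) hull (\<gamma> ` {..<n})"

definition E_set :: "nat \<Rightarrow> (nat \<Rightarrow> 'g::ab_group_add) \<Rightarrow> nat \<Rightarrow> 'g set" where
  "E_set n \<gamma> l = {\<Sum>i\<in>I. \<gamma> i | I. I \<subseteq> {..<n} \<and> card I = l}"

definition F_set :: "nat \<Rightarrow> (nat \<Rightarrow> 'g::ab_group_add) \<Rightarrow> nat \<Rightarrow> 'g set" where
  "F_set n \<gamma> i = {mdegree \<gamma> m | m. set_mset m \<subseteq> {..<n} \<and> size m = i}"

definition F_pred :: "nat \<Rightarrow> (nat \<Rightarrow> 'g::ab_group_add) \<Rightarrow> nat \<Rightarrow> 'g set" where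
  \<comment> \<open>the set with index \<open>i - 1\<close>, where index \<open>-1\<close> stands for the negatives of \<open>F_set n \<gamma> 1\<close>\<close>
  "F_pred n \<gamma> i = (if i = 0 then uminus ` F_set n \<gamma> 1 else F_set n \<gamma> (i - 1))"

definition weakly_regular ::
    "('s, 'b) ring_scheme \<Rightarrow> nat \<Rightarrow> (nat \<Rightarrow> 'g::ab_group_add) \<Rightarrow> (nat multiset \<Rightarrow> 's) list
      \<Rightarrow> (nat multiset \<Rightarrow> 's, 'm, 'g) gmodule \<Rightarrow> 'g \<Rightarrow> bool" where
  "weakly_regular S n \<gamma> fs M \<mu> \<longleftrightarrow>
     \<mu> \<notin> (\<Union>i. Supp (cech_cohomology (graded_poly_ring S n \<gamma>) fs M i) + F_pred n \<gamma> i)"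

definition reg ::
    "('s, 'b) ring_scheme \<Rightarrow> nat \<Rightarrow> (nat \<Rightarrow> 'g::ab_group_add) \<Rightarrow> (nat multiset \<Rightarrow> 's) list
      \<Rightarrow> (nat multiset \<Rightarrow> 's, 'm, 'g) gmodule \<Rightarrow> 'g set" where
  "reg S n \<gamma> fs M = {\<mu>. \<forall>\<mu>'\<in>{\<mu>} + degree_monoid n \<gamma>. weakly_regular S n \<gamma> fs M \<mu>'}"

end

theory Submission
  imports Defs
begin

text \<open>
  Let \<open>K(X; M)\<close> be the Koszul complex of the variables with coefficients in \<open>M\<close>. The basis element
  that belongs to a set \<open>I\<close> of variables has degree \<open>\<gamma>\<^sub>I = \<Sum>\<^sub>i\<^sub>\<in>\<^sub>I \<gamma>\<^sub>i\<close>, so the part of degree \<open>\<mu>\<close> is a sum of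
  copies of the groups \<open>M\<^sub>\<mu>\<^sub>-\<^sub>\<gamma>\<^sub>I\<close>. Everything rests on one claim: if \<open>Tor\<^sub>j(M, S)\<close> is not zero in degree \<open>\<mu>\<close>,
  then there are \<open>i\<close> and a set \<open>I\<close> of \<open>i + j\<close> variables such that \<open>H\<^sup>i\<^sub>B(M)\<close> is not zero in degree \<open>\<mu> - \<gamma>\<^sub>I\<close>.

  The claim implies the theorem by counting. As \<open>I\<close> has at most \<open>n\<close> elements, \<open>j \<le> n\<close>. If \<open>j = n\<close> then
  \<open>i = 0\<close> and \<open>I\<close> consists of all variables, which is the second inclusion. If \<open>j < n\<close> and \<open>i > 0\<close>, split
  \<open>I\<close> into \<open>j + 1\<close> elements, whose degrees add up to an element of \<open>\<E>\<^sub>j\<^sub>+\<^sub>1\<close>, and \<open>i - 1\<close> others, whose degrees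
  add up to an element of \<open>\<F>\<^sub>i\<^sub>-\<^sub>1\<close> that takes \<open>\<mu> - \<gamma>\<^sub>I\<close> to a degree in which \<open>M\<close> is not regular. If \<open>j < n\<close> and \<open>i = 0\<close>, then some variable is
  missing from \<open>I\<close>; adding it and subtracting its degree again is the role of \<open>\<F>\<^sub>-\<^sub>1\<close>. This is
  \<open>shifted_support_subset\<close>.

  The claim is proved in contrapositive form by two diagram chases in degree \<open>\<mu>\<close>, with exactness of
  \<open>K(X; M)\<close> at exterior degree \<open>j\<close> as the intermediate statement.

  \<^item> In the double complex of the Cech complex and the Koszul complex, the Cech direction is exact at the
    places \<open>(i, i + j)\<close> by the assumption on \<open>H\<^sup>i\<^sub>B(M)\<close>. The Koszul direction is exact in positive Cech
    degree: there \<open>M\<close> is localized at an element of \<open>(X)\<close>, which acts bijectively, whereas elements of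
    \<open>(X)\<close> act as zero on Koszul homology. So a Koszul cycle of exterior degree \<open>j\<close> on \<open>M\<close> is a boundary:
    \<open>koszul_exact_of_cech_vanishing\<close>.
  \<^item> In the double complex of a free resolution \<open>F\<close> of \<open>M\<close> and the Koszul complex, the Koszul direction
    is exact in positive exterior degree, since it is so for the polynomial ring, by an explicit
    contraction. So an element \<open>z\<close> of \<open>F\<^sub>j\<close> of degree \<open>\<mu>\<close> whose differential lies in \<open>(X) F\<^sub>j\<^sub>-\<^sub>1\<close> lies in
    \<open>(X) F\<^sub>j + d F\<^sub>j\<^sub>+\<^sub>1\<close>: \<open>resolution_cycle_mod_irrelevant\<close>. As \<open>F \<otimes> S = F / (X) F\<close>, this says that
    \<open>Tor\<^sub>j(M, S)\<close> is zero in degree \<open>\<mu>\<close>.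

  The two chases share their induction step, \<open>staircase_step\<close>.
\<close>

section \<open>Signs and additive maps\<close>

text \<open>Signs are recorded as exponents of \<open>-1\<close>, so that products of signs become sums.\<close>
definition signed :: "('a, 'b) ring_scheme \<Rightarrow> nat \<Rightarrow> 'a \<Rightarrow> 'a" where
  "signed N m y = (if even m then y else \<ominus>\<^bsub>N\<^esub> y)"

definition below :: "nat \<Rightarrow> nat set \<Rightarrow> nat" where
  "below k I = card {i \<in> I. i < k}"

lemma below_insert:
  assumes "finite I" "l \<notin> I"
  shows "below k (insert l I) = (if l < k then Suc (below k I) else below k I)"
proof -
  have "{i \<in> insert l I. i < k} = (if l < k then insert l {i \<in> I. i < k} else {i \<in> I. i < k})"
    by auto
  then show ?thesis using assms by (auto simp: below_def)
qed

lemma below_remove: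
  assumes "finite I" "l \<in> I"
  shows "below k I = (if l < k then Suc (below k (I - {l})) else below k (I - {l}))"
  using below_insert[of "I - {l}" l k] assms by (simp add: insert_absorb)

context abelian_group
begin

lemma signed_closed [simp]: "y \<in> carrier G \<Longrightarrow> signed G m y \<in> carrier G"
  by (simp add: signed_def)

lemma signed_zero [simp]: "signed G m \<zero> = \<zero>"
  by (simp add: signed_def)

lemma signed_signed: "y \<in> carrier G \<Longrightarrow> signed G m (signed G k y) = signed G (m + k) y"
  by (simp add: signed_def)

lemma signed_add:
  "y \<in> carrier G \<Longrightarrow> z \<in> carrier G \<Longrightarrow> signed G m (y \<oplus> z) = signed G m y \<oplus> signed G m z"
  by (simp add: signed_def minus_add)

lemma signed_Suc_cancel:
  assumes "y \<in> carrier G" "odd (m + k)"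
  shows "signed G m y \<oplus> signed G k y = \<zero>"
  using assms by (auto simp: signed_def r_neg l_neg)

text \<open>Koszul and Cech differentials both square to zero for this reason: two indices are added, or removed,
in either order, and the two results differ by a sign.\<close>
lemma finsum_antisymmetric:
  assumes "finite A"
    and "\<And>k l. k \<in> A \<Longrightarrow> l \<in> A \<Longrightarrow> k \<noteq> l \<Longrightarrow> h k l \<in> carrier G"
    and "\<And>k l. k \<in> A \<Longrightarrow> l \<in> A \<Longrightarrow> k \<noteq> l \<Longrightarrow> h k l \<oplus> h l k = \<zero>"
  shows "(\<Oplus>k\<in>A. \<Oplus>l\<in>A - {k}. h k l) = \<zero>"
  using assms
proof (induction A)
  case (insert a B)
  have cl: "h k l \<in> carrier G" if "k \<in> insert a B" "l \<in> insert a B" "k \<noteq> l" for k l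
    using insert.prems(1) that by blast
  have B: "h a k \<in> carrier G" "h k a \<in> carrier G" "(\<Oplus>l\<in>B - {k}. h k l) \<in> carrier G" if "k \<in> B" for k
    using cl that insert.hyps by (auto intro!: finsum_closed)
  have IH: "(\<Oplus>k\<in>B. \<Oplus>l\<in>B - {k}. h k l) = \<zero>"
    using insert by auto
  have inner: "(\<Oplus>l\<in>insert a B - {k}. h k l) = h k a \<oplus> (\<Oplus>l\<in>B - {k}. h k l)" if "k \<in> B" for k
  proof -
    have "insert a B - {k} = insert a (B - {k})" using that insert.hyps by auto
    then show ?thesis using insert.hyps cl that by (auto intro!: finsum_insert)
  qed
  have row: "(\<Oplus>l\<in>insert a B - {a}. h a l) = (\<Oplus>k\<in>B. h a k)"
    using insert.hyps by simp
  have "(\<Oplus>k\<in>insert a B. \<Oplus>l\<in>insert a B - {k}. h k l)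
      = (\<Oplus>l\<in>insert a B - {a}. h a l) \<oplus> (\<Oplus>k\<in>B. \<Oplus>l\<in>insert a B - {k}. h k l)"
    using insert.hyps cl by (intro finsum_insert) (auto intro!: finsum_closed)
  also have "(\<Oplus>k\<in>B. \<Oplus>l\<in>insert a B - {k}. h k l) = (\<Oplus>k\<in>B. h k a \<oplus> (\<Oplus>l\<in>B - {k}. h k l))"
    by (intro finsum_cong') (use B inner in auto)
  also have "\<dots> = (\<Oplus>k\<in>B. h k a)"
    using B IH by (subst finsum_addf) (auto intro!: r_zero finsum_closed)
  also have "(\<Oplus>l\<in>insert a B - {a}. h a l) \<oplus> (\<Oplus>k\<in>B. h k a) = (\<Oplus>k\<in>B. h a k \<oplus> h k a)"
    unfolding row using B by (subst finsum_addf) auto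
  also have "\<dots> = (\<Oplus>k\<in>B. \<zero>)"
    by (intro finsum_cong') (use insert in auto)
  finally show ?case by simp
qed simp

end

definition additive_map :: "('a, 'b) ring_scheme \<Rightarrow> ('c, 'd) ring_scheme \<Rightarrow> ('a \<Rightarrow> 'c) \<Rightarrow> bool" where
  "additive_map N N' h \<longleftrightarrow> h \<in> carrier N \<rightarrow> carrier N' \<and>
     (\<forall>x\<in>carrier N. \<forall>y\<in>carrier N. h (x \<oplus>\<^bsub>N\<^esub> y) = h x \<oplus>\<^bsub>N'\<^esub> h y)"

lemma additive_mapD:
  assumes "additive_map N N' h"
  shows "x \<in> carrier N \<Longrightarrow> h x \<in> carrier N'"
    and "x \<in> carrier N \<Longrightarrow> y \<in> carrier N \<Longrightarrow> h (x \<oplus>\<^bsub>N\<^esub> y) = h x \<oplus>\<^bsub>N'\<^esub> h y"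
  using assms by (auto simp: additive_map_def)

lemma additive_map_zero:
  assumes "abelian_group N" "abelian_group N'" "additive_map N N' h"
  shows "h \<zero>\<^bsub>N\<^esub> = \<zero>\<^bsub>N'\<^esub>"
proof -
  interpret N: abelian_group N by fact
  interpret N': abelian_group N' by fact
  have "h \<zero>\<^bsub>N\<^esub> \<oplus>\<^bsub>N'\<^esub> h \<zero>\<^bsub>N\<^esub> = h \<zero>\<^bsub>N\<^esub>"
    using additive_mapD(2)[OF assms(3), of "\<zero>\<^bsub>N\<^esub>" "\<zero>\<^bsub>N\<^esub>"] by simp
  then show ?thesis using additive_mapD(1)[OF assms(3), of "\<zero>\<^bsub>N\<^esub>"]
    by (simp add: N'.add.l_cancel_one)
qed

lemma additive_map_minus:
  assumes "abelian_group N" "abelian_group N'" "additive_map N N' h" "x \<in> carrier N"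
  shows "h (\<ominus>\<^bsub>N\<^esub> x) = \<ominus>\<^bsub>N'\<^esub> h x"
proof -
  interpret N: abelian_group N by fact
  interpret N': abelian_group N' by fact
  have "h (\<ominus>\<^bsub>N\<^esub> x) \<oplus>\<^bsub>N'\<^esub> h x = \<zero>\<^bsub>N'\<^esub>"
    using additive_mapD(2)[OF assms(3), of "\<ominus>\<^bsub>N\<^esub> x" x] assms(4) additive_map_zero[OF assms(1-3)]
    by (simp add: N.l_neg)
  then show ?thesis using additive_mapD(1)[OF assms(3)] assms(4)
    by (simp add: N'.minus_equality)
qed

lemma additive_map_signed:
  assumes "abelian_group N" "abelian_group N'" "additive_map N N' h" "x \<in> carrier N"
  shows "h (signed N m x) = signed N' m (h x)"
  using assms by (simp add: signed_def additive_map_minus)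

lemma additive_map_finsum:
  assumes "abelian_group N" "abelian_group N'" "additive_map N N' h" "finite A" "f \<in> A \<rightarrow> carrier N"
  shows "h (\<Oplus>\<^bsub>N\<^esub>a\<in>A. f a) = (\<Oplus>\<^bsub>N'\<^esub>a\<in>A. h (f a))"
proof -
  interpret N: abelian_group N by fact
  interpret N': abelian_group N' by fact
  from assms(4,5) show ?thesis
  proof (induction A)
    case empty
    then show ?case using additive_map_zero[OF assms(1-3)] by simp
  next
    case (insert a A)
    then have f: "f \<in> A \<rightarrow> carrier N" "f a \<in> carrier N" by auto
    have hf: "(\<lambda>a. h (f a)) \<in> A \<rightarrow> carrier N'" "h (f a) \<in> carrier N'"
      using f additive_mapD(1)[OF assms(3)] by auto
    have "h (\<Oplus>\<^bsub>N\<^esub>a\<in>insert a A. f a) = h (f a \<oplus>\<^bsub>N\<^esub> (\<Oplus>\<^bsub>N\<^esub>a\<in>A. f a))"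
      using insert.hyps f by (subst N.finsum_insert) auto
    also have "\<dots> = h (f a) \<oplus>\<^bsub>N'\<^esub> h (\<Oplus>\<^bsub>N\<^esub>a\<in>A. f a)"
      using f by (intro additive_mapD(2)[OF assms(3)]) (auto intro!: N.finsum_closed)
    also have "\<dots> = h (f a) \<oplus>\<^bsub>N'\<^esub> (\<Oplus>\<^bsub>N'\<^esub>a\<in>A. h (f a))"
      using insert.IH f by simp
    also have "\<dots> = (\<Oplus>\<^bsub>N'\<^esub>a\<in>insert a A. h (f a))"
      using insert.hyps hf by (subst N'.finsum_insert) auto
    finally show ?case .
  qed
qed

definition linear_map ::
    "('r, 'c) ring_scheme \<Rightarrow> ('r, 'm, 'd) module_scheme \<Rightarrow> ('r, 'k, 'e) module_scheme \<Rightarrow> ('m \<Rightarrow> 'k) \<Rightarrow> bool" where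
  "linear_map R N N' h \<longleftrightarrow> additive_map N N' h \<and>
     (\<forall>r\<in>carrier R. \<forall>y\<in>carrier N. h (r \<odot>\<^bsub>N\<^esub> y) = r \<odot>\<^bsub>N'\<^esub> h y)"

lemma linear_mapD:
  assumes "linear_map R N N' h"
  shows "additive_map N N' h"
    and "r \<in> carrier R \<Longrightarrow> y \<in> carrier N \<Longrightarrow> h (r \<odot>\<^bsub>N\<^esub> y) = r \<odot>\<^bsub>N'\<^esub> h y"
  using assms by (auto simp: linear_map_def)

lemma (in module) additive_map_smult: "r \<in> carrier R \<Longrightarrow> additive_map M M (\<lambda>y. r \<odot>\<^bsub>M\<^esub> y)"
  by (auto simp: additive_map_def smult_r_distr)

lemma (in module) smult_signed:
  "r \<in> carrier R \<Longrightarrow> y \<in> carrier M \<Longrightarrow> r \<odot>\<^bsub>M\<^esub> signed M m y = signed M m (r \<odot>\<^bsub>M\<^esub> y)"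
  by (simp add: signed_def smult_r_minus)

section \<open>The Koszul complex\<close>

text \<open>The Koszul differential in coordinates: \<open>y I\<close> is the coefficient of the exterior product of the basis
vectors in \<open>I\<close>. One family carries all exterior degrees at once. A family that is supported at \<open>{}\<close> has
differential zero because no set \<open>insert k I\<close> is empty.\<close>
definition koszul_d ::
    "(nat \<Rightarrow> 'r) \<Rightarrow> nat \<Rightarrow> ('r, 'm, 'd) module_scheme \<Rightarrow> (nat set \<Rightarrow> 'm) \<Rightarrow> nat set \<Rightarrow> 'm" where
  "koszul_d x n N y I = (if I \<subseteq> {..<n} then
     \<Oplus>\<^bsub>N\<^esub>k\<in>{..<n} - I. signed N (below k I) (x k \<odot>\<^bsub>N\<^esub> y (insert k I)) else \<zero>\<^bsub>N\<^esub>)"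

locale koszul = module R N for R (structure) and N (structure) +
  fixes n :: nat and x :: "nat \<Rightarrow> 'a"
  assumes x_closed: "k < n \<Longrightarrow> x k \<in> carrier R"
begin

lemma koszul_d_term_closed:
  "y (insert k I) \<in> carrier N \<Longrightarrow> k < n \<Longrightarrow> signed N m (x k \<odot>\<^bsub>N\<^esub> y (insert k I)) \<in> carrier N"
  by (simp add: x_closed)

lemma koszul_d_closed: "(\<And>I. y I \<in> carrier N) \<Longrightarrow> koszul_d x n N y I \<in> carrier N"
  by (auto simp: koszul_d_def intro!: M.finsum_closed koszul_d_term_closed)

lemma koszul_d_add:
  assumes "\<And>I. y I \<in> carrier N" "\<And>I. z I \<in> carrier N"
  shows "koszul_d x n N (\<lambda>I. y I \<oplus>\<^bsub>N\<^esub> z I) I = koszul_d x n N y I \<oplus>\<^bsub>N\<^esub> koszul_d x n N z I"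
proof (cases "I \<subseteq> {..<n}")
  case True
  have "koszul_d x n N (\<lambda>I. y I \<oplus>\<^bsub>N\<^esub> z I) I =
    (\<Oplus>\<^bsub>N\<^esub>k\<in>{..<n} - I. signed N (below k I) (x k \<odot>\<^bsub>N\<^esub> y (insert k I)) \<oplus>\<^bsub>N\<^esub>
       signed N (below k I) (x k \<odot>\<^bsub>N\<^esub> z (insert k I)))"
    using True unfolding koszul_d_def
    by (simp only: if_True, intro M.finsum_cong') (auto simp: smult_r_distr x_closed assms M.signed_add)
  also have "\<dots> = koszul_d x n N y I \<oplus>\<^bsub>N\<^esub> koszul_d x n N z I"
    using True assms unfolding koszul_d_def
    by (subst M.finsum_addf) (auto simp: x_closed)
  finally show ?thesis .
qed (simp add: koszul_d_def)

lemma koszul_d_zero: "koszul_d x n N (\<lambda>_. \<zero>\<^bsub>N\<^esub>) I = \<zero>\<^bsub>N\<^esub>"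
  unfolding koszul_d_def by (auto intro!: M.add.finprod_one_eqI simp: x_closed)

lemma koszul_d_cong: "(\<And>I. y I = z I) \<Longrightarrow> koszul_d x n N y I = koszul_d x n N z I"
  by (simp add: koszul_d_def)

lemma linear_map_koszul_d:
  assumes "module R N'" "linear_map R N N' h" "\<And>I. y I \<in> carrier N"
  shows "h (koszul_d x n N y I) = koszul_d x n N' (\<lambda>I. h (y I)) I"
proof -
  interpret N': module R N' by fact
  note ad = M.abelian_group_axioms N'.abelian_group_axioms linear_mapD(1)[OF assms(2)]
  show ?thesis
  proof (cases "I \<subseteq> {..<n}")
    case True
    have "h (koszul_d x n N y I)
        = (\<Oplus>\<^bsub>N'\<^esub>k\<in>{..<n} - I. h (signed N (below k I) (x k \<odot>\<^bsub>N\<^esub> y (insert k I))))"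
      using True assms(3) unfolding koszul_d_def
      by (auto intro!: additive_map_finsum[OF ad] simp: x_closed)
    also have "\<dots> = koszul_d x n N' (\<lambda>I. h (y I)) I"
      using True assms(3) unfolding koszul_d_def
      by (auto intro!: N'.finsum_cong' simp: x_closed additive_map_signed[OF ad]
          linear_mapD(2)[OF assms(2)] additive_mapD(1)[OF ad(3)])
    finally show ?thesis .
  qed (simp add: koszul_d_def additive_map_zero[OF ad])
qed

lemma koszul_d_smult:
  assumes "r \<in> carrier R" "\<And>I. y I \<in> carrier N"
  shows "r \<odot>\<^bsub>N\<^esub> koszul_d x n N y I = koszul_d x n N (\<lambda>I. r \<odot>\<^bsub>N\<^esub> y I) I"
proof -
  have "linear_map R N N (\<lambda>y. r \<odot>\<^bsub>N\<^esub> y)"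
    using assms(1) by (auto simp: linear_map_def additive_map_smult smult_assoc1[symmetric] R.m_comm)
  then show ?thesis
    using linear_map_koszul_d[of N "\<lambda>y. r \<odot>\<^bsub>N\<^esub> y" y I] assms(2) module_axioms by simp
qed

lemma koszul_d_minus:
  assumes "\<And>I. y I \<in> carrier N"
  shows "koszul_d x n N (\<lambda>I. \<ominus>\<^bsub>N\<^esub> y I) I = \<ominus>\<^bsub>N\<^esub> koszul_d x n N y I"
proof -
  have "koszul_d x n N (\<lambda>I. \<ominus>\<^bsub>N\<^esub> y I) I \<oplus>\<^bsub>N\<^esub> koszul_d x n N y I = \<zero>\<^bsub>N\<^esub>"
    using koszul_d_add[of "\<lambda>I. \<ominus>\<^bsub>N\<^esub> y I" y I] assms koszul_d_zero[of I] by (simp add: M.l_neg)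
  then show ?thesis using assms by (auto intro!: M.minus_equality[symmetric] koszul_d_closed)
qed

lemma koszul_d_finsum:
  assumes "finite A" "\<And>a I. a \<in> A \<Longrightarrow> y a I \<in> carrier N"
  shows "koszul_d x n N (\<lambda>I. \<Oplus>\<^bsub>N\<^esub>a\<in>A. y a I) I = (\<Oplus>\<^bsub>N\<^esub>a\<in>A. koszul_d x n N (y a) I)"
  using assms
proof (induction A)
  case empty
  then show ?case by (simp add: koszul_d_zero)
next
  case (insert a A)
  have "koszul_d x n N (\<lambda>I. \<Oplus>\<^bsub>N\<^esub>a\<in>insert a A. y a I) I = koszul_d x n N (\<lambda>I. y a I \<oplus>\<^bsub>N\<^esub> (\<Oplus>\<^bsub>N\<^esub>a\<in>A. y a I)) I"
    using insert by (intro koszul_d_cong) (auto intro!: M.finsum_insert)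
  also have "\<dots> = koszul_d x n N (y a) I \<oplus>\<^bsub>N\<^esub> (\<Oplus>\<^bsub>N\<^esub>a\<in>A. koszul_d x n N (y a) I)"
    using insert by (subst koszul_d_add) (auto intro!: M.finsum_closed)
  also have "\<dots> = (\<Oplus>\<^bsub>N\<^esub>a\<in>insert a A. koszul_d x n N (y a) I)"
    using insert by (subst M.finsum_insert) (auto intro!: koszul_d_closed)
  finally show ?case .
qed

lemma koszul_d_koszul_d:
  assumes y: "\<And>I. y I \<in> carrier N"
  shows "koszul_d x n N (koszul_d x n N y) I = \<zero>\<^bsub>N\<^esub>"
proof (cases "I \<subseteq> {..<n}")
  case True
  then have fin: "finite I" by (rule finite_subset) simp
  let ?A = "{..<n} - I"
  let ?h = "\<lambda>k l. signed N (below k I + below l (insert k I)) (x k \<odot>\<^bsub>N\<^esub> (x l \<odot>\<^bsub>N\<^esub> y (insert l (insert k I))))"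
  have summand: "signed N (below k I) (x k \<odot>\<^bsub>N\<^esub> koszul_d x n N y (insert k I)) = (\<Oplus>\<^bsub>N\<^esub>l\<in>?A - {k}. ?h k l)"
    if k: "k \<in> ?A" for k
  proof -
    have eq: "{..<n} - insert k I = ?A - {k}" by auto
    have "additive_map N N (\<lambda>z. signed N (below k I) (x k \<odot>\<^bsub>N\<^esub> z))"
      using k by (auto simp: additive_map_def x_closed smult_r_distr M.signed_add)
    note * = additive_map_finsum[OF M.abelian_group_axioms M.abelian_group_axioms this]
    have "signed N (below k I) (x k \<odot>\<^bsub>N\<^esub> koszul_d x n N y (insert k I)) =
      (\<Oplus>\<^bsub>N\<^esub>l\<in>?A - {k}. signed N (below k I) (x k \<odot>\<^bsub>N\<^esub> signed N (below l (insert k I)) (x l \<odot>\<^bsub>N\<^esub> y (insert l (insert k I)))))"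
      using k True y unfolding koszul_d_def eq by (auto intro!: * simp: x_closed)
    also have "\<dots> = (\<Oplus>\<^bsub>N\<^esub>l\<in>?A - {k}. ?h k l)"
      using k y by (auto intro!: M.finsum_cong' simp: x_closed smult_signed M.signed_signed)
    finally show ?thesis .
  qed
  have "koszul_d x n N (koszul_d x n N y) I = (\<Oplus>\<^bsub>N\<^esub>k\<in>?A. \<Oplus>\<^bsub>N\<^esub>l\<in>?A - {k}. ?h k l)"
    using True unfolding koszul_d_def[of x n N "koszul_d x n N y"]
    by (auto intro!: M.finsum_cong' simp: summand x_closed y)
  also have "\<dots> = \<zero>\<^bsub>N\<^esub>"
  proof (rule M.finsum_antisymmetric)
    fix k l assume kl: "k \<in> ?A" "l \<in> ?A" "k \<noteq> l"
    show "?h k l \<in> carrier N" using kl y by (auto simp: x_closed)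
    have eq: "x k \<odot>\<^bsub>N\<^esub> (x l \<odot>\<^bsub>N\<^esub> y (insert l (insert k I))) = x l \<odot>\<^bsub>N\<^esub> (x k \<odot>\<^bsub>N\<^esub> y (insert k (insert l I)))"
      using kl y by (simp add: smult_assoc1[symmetric] x_closed R.m_comm insert_commute)
    show "?h k l \<oplus>\<^bsub>N\<^esub> ?h l k = \<zero>\<^bsub>N\<^esub>"
      unfolding eq using kl y fin
      by (intro M.signed_Suc_cancel) (auto simp: x_closed below_insert)
  qed auto
  finally show ?thesis .
qed (simp add: koszul_d_def)

text \<open>The exterior product with the \<open>l\<close>-th basis vector is a homotopy between multiplication by \<open>x l\<close> and
zero. On a cycle one half of the homotopy formula vanishes and this identity is left.\<close>
lemma koszul_d_contraction:
  assumes y: "\<And>I. y I \<in> carrier N" and l: "l < n" and I: "I \<subseteq> {..<n}"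
    and cycle: "\<And>I. koszul_d x n N y I = \<zero>\<^bsub>N\<^esub>"
  defines "w \<equiv> \<lambda>J. if l \<in> J then signed N (below l J) (y (J - {l})) else \<zero>\<^bsub>N\<^esub>"
  shows "koszul_d x n N w I = x l \<odot>\<^bsub>N\<^esub> y I"
proof -
  have fin: "finite I" using I by (rule finite_subset) simp
  have w: "w J \<in> carrier N" for J by (simp add: w_def y)
  show ?thesis
  proof (cases "l \<in> I")
    case False
    have diag: "signed N (below k I) (x k \<odot>\<^bsub>N\<^esub> w (insert k I)) = (if k = l then x l \<odot>\<^bsub>N\<^esub> y I else \<zero>\<^bsub>N\<^esub>)"
      if k: "k \<in> {..<n} - I" for k
    proof (cases "k = l")
      case True
      then show ?thesis using False y l fin
        by (simp add: w_def smult_signed M.signed_signed x_closed below_insert) (simp add: signed_def)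
    qed (use k False in \<open>simp add: w_def x_closed\<close>)
    have "koszul_d x n N w I = (\<Oplus>\<^bsub>N\<^esub>k\<in>{..<n} - I. if k = l then x l \<odot>\<^bsub>N\<^esub> y I else \<zero>\<^bsub>N\<^esub>)"
      using I diag l y unfolding koszul_d_def by (simp only: if_True, intro M.finsum_cong') (auto simp: x_closed)
    also have "\<dots> = x l \<odot>\<^bsub>N\<^esub> y I"
      using M.add.finprod_singleton_swap[of l "{..<n} - I" "\<lambda>_. x l \<odot>\<^bsub>N\<^esub> y I"] l False y
      by (simp add: x_closed)
    finally show ?thesis .
  next
    case True
    \<comment> \<open>The cycle equation at \<open>I - {l}\<close>, with its summand for \<open>l\<close> split off, is the claim up to a sign.\<close>
    let ?J = "I - {l}"
    let ?g = "\<lambda>k. signed N (below k ?J) (x k \<odot>\<^bsub>N\<^esub> y (insert k ?J))"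
    have J: "{..<n} - ?J = insert l ({..<n} - I)" "?J \<subseteq> {..<n}" using True l I by auto
    have g: "?g \<in> {..<n} - I \<rightarrow> carrier N" "?g l \<in> carrier N" using y l by (auto simp: x_closed)
    have "\<zero>\<^bsub>N\<^esub> = koszul_d x n N y ?J" by (simp add: cycle)
    also have "\<dots> = ?g l \<oplus>\<^bsub>N\<^esub> (\<Oplus>\<^bsub>N\<^esub>k\<in>{..<n} - I. ?g k)"
      unfolding koszul_d_def J(1) using J(2) True g by (subst M.finsum_insert) auto
    finally have z: "?g l \<oplus>\<^bsub>N\<^esub> (\<Oplus>\<^bsub>N\<^esub>k\<in>{..<n} - I. ?g k) = \<zero>\<^bsub>N\<^esub>" ..
    have "koszul_d x n N w I = (\<Oplus>\<^bsub>N\<^esub>k\<in>{..<n} - I. signed N (Suc (below l ?J)) (?g k))"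
    proof -
      have "signed N (below k I) (x k \<odot>\<^bsub>N\<^esub> w (insert k I)) = signed N (Suc (below l ?J)) (?g k)"
        if k: "k \<in> {..<n} - I" for k
      proof -
        have ne: "k \<noteq> l" using k True by auto
        have 1: "insert k I - {l} = insert k ?J" using ne by auto
        have 2: "signed N (below k I + below l (insert k I)) z = signed N (Suc (below l ?J) + below k ?J) z" for z
          using below_remove[OF fin True, of k] below_remove[OF fin True, of l] below_insert[OF fin, of k l] k ne
          by (auto simp: signed_def)
        show ?thesis
          using k True y by (simp add: w_def smult_signed M.signed_signed x_closed 1 2)
      qed
      then show ?thesis using I y unfolding koszul_d_def by (auto intro!: M.finsum_cong' simp: x_closed)
    qed
    also have "\<dots> = signed N (Suc (below l ?J)) (\<Oplus>\<^bsub>N\<^esub>k\<in>{..<n} - I. ?g k)"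
    proof -
      have "additive_map N N (signed N (Suc (below l ?J)))"
        by (auto simp: additive_map_def M.signed_add)
      from additive_map_finsum[OF M.abelian_group_axioms M.abelian_group_axioms this _ g(1)]
      show ?thesis by simp
    qed
    also have "(\<Oplus>\<^bsub>N\<^esub>k\<in>{..<n} - I. ?g k) = \<ominus>\<^bsub>N\<^esub> ?g l"
    proof (rule M.minus_equality[symmetric])
      have "(\<Oplus>\<^bsub>N\<^esub>k\<in>{..<n} - I. ?g k) \<in> carrier N" using g(1) by (rule M.finsum_closed)
      then show "(\<Oplus>\<^bsub>N\<^esub>k\<in>{..<n} - I. ?g k) \<oplus>\<^bsub>N\<^esub> ?g l = \<zero>\<^bsub>N\<^esub>" "(\<Oplus>\<^bsub>N\<^esub>k\<in>{..<n} - I. ?g k) \<in> carrier N"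
        using z g(2) by (simp_all only: M.a_comm)
    qed (rule g(2))
    also have "signed N (Suc (below l ?J)) (\<ominus>\<^bsub>N\<^esub> ?g l) = x l \<odot>\<^bsub>N\<^esub> y I"
      using True l y by (simp add: signed_def insert_absorb x_closed)
    finally show ?thesis .
  qed
qed

end

text \<open>The part of exterior degree \<open>q\<close> and degree \<open>\<mu>\<close>. A chain is zero off its index sets, so that chains
are equal as soon as they are equal as functions.\<close>
definition koszul_chains ::
    "nat \<Rightarrow> (nat \<Rightarrow> 'g::ab_group_add) \<Rightarrow> ('r, 'm, 'g) gmodule \<Rightarrow> 'g \<Rightarrow> nat \<Rightarrow> (nat set \<Rightarrow> 'm) set" where
  "koszul_chains n \<gamma> N \<mu> q = {y. \<forall>I. if I \<subseteq> {..<n} \<and> card I = q then y I \<in> grade N (\<mu> - sum \<gamma> I) else y I = \<zero>\<^bsub>N\<^esub>}"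

lemma koszul_chainsI:
  assumes "\<And>I. I \<subseteq> {..<n} \<Longrightarrow> card I = q \<Longrightarrow> y I \<in> grade N (\<mu> - sum \<gamma> I)"
    and "\<And>I. \<not> (I \<subseteq> {..<n} \<and> card I = q) \<Longrightarrow> y I = \<zero>\<^bsub>N\<^esub>"
  shows "y \<in> koszul_chains n \<gamma> N \<mu> q"
  using assms by (auto simp: koszul_chains_def)

lemma koszul_chainsD:
  assumes "y \<in> koszul_chains n \<gamma> N \<mu> q"
  shows "I \<subseteq> {..<n} \<Longrightarrow> card I = q \<Longrightarrow> y I \<in> grade N (\<mu> - sum \<gamma> I)"
    and "\<not> (I \<subseteq> {..<n} \<and> card I = q) \<Longrightarrow> y I = \<zero>\<^bsub>N\<^esub>"
  using assms unfolding koszul_chains_def by (auto split: if_splits)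

definition koszul_exact ::
    "(nat \<Rightarrow> 'r) \<Rightarrow> nat \<Rightarrow> (nat \<Rightarrow> 'g::ab_group_add) \<Rightarrow> ('r, 'm, 'g) gmodule \<Rightarrow> 'g \<Rightarrow> nat \<Rightarrow> bool" where
  "koszul_exact x n \<gamma> N \<mu> q \<longleftrightarrow> (\<forall>y\<in>koszul_chains n \<gamma> N \<mu> q. (\<forall>I. koszul_d x n N y I = \<zero>\<^bsub>N\<^esub>) \<longrightarrow>
     (\<exists>w\<in>koszul_chains n \<gamma> N \<mu> (Suc q). \<forall>I. y I = koszul_d x n N w I))"

text \<open>All that is used of a grading are additive projections onto the homogeneous parts which are compatible
with the action of the variables. In this form a grading passes directly to localizations and to
finite products.\<close>
locale graded_koszul = koszul R N n x for R and N :: "('r, 'm, 'g::ab_group_add) gmodule" and n x +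
  fixes \<gamma> :: "nat \<Rightarrow> 'g" and \<pi> :: "'g \<Rightarrow> 'm \<Rightarrow> 'm"
  assumes \<pi>_additive: "additive_map N N (\<pi> \<nu>)"
    and \<pi>_grade: "y \<in> carrier N \<Longrightarrow> \<pi> \<nu> y \<in> grade N \<nu>"
    and grade_carrier: "y \<in> grade N \<nu> \<Longrightarrow> y \<in> carrier N"
    and \<pi>_id: "y \<in> grade N \<nu> \<Longrightarrow> \<pi> \<nu> y = y"
    and \<pi>_shift: "k < n \<Longrightarrow> y \<in> carrier N \<Longrightarrow> x k \<odot>\<^bsub>N\<^esub> \<pi> \<nu> y = \<pi> (\<gamma> k + \<nu>) (x k \<odot>\<^bsub>N\<^esub> y)"
begin

lemma \<pi>_closed: "y \<in> carrier N \<Longrightarrow> \<pi> \<nu> y \<in> carrier N"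
  using \<pi>_grade grade_carrier by blast

lemma grade_iff: "y \<in> grade N \<nu> \<longleftrightarrow> y \<in> carrier N \<and> \<pi> \<nu> y = y"
  using \<pi>_grade grade_carrier \<pi>_id by metis

lemma \<pi>_zero: "\<pi> \<nu> \<zero>\<^bsub>N\<^esub> = \<zero>\<^bsub>N\<^esub>"
  by (rule additive_map_zero[OF M.abelian_group_axioms M.abelian_group_axioms \<pi>_additive])

lemma grade_zero: "\<zero>\<^bsub>N\<^esub> \<in> grade N \<nu>"
  by (simp add: grade_iff \<pi>_zero)

lemma grade_diff: "y \<in> grade N \<nu> \<Longrightarrow> z \<in> grade N \<nu> \<Longrightarrow> y \<ominus>\<^bsub>N\<^esub> z \<in> grade N \<nu>"
  by (simp add: grade_iff a_minus_def additive_mapD(2)[OF \<pi>_additive]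
      additive_map_minus[OF M.abelian_group_axioms M.abelian_group_axioms \<pi>_additive])

lemma koszul_chains_carrier: "y \<in> koszul_chains n \<gamma> N \<mu> q \<Longrightarrow> y I \<in> carrier N"
  using koszul_chainsD[of y n \<gamma> N \<mu> q I] grade_carrier by fastforce

lemma koszul_chains_zero: "(\<lambda>_. \<zero>\<^bsub>N\<^esub>) \<in> koszul_chains n \<gamma> N \<mu> q"
  by (rule koszul_chainsI) (simp_all add: grade_zero)

lemma koszul_chains_diff:
  assumes "y \<in> koszul_chains n \<gamma> N \<mu> q" "z \<in> koszul_chains n \<gamma> N \<mu> q"
  shows "(\<lambda>I. y I \<ominus>\<^bsub>N\<^esub> z I) \<in> koszul_chains n \<gamma> N \<mu> q"
  using koszul_chainsD[OF assms(1)] koszul_chainsD[OF assms(2)]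
  by (intro koszul_chainsI) (simp_all add: grade_diff a_minus_def[of N "\<zero>\<^bsub>N\<^esub>"])

text \<open>The differential preserves the total degree: \<open>x k\<close> raises the degree by \<open>\<gamma> k\<close>, which makes up for the
basis vector that is lost.\<close>
lemma koszul_d_project:
  assumes w: "\<And>I. w I \<in> carrier N"
  shows "koszul_d x n N (\<lambda>J. if J \<subseteq> {..<n} \<and> card J = Suc q then \<pi> (\<mu> - sum \<gamma> J) (w J) else \<zero>\<^bsub>N\<^esub>) I =
    (if I \<subseteq> {..<n} \<and> card I = q then \<pi> (\<mu> - sum \<gamma> I) (koszul_d x n N w I) else \<zero>\<^bsub>N\<^esub>)"
    (is "koszul_d x n N ?w' I = _")
proof (cases "I \<subseteq> {..<n}")
  case True
  then have fin: "finite I" by (rule finite_subset) simp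
  show ?thesis
  proof (cases "card I = q")
    case card: True
    have "koszul_d x n N ?w' I
        = (\<Oplus>\<^bsub>N\<^esub>k\<in>{..<n} - I. \<pi> (\<mu> - sum \<gamma> I) (signed N (below k I) (x k \<odot>\<^bsub>N\<^esub> w (insert k I))))"
      unfolding koszul_d_def
    proof (simp only: True if_True, intro M.finsum_cong')
      fix k assume k: "k \<in> {..<n} - I"
      have deg: "\<gamma> k + (\<mu> - sum \<gamma> (insert k I)) = \<mu> - sum \<gamma> I"
        using k fin by (simp add: algebra_simps)
      have "x k \<odot>\<^bsub>N\<^esub> ?w' (insert k I) = \<pi> (\<mu> - sum \<gamma> I) (x k \<odot>\<^bsub>N\<^esub> w (insert k I))"
        using k True fin card w \<pi>_shift[of k "w (insert k I)" "\<mu> - sum \<gamma> (insert k I)"] by (simp add: deg)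
      then show "signed N (below k I) (x k \<odot>\<^bsub>N\<^esub> ?w' (insert k I)) =
          \<pi> (\<mu> - sum \<gamma> I) (signed N (below k I) (x k \<odot>\<^bsub>N\<^esub> w (insert k I)))"
        using k w additive_map_signed[OF M.abelian_group_axioms M.abelian_group_axioms \<pi>_additive]
        by (simp add: x_closed)
    qed (use w in \<open>auto simp: x_closed intro!: \<pi>_closed\<close>)
    also have "\<dots> = \<pi> (\<mu> - sum \<gamma> I) (koszul_d x n N w I)"
      using True w unfolding koszul_d_def
      by (simp, intro additive_map_finsum[OF M.abelian_group_axioms M.abelian_group_axioms \<pi>_additive, symmetric])
        (auto simp: x_closed)
    finally show ?thesis using True card by simp
  next
    case False
    have "koszul_d x n N ?w' I = (\<Oplus>\<^bsub>N\<^esub>k\<in>{..<n} - I. \<zero>\<^bsub>N\<^esub>)"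
      unfolding koszul_d_def using True False fin
      by (simp only: True if_True, intro M.finsum_cong') (auto simp: x_closed)
    then show ?thesis using False by simp
  qed
qed (simp add: koszul_d_def)

lemma koszul_d_koszul_chains:
  assumes "w \<in> koszul_chains n \<gamma> N \<mu> (Suc q)"
  shows "koszul_d x n N w \<in> koszul_chains n \<gamma> N \<mu> q"
proof -
  have "w J = (if J \<subseteq> {..<n} \<and> card J = Suc q then \<pi> (\<mu> - sum \<gamma> J) (w J) else \<zero>\<^bsub>N\<^esub>)" for J
    using koszul_chainsD[OF assms, of J] \<pi>_id by auto
  then have "koszul_d x n N w I = koszul_d x n N (\<lambda>J. if J \<subseteq> {..<n} \<and> card J = Suc q then \<pi> (\<mu> - sum \<gamma> J) (w J) else \<zero>\<^bsub>N\<^esub>) I" for I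
    by (rule koszul_d_cong)
  then have "koszul_d x n N w I = (if I \<subseteq> {..<n} \<and> card I = q then \<pi> (\<mu> - sum \<gamma> I) (koszul_d x n N w I) else \<zero>\<^bsub>N\<^esub>)" for I
    unfolding koszul_d_project[of w q \<mu>, OF koszul_chains_carrier[OF assms]] .
  then show ?thesis
    using koszul_d_closed[of w, OF koszul_chains_carrier[OF assms]] \<pi>_grade by (intro koszul_chainsI) metis+
qed

lemma homogeneous_koszul_d_preimage:
  assumes y: "y \<in> koszul_chains n \<gamma> N \<mu> q" and w: "\<And>I. w I \<in> carrier N" and yw: "\<And>I. y I = koszul_d x n N w I"
  shows "\<exists>w'\<in>koszul_chains n \<gamma> N \<mu> (Suc q). \<forall>I. y I = koszul_d x n N w' I"
proof (intro bexI allI)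
  let ?w' = "\<lambda>J. if J \<subseteq> {..<n} \<and> card J = Suc q then \<pi> (\<mu> - sum \<gamma> J) (w J) else \<zero>\<^bsub>N\<^esub>"
  show "y I = koszul_d x n N ?w' I" for I
    unfolding koszul_d_project[of w q \<mu>, OF w] yw[symmetric] using koszul_chainsD[OF y, of I] \<pi>_id by auto
  show "?w' \<in> koszul_chains n \<gamma> N \<mu> (Suc q)"
    using w \<pi>_grade by (intro koszul_chainsI) auto
qed

text \<open>Exactness in a given degree follows from exactness without regard to degrees, since the preimage may be
projected.\<close>
lemma koszul_exactI:
  assumes "\<And>y. y \<in> koszul_chains n \<gamma> N \<mu> q \<Longrightarrow> (\<And>I. koszul_d x n N y I = \<zero>\<^bsub>N\<^esub>) \<Longrightarrow>
    \<exists>w. (\<forall>I. w I \<in> carrier N) \<and> (\<forall>I. y I = koszul_d x n N w I)"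
  shows "koszul_exact x n \<gamma> N \<mu> q"
  unfolding koszul_exact_def using assms homogeneous_koszul_d_preimage by (metis (no_types, lifting))

end

lemma koszul_chains_map:
  assumes "\<And>\<nu>. h ` grade N \<nu> \<subseteq> grade N' \<nu>" "h \<zero>\<^bsub>N\<^esub> = \<zero>\<^bsub>N'\<^esub>" "y \<in> koszul_chains n \<gamma> N \<mu> q"
  shows "(\<lambda>I. h (y I)) \<in> koszul_chains n \<gamma> N' \<mu> q"
  using assms koszul_chainsD[OF assms(3)] by (intro koszul_chainsI) (auto simp: image_subset_iff)

definition graded_map ::
    "('m, 'b) ring_scheme \<Rightarrow> ('g \<Rightarrow> 'm \<Rightarrow> 'm) \<Rightarrow> ('g \<Rightarrow> 'k \<Rightarrow> 'k) \<Rightarrow> ('m \<Rightarrow> 'k) \<Rightarrow> bool" where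
  "graded_map N \<pi> \<pi>' h \<longleftrightarrow> (\<forall>\<nu>. \<forall>y\<in>carrier N. \<pi>' \<nu> (h y) = h (\<pi> \<nu> y))"

lemma graded_map_grade:
  assumes "graded_koszul R N n x \<gamma> \<pi>" "graded_koszul R N' n x \<gamma> \<pi>'"
    and "additive_map N N' h" "graded_map N \<pi> \<pi>' h"
  shows "h ` grade N \<nu> \<subseteq> grade N' \<nu>"
  using assms additive_mapD(1)[OF assms(3)]
  by (auto simp: graded_koszul.grade_iff graded_map_def)

lemma homogeneous_preimage:
  assumes "graded_koszul R N n x \<gamma> \<pi>" "graded_koszul R N' n x \<gamma> \<pi>'"
    and "additive_map N N' h" "graded_map N \<pi> \<pi>' h"
    and z: "z \<in> koszul_chains n \<gamma> N' \<mu> q" and im: "\<And>I. z I \<in> h ` carrier N"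
  shows "\<exists>v\<in>koszul_chains n \<gamma> N \<mu> q. \<forall>I. z I = h (v I)"
proof -
  interpret N: graded_koszul R N n x \<gamma> \<pi> by fact
  interpret N': graded_koszul R N' n x \<gamma> \<pi>' by fact
  obtain v where v: "\<And>I. v I \<in> carrier N" "\<And>I. z I = h (v I)"
    using im unfolding image_iff by metis
  let ?v = "\<lambda>I. if I \<subseteq> {..<n} \<and> card I = q then \<pi> (\<mu> - sum \<gamma> I) (v I) else \<zero>\<^bsub>N\<^esub>"
  have "z I = h (?v I)" for I
  proof (cases "I \<subseteq> {..<n} \<and> card I = q")
    case True
    then have "z I = \<pi>' (\<mu> - sum \<gamma> I) (h (v I))"
      using koszul_chainsD(1)[OF z] N'.\<pi>_id v(2) by metis
    then show ?thesis using True assms(4) v(1) by (simp add: graded_map_def)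
  next
    case False
    then show ?thesis using koszul_chainsD(2)[OF z]
        additive_map_zero[OF N.M.abelian_group_axioms N'.M.abelian_group_axioms assms(3)] by auto
  qed
  moreover have "?v \<in> koszul_chains n \<gamma> N \<mu> q"
    using v N.\<pi>_grade by (intro koszul_chainsI) auto
  ultimately show ?thesis by (intro bexI[of _ ?v]) simp_all
qed

text \<open>One step of a chase in a double complex with rows \<open>N0 \<longrightarrow> P \<longrightarrow> T\<close>, exact at \<open>P\<close>, and Koszul complexes as
columns. The image of \<open>y\<close> in \<open>T\<close> is the boundary of \<open>y'\<close>, and \<open>y'\<close> is already known to be a boundary
plus the image of some \<open>v'\<close>. Then \<open>y\<close> and the boundary of \<open>v'\<close> have the same image in \<open>T\<close>, and their
difference comes from \<open>N0\<close>.\<close>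
lemma staircase_step:
  fixes N0 :: "('r, 'm0, 'g::ab_group_add) gmodule" and P :: "('r, 'm1, 'g) gmodule"
    and T :: "('r, 'm2, 'g) gmodule"
  assumes P: "graded_koszul R P n x \<gamma> \<pi>" and T: "koszul R T n x"
    and h: "linear_map R P T h"
    and exact: "\<And>z. z \<in> koszul_chains n \<gamma> P \<mu> q \<Longrightarrow> (\<And>I. h (z I) = \<zero>\<^bsub>T\<^esub>) \<Longrightarrow>
      \<exists>v\<in>koszul_chains n \<gamma> N0 \<mu> q. \<forall>I. z I = h0 (v I)"
    and y: "y \<in> koszul_chains n \<gamma> P \<mu> q"
    and y': "\<And>I. h (y I) = koszul_d x n T y' I"
    and w': "\<And>I. w' I \<in> carrier T" and v': "v' \<in> koszul_chains n \<gamma> P \<mu> (Suc q)"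
    and y'_eq: "\<And>I. y' I = koszul_d x n T w' I \<oplus>\<^bsub>T\<^esub> h (v' I)"
  shows "\<exists>w\<in>koszul_chains n \<gamma> P \<mu> (Suc q). \<exists>v\<in>koszul_chains n \<gamma> N0 \<mu> q. \<forall>I. y I = koszul_d x n P w I \<oplus>\<^bsub>P\<^esub> h0 (v I)"
proof -
  interpret P: graded_koszul R P n x \<gamma> \<pi> by fact
  interpret T: koszul R T n x by fact
  note ad = P.M.abelian_group_axioms T.M.abelian_group_axioms linear_mapD(1)[OF h]
  let ?z = "\<lambda>I. y I \<ominus>\<^bsub>P\<^esub> koszul_d x n P v' I"
  have v'c: "v' I \<in> carrier P" and yc: "y I \<in> carrier P" for I
    using v' y P.koszul_chains_carrier by auto
  have hv': "h (v' I) \<in> carrier T" for I using v'c additive_mapD(1)[OF ad(3)] by auto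
  have "h (?z I) = \<zero>\<^bsub>T\<^esub>" for I
  proof -
    have "h (?z I) = h (y I) \<ominus>\<^bsub>T\<^esub> h (koszul_d x n P v' I)"
      using yc P.koszul_d_closed[of v' I, OF v'c]
      by (simp add: a_minus_def additive_mapD(2)[OF ad(3)] additive_map_minus[OF ad])
    also have "h (koszul_d x n P v' I) = koszul_d x n T (\<lambda>I. h (v' I)) I"
      by (rule P.linear_map_koszul_d[of T h v' I, OF T.module_axioms h v'c])
    also have "h (y I) = koszul_d x n T (koszul_d x n T w') I \<oplus>\<^bsub>T\<^esub> koszul_d x n T (\<lambda>I. h (v' I)) I"
      unfolding y' by (subst T.koszul_d_add[symmetric]) (auto simp: w' T.koszul_d_closed hv' y'_eq intro!: T.koszul_d_cong)
    also have "koszul_d x n T (koszul_d x n T w') I = \<zero>\<^bsub>T\<^esub>"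
      by (rule T.koszul_d_koszul_d[of w' I, OF w'])
    finally show ?thesis using T.koszul_d_closed[of "\<lambda>I. h (v' I)" I] hv' by (simp add: a_minus_def T.M.r_neg)
  qed
  moreover have "?z \<in> koszul_chains n \<gamma> P \<mu> q"
    by (intro P.koszul_chains_diff y P.koszul_d_koszul_chains v')
  ultimately obtain v where v: "v \<in> koszul_chains n \<gamma> N0 \<mu> q" "\<And>I. ?z I = h0 (v I)"
    using exact[of ?z] by auto
  have "y I = koszul_d x n P v' I \<oplus>\<^bsub>P\<^esub> h0 (v I)" for I
    using v(2)[of I, symmetric] yc[of I] P.koszul_d_closed[of v' I, OF v'c]
    by (simp add: a_minus_def P.M.a_ac P.M.r_neg)
  then show ?thesis using v(1) v' by blast
qed

text \<open>The ring elements that multiply a given cycle into the boundaries form an ideal, and by contraction the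
elements \<open>x l\<close> belong to it.\<close>
lemma (in koszul) ideal_kills_koszul_cycles:
  assumes y: "\<And>I. y I \<in> carrier N" "\<And>I. \<not> I \<subseteq> {..<n} \<Longrightarrow> y I = \<zero>\<^bsub>N\<^esub>"
    and cycle: "\<And>I. koszul_d x n N y I = \<zero>\<^bsub>N\<^esub>"
    and r: "r \<in> Idl\<^bsub>R\<^esub> (x ` {..<n})"
  shows "\<exists>w. (\<forall>I. w I \<in> carrier N) \<and> (\<forall>I. r \<odot>\<^bsub>N\<^esub> y I = koszul_d x n N w I)"
proof -
  define bounds where "bounds r w \<longleftrightarrow> (\<forall>I. w I \<in> carrier N) \<and> (\<forall>I. r \<odot>\<^bsub>N\<^esub> y I = koszul_d x n N w I)" for r w
  define J where "J = {r \<in> carrier R. \<exists>w. bounds r w}"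
  have add: "bounds (r \<oplus> s) (\<lambda>I. u I \<oplus>\<^bsub>N\<^esub> w I)"
    if "r \<in> carrier R" "s \<in> carrier R" "bounds r u" "bounds s w" for r s u w
    using that by (auto simp: bounds_def y smult_l_distr koszul_d_add)
  have mul: "bounds (s \<otimes> r) (\<lambda>I. s \<odot>\<^bsub>N\<^esub> w I)"
    if "r \<in> carrier R" "s \<in> carrier R" "bounds r w" for r s w
    using that by (auto simp: bounds_def y smult_assoc1 koszul_d_smult)
  have "ideal J R"
  proof (rule idealI)
    show "subgroup J (add_monoid R)"
    proof (rule R.add.subgroupI)
      show "J \<subseteq> carrier R" by (auto simp: J_def)
      have "bounds \<zero> (\<lambda>_. \<zero>\<^bsub>N\<^esub>)" by (simp add: bounds_def y koszul_d_zero)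
      then show "J \<noteq> {}" by (auto simp: J_def)
      show "r \<oplus> s \<in> J" if "r \<in> J" "s \<in> J" for r s
        using that add unfolding J_def by blast
      have "bounds (\<ominus> r) (\<lambda>I. (\<ominus> \<one>) \<odot>\<^bsub>N\<^esub> w I)" if "r \<in> carrier R" "bounds r w" for r w
        using mul[of r "\<ominus> \<one>" w] that by (simp add: R.l_minus)
      then show "\<ominus> r \<in> J" if "r \<in> J" for r
        using that unfolding J_def by blast
    qed
    show "s \<otimes> r \<in> J" if "r \<in> J" "s \<in> carrier R" for r s
      using that mul unfolding J_def by blast
    then show "r \<otimes> s \<in> J" if "r \<in> J" "s \<in> carrier R" for r s
      using that by (simp add: J_def R.m_comm)
  qed (rule R.ring_axioms)
  moreover have "x ` {..<n} \<subseteq> J"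
  proof clarsimp
    fix l assume l: "l < n"
    let ?w = "\<lambda>J. if l \<in> J then signed N (below l J) (y (J - {l})) else \<zero>\<^bsub>N\<^esub>"
    have "x l \<odot>\<^bsub>N\<^esub> y I = koszul_d x n N ?w I" for I
    proof (cases "I \<subseteq> {..<n}")
      case True
      then show ?thesis using koszul_d_contraction[of y l I] y(1) l cycle by simp
    qed (simp add: koszul_d_def y(2) l x_closed)
    then have "bounds (x l) ?w" by (auto simp: bounds_def y(1))
    then show "x l \<in> J" using l x_closed by (auto simp: J_def)
  qed
  ultimately have "Idl\<^bsub>R\<^esub> (x ` {..<n}) \<subseteq> J" by (rule R.genideal_minimal)
  then show ?thesis using r unfolding J_def bounds_def by blast
qed

text \<open>If \<open>f\<close> acts bijectively, then a cycle is \<open>f\<close> times another cycle, and \<open>f\<close> multiplies that one into the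
boundaries.\<close>
lemma (in koszul) koszul_cycle_is_boundary_if_bij:
  assumes y: "\<And>I. y I \<in> carrier N" "\<And>I. \<not> I \<subseteq> {..<n} \<Longrightarrow> y I = \<zero>\<^bsub>N\<^esub>"
    and cycle: "\<And>I. koszul_d x n N y I = \<zero>\<^bsub>N\<^esub>"
    and f: "f \<in> Idl\<^bsub>R\<^esub> (x ` {..<n})" "f \<in> carrier R"
    and surj: "\<And>z. z \<in> carrier N \<Longrightarrow> \<exists>u\<in>carrier N. f \<odot>\<^bsub>N\<^esub> u = z"
    and inj: "\<And>u. u \<in> carrier N \<Longrightarrow> f \<odot>\<^bsub>N\<^esub> u = \<zero>\<^bsub>N\<^esub> \<Longrightarrow> u = \<zero>\<^bsub>N\<^esub>"
  shows "\<exists>w. (\<forall>I. w I \<in> carrier N) \<and> (\<forall>I. y I = koszul_d x n N w I)"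
proof -
  obtain u where u: "\<And>I. u I \<in> carrier N" "\<And>I. f \<odot>\<^bsub>N\<^esub> u I = y I"
    using surj[OF y(1)] by metis
  have "koszul_d x n N u I = \<zero>\<^bsub>N\<^esub>" for I
    using inj[OF koszul_d_closed[of u I, OF u(1)]] koszul_d_smult[of f u I] f(2) u cycle[of I] by simp
  moreover have "u I = \<zero>\<^bsub>N\<^esub>" if "\<not> I \<subseteq> {..<n}" for I
    using inj u y(2)[OF that] by simp
  ultimately show ?thesis using ideal_kills_koszul_cycles[of u f, OF u(1)] f(1) u(2) by simp
qed


section \<open>Homogeneous components\<close>
definition component :: "('a, 'b) ring_scheme \<Rightarrow> ('g \<Rightarrow> 'a set) \<Rightarrow> 'a \<Rightarrow> 'g \<Rightarrow> 'a" where
  "component A D x = (THE c. (\<forall>\<gamma>. c \<gamma> \<in> D \<gamma>) \<and> finite {\<gamma>. c \<gamma> \<noteq> \<zero>\<^bsub>A\<^esub>} \<and>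
     x = (\<Oplus>\<^bsub>A\<^esub>\<gamma>\<in>{\<gamma>. c \<gamma> \<noteq> \<zero>\<^bsub>A\<^esub>}. c \<gamma>))"

lemma (in abelian_group) finsum_support:
  assumes "finite B" "{b. c b \<noteq> \<zero>} \<subseteq> B" "\<And>b. c b \<in> carrier G"
  shows "(\<Oplus>b\<in>{b. c b \<noteq> \<zero>}. c b) = (\<Oplus>b\<in>B. c b)"
  using assms by (intro add.finprod_mono_neutral_cong_left) auto

context
  fixes A :: "('a, 'b) ring_scheme" and D :: "'g \<Rightarrow> 'a set"
  assumes grp: "abelian_group A" and dec: "direct_decomposition A D"
begin

interpretation A: abelian_group A by (rule grp)

lemma decomposition_carrier: "y \<in> D \<nu> \<Longrightarrow> y \<in> carrier A"
  using dec additive_subgroup.a_subset unfolding direct_decomposition_def by fastforce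

lemma decomposition_zero: "\<zero>\<^bsub>A\<^esub> \<in> D \<nu>"
  using dec additive_subgroup.zero_closed unfolding direct_decomposition_def by metis

lemma component_ex1:
  assumes "x \<in> carrier A"
  shows "\<exists>!c. (\<forall>\<gamma>. c \<gamma> \<in> D \<gamma>) \<and> finite {\<gamma>. c \<gamma> \<noteq> \<zero>\<^bsub>A\<^esub>} \<and> x = (\<Oplus>\<^bsub>A\<^esub>\<gamma>\<in>{\<gamma>. c \<gamma> \<noteq> \<zero>\<^bsub>A\<^esub>}. c \<gamma>)"
  using dec assms unfolding direct_decomposition_def by blast

lemma component:
  assumes "x \<in> carrier A"
  shows "component A D x \<nu> \<in> D \<nu>" "finite {\<gamma>. component A D x \<gamma> \<noteq> \<zero>\<^bsub>A\<^esub>}"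
    "x = (\<Oplus>\<^bsub>A\<^esub>\<gamma>\<in>{\<gamma>. component A D x \<gamma> \<noteq> \<zero>\<^bsub>A\<^esub>}. component A D x \<gamma>)"
  using theI'[OF component_ex1[OF assms]] unfolding component_def by blast+

lemma component_sum:
  assumes "x \<in> carrier A" "finite B" "{\<gamma>. component A D x \<gamma> \<noteq> \<zero>\<^bsub>A\<^esub>} \<subseteq> B"
  shows "x = (\<Oplus>\<^bsub>A\<^esub>\<gamma>\<in>B. component A D x \<gamma>)"
  using A.finsum_support[OF assms(2,3)] component[OF assms(1)] decomposition_carrier by metis

lemma component_unique:
  assumes x: "x \<in> carrier A" and c: "\<And>\<gamma>. c \<gamma> \<in> D \<gamma>" and B: "finite B" "{\<gamma>. c \<gamma> \<noteq> \<zero>\<^bsub>A\<^esub>} \<subseteq> B"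
    and sum: "x = (\<Oplus>\<^bsub>A\<^esub>\<gamma>\<in>B. c \<gamma>)"
  shows "component A D x = c"
proof -
  have "finite {\<gamma>. c \<gamma> \<noteq> \<zero>\<^bsub>A\<^esub>}" using B by (rule finite_subset[rotated])
  moreover have "x = (\<Oplus>\<^bsub>A\<^esub>\<gamma>\<in>{\<gamma>. c \<gamma> \<noteq> \<zero>\<^bsub>A\<^esub>}. c \<gamma>)"
    unfolding sum using c decomposition_carrier by (intro A.finsum_support[OF B, symmetric]) auto
  ultimately show ?thesis unfolding component_def using c
    by (intro the1_equality[OF component_ex1[OF x]]) blast
qed

lemma component_homogeneous:
  assumes "x \<in> D \<nu>"
  shows "component A D x \<nu> = x"
proof -
  have "component A D x = (\<lambda>\<gamma>. if \<gamma> = \<nu> then x else \<zero>\<^bsub>A\<^esub>)"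
    using assms decomposition_carrier[OF assms] decomposition_zero
    by (intro component_unique[of _ _ "{\<nu>}"]) auto
  then show ?thesis by simp
qed

end

text \<open>The images of the components of \<open>x\<close> decompose \<open>h x\<close>, and decompositions are unique. Graded
homomorphisms are the case \<open>\<alpha> = 0\<close>; multiplication by a homogeneous ring element of degree \<open>\<alpha>\<close> is the
other case of interest.\<close>
lemma component_additive_shift:
  fixes D :: "'g::ab_group_add \<Rightarrow> 'a set"
  assumes A: "abelian_group A" "direct_decomposition A D" and A': "abelian_group A'" "direct_decomposition A' D'"
    and h: "additive_map A A' h" "\<And>\<nu>. h ` D \<nu> \<subseteq> D' (\<alpha> + \<nu>)" and x: "x \<in> carrier A"
  shows "component A' D' (h x) (\<alpha> + \<nu>) = h (component A D x \<nu>)"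
proof -
  interpret A: abelian_group A by fact
  interpret A': abelian_group A' by fact
  let ?c = "component A D x" and ?c' = "\<lambda>\<nu>. h (component A D x (\<nu> - \<alpha>))"
  let ?B = "{\<gamma>. ?c \<gamma> \<noteq> \<zero>\<^bsub>A\<^esub>}"
  have cc: "?c \<gamma> \<in> carrier A" for \<gamma>
    using component(1)[OF A x] decomposition_carrier[OF A] by blast
  have "component A' D' (h x) = ?c'"
  proof (rule component_unique[OF A', of _ _ "(+) \<alpha> ` ?B"])
    show "h x \<in> carrier A'" using additive_mapD(1)[OF h(1) x] .
    show "?c' \<gamma> \<in> D' \<gamma>" for \<gamma> using h(2)[of "\<gamma> - \<alpha>"] component(1)[OF A x, of "\<gamma> - \<alpha>"] by auto
    show "finite ((+) \<alpha> ` ?B)" using component(2)[OF A x] by simp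
    show "{\<gamma>. ?c' \<gamma> \<noteq> \<zero>\<^bsub>A'\<^esub>} \<subseteq> (+) \<alpha> ` ?B"
    proof
      fix \<gamma> assume "\<gamma> \<in> {\<gamma>. ?c' \<gamma> \<noteq> \<zero>\<^bsub>A'\<^esub>}"
      then have "\<gamma> - \<alpha> \<in> ?B" using additive_map_zero[OF A(1) A'(1) h(1)] by auto
      then show "\<gamma> \<in> (+) \<alpha> ` ?B" by (metis add_diff_cancel_left' diff_add_cancel image_eqI add.commute)
    qed
    have "h x = h (\<Oplus>\<^bsub>A\<^esub>\<gamma>\<in>?B. ?c \<gamma>)" using component(3)[OF A x] by simp
    also have "\<dots> = (\<Oplus>\<^bsub>A'\<^esub>\<gamma>\<in>?B. h (?c \<gamma>))"
      using cc component(2)[OF A x] by (intro additive_map_finsum[OF A(1) A'(1) h(1)]) auto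
    also have "\<dots> = (\<Oplus>\<^bsub>A'\<^esub>\<gamma>\<in>?B. ?c' (\<alpha> + \<gamma>))" by simp
    also have "\<dots> = (\<Oplus>\<^bsub>A'\<^esub>\<gamma>\<in>(+) \<alpha> ` ?B. ?c' \<gamma>)"
      using cc additive_mapD(1)[OF h(1)] by (intro A'.finsum_reindex[symmetric]) auto
    finally show "h x = (\<Oplus>\<^bsub>A'\<^esub>\<gamma>\<in>(+) \<alpha> ` ?B. ?c' \<gamma>)" .
  qed
  then show ?thesis by simp
qed

lemma component_add:
  assumes A: "abelian_group A" "direct_decomposition A D" and x: "x \<in> carrier A" and y: "y \<in> carrier A"
  shows "component A D (x \<oplus>\<^bsub>A\<^esub> y) \<nu> = component A D x \<nu> \<oplus>\<^bsub>A\<^esub> component A D y \<nu>"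
proof -
  interpret A: abelian_group A by fact
  let ?c = "component A D x" and ?d = "component A D y"
  let ?B = "{\<gamma>. ?c \<gamma> \<noteq> \<zero>\<^bsub>A\<^esub>} \<union> {\<gamma>. ?d \<gamma> \<noteq> \<zero>\<^bsub>A\<^esub>}"
  have cc: "?c \<gamma> \<in> carrier A" "?d \<gamma> \<in> carrier A" for \<gamma>
    using component(1)[OF A x] component(1)[OF A y] decomposition_carrier[OF A] by blast+
  have fin: "finite ?B" using component(2)[OF A x] component(2)[OF A y] by simp
  have "component A D (x \<oplus>\<^bsub>A\<^esub> y) = (\<lambda>\<nu>. ?c \<nu> \<oplus>\<^bsub>A\<^esub> ?d \<nu>)"
  proof (rule component_unique[OF A, of _ _ ?B])
    show "?c \<gamma> \<oplus>\<^bsub>A\<^esub> ?d \<gamma> \<in> D \<gamma>" for \<gamma>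
    proof -
      have "additive_subgroup (D \<gamma>) A" using A(2) by (simp add: direct_decomposition_def)
      then show ?thesis using component(1)[OF A x] component(1)[OF A y] by (rule additive_subgroup.a_closed)
    qed
    show "{\<gamma>. ?c \<gamma> \<oplus>\<^bsub>A\<^esub> ?d \<gamma> \<noteq> \<zero>\<^bsub>A\<^esub>} \<subseteq> ?B" by auto
    have "x = (\<Oplus>\<^bsub>A\<^esub>\<gamma>\<in>?B. ?c \<gamma>)" "y = (\<Oplus>\<^bsub>A\<^esub>\<gamma>\<in>?B. ?d \<gamma>)"
      using fin by (intro component_sum[OF A]; auto simp: x y)+
    then have "x \<oplus>\<^bsub>A\<^esub> y = (\<Oplus>\<^bsub>A\<^esub>\<gamma>\<in>?B. ?c \<gamma>) \<oplus>\<^bsub>A\<^esub> (\<Oplus>\<^bsub>A\<^esub>\<gamma>\<in>?B. ?d \<gamma>)" by simp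
    then show "x \<oplus>\<^bsub>A\<^esub> y = (\<Oplus>\<^bsub>A\<^esub>\<gamma>\<in>?B. ?c \<gamma> \<oplus>\<^bsub>A\<^esub> ?d \<gamma>)"
      using cc by (subst A.finsum_addf) auto
  qed (use x y fin in auto)
  then show ?thesis by simp
qed

abbreviation gcomp :: "('r, 'm, 'g) gmodule \<Rightarrow> 'g \<Rightarrow> 'm \<Rightarrow> 'm" where
  "gcomp N \<nu> x \<equiv> component N (grade N) x \<nu>"

lemma graded_moduleD:
  assumes "graded_module R N"
  shows "module R N" "abelian_group N" "direct_decomposition N (grade N)"
    "r \<in> homog R \<alpha> \<Longrightarrow> y \<in> grade N \<beta> \<Longrightarrow> r \<odot>\<^bsub>N\<^esub> y \<in> grade N (\<alpha> + \<beta>)"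
  using assms unfolding graded_module_def by (auto simp: module_def)

lemma gcomp_smult:
  assumes N: "graded_module R N" and r: "r \<in> homog R \<alpha>" "r \<in> carrier R" and y: "y \<in> carrier N"
  shows "gcomp N (\<alpha> + \<nu>) (r \<odot>\<^bsub>N\<^esub> y) = r \<odot>\<^bsub>N\<^esub> gcomp N \<nu> y"
proof -
  interpret module R N using graded_moduleD(1)[OF N] .
  show ?thesis
    using component_additive_shift[OF graded_moduleD(2,3)[OF N] graded_moduleD(2,3)[OF N]
        additive_map_smult[OF r(2)], of \<alpha> y \<nu>] graded_moduleD(4)[OF N r(1)] y by auto
qed

lemma graded_koszul_gcomp:
  assumes N: "graded_module R N"
    and x: "\<And>k. k < n \<Longrightarrow> x k \<in> carrier R" "\<And>k. k < n \<Longrightarrow> x k \<in> homog R (\<gamma> k)"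
  shows "graded_koszul R N n x \<gamma> (gcomp N)"
proof -
  interpret module R N using graded_moduleD(1)[OF N] .
  note dec = graded_moduleD(2,3)[OF N]
  show ?thesis
  proof
    show "additive_map N N (gcomp N \<nu>)" for \<nu>
      using component(1)[OF dec] decomposition_carrier[OF dec] component_add[OF dec]
      by (fastforce simp: additive_map_def)
  qed (use x in \<open>auto simp: gcomp_smult[OF N] component(1)[OF dec] decomposition_carrier[OF dec]
        component_homogeneous[OF dec]\<close>)
qed

lemma graded_hom_maps:
  assumes h: "h \<in> graded_hom R N N'" and N: "graded_module R N" and N': "graded_module R N'"
  shows "linear_map R N N' h" "graded_map N (gcomp N) (gcomp N') h"
proof -
  show lin: "linear_map R N N' h"
    using h by (auto simp: graded_hom_def linear_map_def additive_map_def)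
  have "h ` grade N \<nu> \<subseteq> grade N' (0 + \<nu>)" for \<nu> using h by (simp add: graded_hom_def)
  from component_additive_shift[OF graded_moduleD(2,3)[OF N] graded_moduleD(2,3)[OF N'] linear_mapD(1)[OF lin] this]
  show "graded_map N (gcomp N) (gcomp N') h" by (simp add: graded_map_def)
qed

section \<open>The polynomial ring and its Koszul complex\<close>
context ring
begin

text \<open>Polynomials as finitely supported coefficient functions: in this form one can see that a family that
is given by its coefficients consists of polynomials.\<close>
lemma indexed_pset_iff:
  fixes p :: "'c multiset \<Rightarrow> 'a"
  shows "p \<in> indexed_pset V (carrier R) \<longleftrightarrow>
    (\<forall>m. p m \<in> carrier R) \<and> finite {m. p m \<noteq> \<zero>} \<and> (\<forall>m. p m \<noteq> \<zero> \<longrightarrow> set_mset m \<subseteq> V)"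
proof (intro iffI conjI)
  assume "p \<in> indexed_pset V (carrier R)"
  then show "(\<forall>m. p m \<in> carrier R)" "finite {m. p m \<noteq> \<zero>}" "\<forall>m. p m \<noteq> \<zero> \<longrightarrow> set_mset m \<subseteq> V"
  proof (induction)
    case (indexed_const k)
    {
      case 2
      have "{m. local.indexed_const k m \<noteq> \<zero>} \<subseteq> {{#}}" by (auto simp: indexed_const_def)
      then show ?case by (rule finite_subset) simp
    }
  next
    case (indexed_padd p q)
    {
      case 2
      have "{m. local.indexed_padd p q m \<noteq> \<zero>} \<subseteq> {m. p m \<noteq> \<zero>} \<union> {m. q m \<noteq> \<zero>}"
        by (auto simp: indexed_padd_def)
      then show ?case by (rule finite_subset) (use indexed_padd in simp)
    next
      case 3
      have "p m \<noteq> \<zero> \<or> q m \<noteq> \<zero>" if "local.indexed_padd p q m \<noteq> \<zero>" for m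
        using that by (auto simp: indexed_padd_def)
      then show ?case using indexed_padd.IH by blast
    }
  next
    case (indexed_pmult p i)
    {
      case 2
      have "{m. local.indexed_pmult p i m \<noteq> \<zero>} \<subseteq> add_mset i ` {m. p m \<noteq> \<zero>}"
      proof
        fix m assume "m \<in> {m. local.indexed_pmult p i m \<noteq> \<zero>}"
        then have "i \<in># m" "p (m - {#i#}) \<noteq> \<zero>" by (auto simp: indexed_pmult_def split: if_splits)
        then show "m \<in> add_mset i ` {m. p m \<noteq> \<zero>}"
          by (intro image_eqI[of _ _ "m - {#i#}"]) auto
      qed
      then show ?case by (rule finite_subset) (use indexed_pmult in simp)
    next
      case 3
      show ?case
      proof (intro allI impI)
        fix m assume m: "local.indexed_pmult p i m \<noteq> \<zero>"
        then have "i \<in># m" "p (m - {#i#}) \<noteq> \<zero>" by (auto simp: indexed_pmult_def split: if_splits)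
        then have "set_mset (m - {#i#}) \<subseteq> V" "m = add_mset i (m - {#i#})" using indexed_pmult by auto
        then show "set_mset m \<subseteq> V" using indexed_pmult.hyps by (metis insert_subset set_mset_add_mset_insert)
      qed
    }
  qed (auto simp: indexed_const_def indexed_padd_def indexed_pmult_def)
next
  have monomial: "(\<lambda>m'. if m' = m then a else \<zero>) \<in> indexed_pset V (carrier R)"
    if "a \<in> carrier R" "set_mset m \<subseteq> V" for a and m :: "'c multiset"
    using that(2)
  proof (induction m)
    case empty
    have eq: "(\<lambda>m'. if m' = {#} then a else \<zero>) = local.indexed_const a" by (auto simp: indexed_const_def)
    show ?case unfolding eq by (rule indexed_pset.indexed_const[OF that(1)])
  next
    case (add i m)
    have eq: "(\<lambda>m'. if m' = add_mset i m then a else \<zero>) = local.indexed_pmult (\<lambda>m'. if m' = m then a else \<zero>) i"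
      by (rule ext) (auto simp: indexed_pmult_def)
    show ?case unfolding eq using add by (intro indexed_pset.indexed_pmult) auto
  qed
  have "\<forall>p. (\<forall>m. p m \<in> carrier R) \<and> {m. p m \<noteq> \<zero>} \<subseteq> A \<and> (\<forall>m\<in>A. set_mset m \<subseteq> V)
      \<longrightarrow> p \<in> indexed_pset V (carrier R)" if "finite A" for A
    using that
  proof (induction A)
    case empty
    have "p = local.indexed_const \<zero>" if "{m. p m \<noteq> \<zero>} \<subseteq> {}" for p :: "'c multiset \<Rightarrow> 'a"
      using that by (auto simp: indexed_const_def)
    then show ?case by (metis indexed_pset.indexed_const zero_closed)
  next
    case (insert m A)
    show ?case
    proof (intro allI impI, elim conjE)
      fix p :: "'c multiset \<Rightarrow> 'a"
      assume p: "\<forall>m. p m \<in> carrier R" "{m. p m \<noteq> \<zero>} \<subseteq> insert m A" "\<forall>m\<in>insert m A. set_mset m \<subseteq> V"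
      have "p(m := \<zero>) \<in> indexed_pset V (carrier R)"
        using p by (intro insert.IH[rule_format]) auto
      moreover have "(\<lambda>m'. if m' = m then p m else \<zero>) \<in> indexed_pset V (carrier R)"
        using p by (intro monomial) auto
      ultimately have "local.indexed_padd (p(m := \<zero>)) (\<lambda>m'. if m' = m then p m else \<zero>) \<in> indexed_pset V (carrier R)"
        by (rule indexed_pset.indexed_padd)
      also have "local.indexed_padd (p(m := \<zero>)) (\<lambda>m'. if m' = m then p m else \<zero>) = p"
        using p(1) by (intro ext) (auto simp: indexed_padd_def)
      finally show "p \<in> indexed_pset V (carrier R)" .
    qed
  qed
  then show "(\<forall>m. p m \<in> carrier R) \<and> finite {m. p m \<noteq> \<zero>} \<and> (\<forall>m. p m \<noteq> \<zero> \<longrightarrow> set_mset m \<subseteq> V)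
    \<Longrightarrow> p \<in> indexed_pset V (carrier R)" by blast
qed

end

lemma finite_submultisets: "finite {a. a \<subseteq># m}"
proof (induction m)
  case (add x m)
  have "{a. a \<subseteq># add_mset x m} \<subseteq> {a. a \<subseteq># m} \<union> add_mset x ` {a. a \<subseteq># m}"
  proof
    fix a assume a: "a \<in> {a. a \<subseteq># add_mset x m}"
    show "a \<in> {a. a \<subseteq># m} \<union> add_mset x ` {a. a \<subseteq># m}"
    proof (cases "x \<in># a")
      case True
      then have "a = add_mset x (a - {#x#})" "a - {#x#} \<subseteq># m"
        using a by (auto simp: subset_eq_diff_conv)
      then show ?thesis by blast
    next
      case False
      then have "a \<subseteq># m" using a by (auto simp: subseteq_mset_def not_in_iff) (metis le_zero_eq not_less_eq_eq zero_le)
      then show ?thesis by blast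
    qed
  qed
  then show ?case by (rule finite_subset) (simp add: add.IH)
qed simp

text \<open>The ring laws of the polynomial ring are assumed here; they are part of the hypothesis that some module
over it exists.\<close>
locale graded_poly = S: cring S + R: cring "graded_poly_ring S n \<gamma>"
  for S :: "('s, 'b) ring_scheme" and n :: nat and \<gamma> :: "nat \<Rightarrow> 'g::ab_group_add"
begin

abbreviation (input) "R \<equiv> graded_poly_ring S n \<gamma>"
definition indet :: "nat \<Rightarrow> nat multiset \<Rightarrow> 's" where "indet = ring.indexed_var S"

lemma carrier_iff:
  "p \<in> carrier R \<longleftrightarrow> (\<forall>m. p m \<in> carrier S) \<and> finite {m. p m \<noteq> \<zero>\<^bsub>S\<^esub>} \<and> (\<forall>m. p m \<noteq> \<zero>\<^bsub>S\<^esub> \<longrightarrow> set_mset m \<subseteq> {..<n})"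
  by (simp add: graded_poly_ring_def S.indexed_pset_iff)

lemma coeff_closed: "p \<in> carrier R \<Longrightarrow> p m \<in> carrier S"
  by (simp add: carrier_iff)

lemma coeff_simps:
  "(p \<oplus>\<^bsub>R\<^esub> q) m = p m \<oplus>\<^bsub>S\<^esub> q m" "\<zero>\<^bsub>R\<^esub> m = \<zero>\<^bsub>S\<^esub>" "\<one>\<^bsub>R\<^esub> m = (if m = {#} then \<one>\<^bsub>S\<^esub> else \<zero>\<^bsub>S\<^esub>)"
  by (auto simp: graded_poly_ring_def S.indexed_padd_def S.indexed_const_def)

lemma homog_iff: "p \<in> homog R \<delta> \<longleftrightarrow> p \<in> carrier R \<and> (\<forall>m. p m \<noteq> \<zero>\<^bsub>S\<^esub> \<longrightarrow> mdegree \<gamma> m = \<delta>)"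
  by (simp add: graded_poly_ring_def)

lemma indet_apply: "indet k m = (if m = {#k#} then \<one>\<^bsub>S\<^esub> else \<zero>\<^bsub>S\<^esub>)"
  by (auto simp: indet_def S.indexed_var_def S.indexed_pmult_def S.indexed_const_def)
     (metis insert_DiffM)

lemma indet_closed: "k < n \<Longrightarrow> indet k \<in> carrier R"
  by (auto simp: carrier_iff indet_apply)

lemma indet_homog: "k < n \<Longrightarrow> indet k \<in> homog R (\<gamma> k)"
  by (auto simp: homog_iff indet_closed indet_apply mdegree_def)

lemma mult_apply: "(p \<otimes>\<^bsub>R\<^esub> q) m = (\<Oplus>\<^bsub>S\<^esub>a\<in>{a. a \<subseteq># m}. p a \<otimes>\<^bsub>S\<^esub> q (m - a))"
  by (simp add: graded_poly_ring_def)

lemma homog_one: "\<one>\<^bsub>R\<^esub> \<in> homog R 0"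
  using R.one_closed by (auto simp: homog_iff coeff_simps mdegree_def)

lemma homog_mult:
  assumes p: "p \<in> homog R \<delta>" and q: "q \<in> homog R \<epsilon>"
  shows "p \<otimes>\<^bsub>R\<^esub> q \<in> homog R (\<delta> + \<epsilon>)"
proof -
  have c: "p \<in> carrier R" "q \<in> carrier R" using p q by (auto simp: homog_iff)
  have "mdegree \<gamma> m = \<delta> + \<epsilon>" if m: "(p \<otimes>\<^bsub>R\<^esub> q) m \<noteq> \<zero>\<^bsub>S\<^esub>" for m
  proof -
    have "\<exists>a. a \<subseteq># m \<and> p a \<otimes>\<^bsub>S\<^esub> q (m - a) \<noteq> \<zero>\<^bsub>S\<^esub>"
    proof (rule ccontr)
      assume "\<nexists>a. a \<subseteq># m \<and> p a \<otimes>\<^bsub>S\<^esub> q (m - a) \<noteq> \<zero>\<^bsub>S\<^esub>"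
      then have "(p \<otimes>\<^bsub>R\<^esub> q) m = \<zero>\<^bsub>S\<^esub>"
        unfolding mult_apply by (intro S.add.finprod_one_eqI) auto
      then show False using m by simp
    qed
    then obtain a where a: "a \<subseteq># m" "p a \<otimes>\<^bsub>S\<^esub> q (m - a) \<noteq> \<zero>\<^bsub>S\<^esub>" by blast
    then have "p a \<noteq> \<zero>\<^bsub>S\<^esub>" "q (m - a) \<noteq> \<zero>\<^bsub>S\<^esub>" using coeff_closed[OF c(1)] coeff_closed[OF c(2)] by auto
    then have "mdegree \<gamma> a = \<delta>" "mdegree \<gamma> (m - a) = \<epsilon>" using p q by (auto simp: homog_iff)
    moreover have "mdegree \<gamma> (a + (m - a)) = mdegree \<gamma> a + mdegree \<gamma> (m - a)"
      by (simp add: mdegree_def del: subset_mset.add_diff_inverse)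
    ultimately show ?thesis using a(1) by simp
  qed
  then show ?thesis using c by (auto simp: homog_iff)
qed

lemma homog_unique: "p \<in> homog R \<delta> \<Longrightarrow> p \<in> homog R \<epsilon> \<Longrightarrow> p \<noteq> \<zero>\<^bsub>R\<^esub> \<Longrightarrow> \<delta> = \<epsilon>"
  unfolding homog_iff using coeff_simps(2) by (metis ext)

lemma indet_mult_apply:
  assumes "p \<in> carrier R"
  shows "(indet k \<otimes>\<^bsub>R\<^esub> p) m = (if k \<in># m then p (m - {#k#}) else \<zero>\<^bsub>S\<^esub>)"
proof (cases "k \<in># m")
  case True
  note fin = finite_submultisets[of m]
  have "(indet k \<otimes>\<^bsub>R\<^esub> p) m = (\<Oplus>\<^bsub>S\<^esub>a\<in>{a. a \<subseteq># m}. if a = {#k#} then p (m - a) else \<zero>\<^bsub>S\<^esub>)"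
    unfolding mult_apply using coeff_closed[OF assms]
    by (intro S.finsum_cong') (auto simp: indet_apply)
  also have "\<dots> = p (m - {#k#})"
    using S.add.finprod_singleton_swap[OF _ fin, of "{#k#}" "\<lambda>a. p (m - a)"] True coeff_closed[OF assms]
    by simp
  finally show ?thesis using True by simp
next
  case False
  have "(indet k \<otimes>\<^bsub>R\<^esub> p) m = (\<Oplus>\<^bsub>S\<^esub>a\<in>{a. a \<subseteq># m}. \<zero>\<^bsub>S\<^esub>)"
    unfolding mult_apply using coeff_closed[OF assms] False
    by (intro S.finsum_cong') (auto simp: indet_apply)
  then show ?thesis using False by simp
qed

lemma regular_sel:
  "carrier (regular_gmodule R) = carrier R" "add (regular_gmodule R) = add R"
  "\<zero>\<^bsub>regular_gmodule R\<^esub> = \<zero>\<^bsub>R\<^esub>" "smult (regular_gmodule R) = monoid.mult R"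
  by (simp_all add: regular_gmodule_def)

lemma module_regular: "module R (regular_gmodule R)"
proof (rule moduleI)
  show "abelian_group (regular_gmodule R)"
    by (rule abelian_groupI) (auto simp: regular_sel R.a_ac intro: R.a_inv_closed R.l_neg)
qed (auto simp: regular_sel R.l_distr R.r_distr R.m_assoc R.cring_axioms)

sublocale reg: koszul R "regular_gmodule R" n indet
  by (rule koszul.intro[OF module_regular]) (simp add: koszul_axioms_def indet_closed)

lemma additive_map_coeff: "additive_map (regular_gmodule R) S (\<lambda>p. p m)"
  by (auto simp: additive_map_def regular_sel coeff_simps coeff_closed)

lemma koszul_d_coeff:
  assumes y: "\<And>I. y I \<in> carrier R" and I: "I \<subseteq> {..<n}"
  shows "koszul_d indet n (regular_gmodule R) y I m = (\<Oplus>\<^bsub>S\<^esub>k\<in>{..<n} - I.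
    signed S (below k I) (if k \<in># m then y (insert k I) (m - {#k#}) else \<zero>\<^bsub>S\<^esub>))"
proof -
  note ad = reg.M.abelian_group_axioms S.abelian_group_axioms additive_map_coeff[of m]
  have "koszul_d indet n (regular_gmodule R) y I m = (\<Oplus>\<^bsub>S\<^esub>k\<in>{..<n} - I.
      signed (regular_gmodule R) (below k I) (indet k \<odot>\<^bsub>regular_gmodule R\<^esub> y (insert k I)) m)"
    unfolding koszul_d_def using y I indet_closed
    by (simp, intro additive_map_finsum[OF ad]) (auto intro!: reg.M.signed_closed[unfolded regular_sel] simp: regular_sel)
  also have "\<dots> = (\<Oplus>\<^bsub>S\<^esub>k\<in>{..<n} - I.
    signed S (below k I) (if k \<in># m then y (insert k I) (m - {#k#}) else \<zero>\<^bsub>S\<^esub>))"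
  proof (intro S.finsum_cong')
    fix k assume "k \<in> {..<n} - I"
    then show "signed (regular_gmodule R) (below k I) (indet k \<odot>\<^bsub>regular_gmodule R\<^esub> y (insert k I)) m =
      signed S (below k I) (if k \<in># m then y (insert k I) (m - {#k#}) else \<zero>\<^bsub>S\<^esub>)"
      using additive_map_signed[OF ad, of "indet k \<odot>\<^bsub>regular_gmodule R\<^esub> y (insert k I)"] indet_closed y
      by (simp add: regular_sel indet_mult_apply)
  qed (use y coeff_closed in auto)
  finally show ?thesis .
qed

text \<open>The Koszul complex of the polynomial ring splits by multidegree, where \<open>X\<^sup>m e\<^sub>I\<close> has multidegree \<open>m + I\<close>. In a
fixed multidegree other than zero it is the chain complex of the full simplex on the variables that
occur, and the cone over one vertex contracts it. With the smallest variable \<open>v\<close> as that vertex,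
\<open>e\<^sub>v\<close> always comes first and no signs appear: the contraction takes a factor \<open>X\<^sub>v\<close> out of the monomial
and puts \<open>e\<^sub>v\<close> in front.\<close>
lemma regular_koszul_acyclic:
  assumes y: "\<And>I. y I \<in> carrier R" "\<And>I. \<not> (I \<subseteq> {..<n} \<and> I \<noteq> {}) \<Longrightarrow> y I = \<zero>\<^bsub>R\<^esub>"
    and cycle: "\<And>I. koszul_d indet n (regular_gmodule R) y I = \<zero>\<^bsub>R\<^esub>"
  shows "\<exists>w. (\<forall>I. w I \<in> carrier R) \<and> (\<forall>I. y I = koszul_d indet n (regular_gmodule R) w I)"
proof -
  define w where "w J m = (if J \<noteq> {} \<and> J \<subseteq> {..<n} \<and> (\<forall>i\<in>#m. Min J \<le> i)
     then y (J - {Min J}) (add_mset (Min J) m) else \<zero>\<^bsub>S\<^esub>)" for J m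
  have w: "w J \<in> carrier R" for J
  proof -
    note yJ = y(1)[of "J - {Min J}", unfolded carrier_iff]
    have "{m. w J m \<noteq> \<zero>\<^bsub>S\<^esub>} \<subseteq> (\<lambda>m. m - {#Min J#}) ` {m. y (J - {Min J}) m \<noteq> \<zero>\<^bsub>S\<^esub>}"
    proof
      fix m assume "m \<in> {m. w J m \<noteq> \<zero>\<^bsub>S\<^esub>}"
      then have "y (J - {Min J}) (add_mset (Min J) m) \<noteq> \<zero>\<^bsub>S\<^esub>" by (auto simp: w_def split: if_splits)
      then show "m \<in> (\<lambda>m. m - {#Min J#}) ` {m. y (J - {Min J}) m \<noteq> \<zero>\<^bsub>S\<^esub>}"
        by (intro image_eqI[of _ _ "add_mset (Min J) m"]) auto
    qed
    then have "finite {m. w J m \<noteq> \<zero>\<^bsub>S\<^esub>}" by (rule finite_subset) (use yJ in simp)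
    moreover have "set_mset m \<subseteq> {..<n}" if "w J m \<noteq> \<zero>\<^bsub>S\<^esub>" for m
    proof -
      have "y (J - {Min J}) (add_mset (Min J) m) \<noteq> \<zero>\<^bsub>S\<^esub>" using that by (auto simp: w_def split: if_splits)
      then have "set_mset (add_mset (Min J) m) \<subseteq> {..<n}" using yJ by blast
      then show ?thesis by simp
    qed
    moreover have "w J m \<in> carrier S" for m using yJ by (simp add: w_def)
    ultimately show ?thesis unfolding carrier_iff by blast
  qed
  have "y I m = koszul_d indet n (regular_gmodule R) w I m" for I m
  proof (cases "I \<subseteq> {..<n} \<and> I \<noteq> {}")
    case False
    show ?thesis
    proof (cases "I = {}")
      case True
      have "w {k} m = \<zero>\<^bsub>S\<^esub>" for k m using y(2)[of "{}"] by (simp add: w_def coeff_simps)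
      then have "koszul_d indet n (regular_gmodule R) w {} m = \<zero>\<^bsub>S\<^esub>"
        unfolding koszul_d_coeff[of w "{}", OF w empty_subsetI] by (intro S.add.finprod_one_eqI) simp
      then show ?thesis using True y(2)[of I] by (simp add: coeff_simps)
    next
      case False2: False
      then show ?thesis using False y(2)[of I] by (simp add: koszul_d_def regular_sel)
    qed
  next
    case True
    then have I: "I \<subseteq> {..<n}" "finite I" "I \<noteq> {}" using finite_subset by auto
    let ?E = "I \<union> set_mset m"
    define v where "v = Min ?E"
    have vE: "v \<in> ?E" unfolding v_def using I by (intro Min_in) auto
    have vmin: "v \<le> i" if "i \<in> ?E" for i unfolding v_def using I that by (intro Min_le) auto
    have no_below: "below v J = 0" if "J \<subseteq> ?E" for J
      using vmin that by (fastforce simp: below_def card_eq_0_iff)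
    have MinE: "Min J = v" if "J \<subseteq> ?E" "v \<in> J" for J
      using that vmin I by (intro Min_eqI) (auto intro: finite_subset[of J ?E])
    show ?thesis
    proof (cases "v \<in> I")
      case v: True
      then have vn: "v < n" using I by auto
      \<comment> \<open>The cycle equation at \<open>I - {v}\<close> and \<open>X\<^sub>v X\<^sup>m\<close> is the required identity: its summand for \<open>v\<close> is the coefficient in question.\<close>
      let ?J = "I - {v}"
      let ?g = "\<lambda>k. signed S (below k ?J) (if k \<in># add_mset v m then y (insert k ?J) (add_mset v m - {#k#}) else \<zero>\<^bsub>S\<^esub>)"
      have J: "?J \<subseteq> {..<n}" "{..<n} - ?J = insert v ({..<n} - I)" using I v vn by auto
      have gc: "?g k \<in> carrier S" for k using coeff_closed[OF y(1)] by simp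
      have gv: "?g v = y I m"
      proof -
        have "below v ?J = 0" by (rule no_below) auto
        moreover have "insert v ?J = I" using v by auto
        ultimately show ?thesis by (simp add: signed_def)
      qed
      have "\<zero>\<^bsub>S\<^esub> = koszul_d indet n (regular_gmodule R) y ?J (add_mset v m)"
        by (simp add: cycle coeff_simps)
      also have "\<dots> = (\<Oplus>\<^bsub>S\<^esub>k\<in>insert v ({..<n} - I). ?g k)"
        unfolding koszul_d_coeff[of y ?J "add_mset v m", OF y(1) J(1)] J(2) ..
      also have "\<dots> = y I m \<oplus>\<^bsub>S\<^esub> (\<Oplus>\<^bsub>S\<^esub>k\<in>{..<n} - I. ?g k)"
      proof -
        have "?g \<in> {..<n} - I \<rightarrow> carrier S" using gc by blast
        from S.finsum_insert[of "{..<n} - I" v ?g, OF _ _ this gc[of v], unfolded gv] v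
        show ?thesis by blast
      qed
      finally have z: "y I m \<oplus>\<^bsub>S\<^esub> (\<Oplus>\<^bsub>S\<^esub>k\<in>{..<n} - I. ?g k) = \<zero>\<^bsub>S\<^esub>" ..
      have "koszul_d indet n (regular_gmodule R) w I m = (\<Oplus>\<^bsub>S\<^esub>k\<in>{..<n} - I. \<ominus>\<^bsub>S\<^esub> ?g k)"
        unfolding koszul_d_coeff[of w I m, OF w I(1)]
      proof (intro S.finsum_cong')
        fix k assume k: "k \<in> {..<n} - I"
        then have kv: "k \<noteq> v" using v by auto
        show "signed S (below k I) (if k \<in># m then w (insert k I) (m - {#k#}) else \<zero>\<^bsub>S\<^esub>) = \<ominus>\<^bsub>S\<^esub> ?g k"
        proof (cases "k \<in># m")
          case True
          have "v < k" using vmin[of k] True kv by simp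
          then have b: "below k I = Suc (below k ?J)" using below_remove[OF I(2) v] by simp
          have "Min (insert k I) = v" using True v by (intro MinE) auto
          moreover have "\<forall>i\<in>#m - {#k#}. v \<le> i" using vmin by (auto dest: in_diffD)
          moreover have "insert k I - {v} = insert k ?J" using kv by auto
          moreover have "add_mset v (m - {#k#}) = add_mset v m - {#k#}" using kv True by simp
          ultimately have "w (insert k I) (m - {#k#}) = y (insert k ?J) (add_mset v m - {#k#})"
            using k I by (auto simp: w_def)
          then show ?thesis using True coeff_closed[OF y(1)] by (simp add: b signed_def)
        next
          case False
          then show ?thesis using kv by simp
        qed
      qed (use gc in auto)
      also have "\<dots> = \<ominus>\<^bsub>S\<^esub> (\<Oplus>\<^bsub>S\<^esub>k\<in>{..<n} - I. ?g k)"
      proof (rule additive_map_finsum[OF S.abelian_group_axioms S.abelian_group_axioms, symmetric])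
        show "additive_map S S (\<lambda>a. \<ominus>\<^bsub>S\<^esub> a)" by (auto simp: additive_map_def S.minus_add)
      qed (use gc in auto)
      also have "\<dots> = y I m"
      proof (rule S.minus_equality[OF z])
        show "(\<Oplus>\<^bsub>S\<^esub>k\<in>{..<n} - I. ?g k) \<in> carrier S" using gc by (intro S.finsum_closed) auto
      qed (rule coeff_closed[OF y(1)])
      finally show ?thesis ..
    next
      case v: False
      \<comment> \<open>Now \<open>w\<close> vanishes on \<open>insert k I\<close> at \<open>m - {#k#}\<close> unless \<open>k = v\<close>, since \<open>v\<close> is still in the monomial.\<close>
      then have vm: "v \<in># m" using vE by auto
      show ?thesis
      proof (cases "v < n")
        case False
        then have "\<not> set_mset m \<subseteq> {..<n}" using vm by auto
        then have z: "p m = \<zero>\<^bsub>S\<^esub>" if "p \<in> carrier R" for p using that unfolding carrier_iff by blast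
        have "koszul_d indet n (regular_gmodule R) w I \<in> carrier R"
          using reg.koszul_d_closed[of w I] w unfolding regular_sel by blast
        then show ?thesis using z[OF y(1)] z by metis
      next
        case vn: True
        have "koszul_d indet n (regular_gmodule R) w I m = (\<Oplus>\<^bsub>S\<^esub>k\<in>{..<n} - I. if k = v then y I m else \<zero>\<^bsub>S\<^esub>)"
          unfolding koszul_d_coeff[of w I m, OF w I(1)]
        proof (intro S.finsum_cong')
          fix k assume k: "k \<in> {..<n} - I"
          show "signed S (below k I) (if k \<in># m then w (insert k I) (m - {#k#}) else \<zero>\<^bsub>S\<^esub>) = (if k = v then y I m else \<zero>\<^bsub>S\<^esub>)"
          proof (cases "k = v")
            case True
            have "Min (insert v I) = v" using vm by (intro MinE) auto
            moreover have "\<forall>i\<in>#m - {#v#}. v \<le> i" using vmin by (auto dest: in_diffD)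
            ultimately have "w (insert v I) (m - {#v#}) = y I m"
              using I vn vm v by (simp add: w_def)
            moreover have "below v I = 0" by (rule no_below) auto
            ultimately show ?thesis using True vm by (simp add: signed_def)
          next
            case kv: False
            have "w (insert k I) (m - {#k#}) = \<zero>\<^bsub>S\<^esub>" if km: "k \<in># m"
            proof -
              have "v \<in># m - {#k#}" using vm kv by (simp add: in_diff_count)
              moreover have "Min (insert k I) \<in> insert k I" using I by (intro Min_in) auto
              then have "v \<le> Min (insert k I)" "v \<noteq> Min (insert k I)"
                using vmin[of "Min (insert k I)"] km kv v by auto
              then have "v < Min (insert k I)" by simp
              ultimately show ?thesis by (auto simp: w_def)
            qed
            then show ?thesis using kv by simp
          qed
        qed (use coeff_closed[OF y(1)] in auto)
        also have "\<dots> = y I m"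
          using S.add.finprod_singleton_swap[of v "{..<n} - I" "\<lambda>_. y I m"] vn v coeff_closed[OF y(1)] by simp
        finally show ?thesis ..
      qed
    qed
  qed
  then show ?thesis using w by (intro exI[of _ w]) auto
qed

end

section \<open>Free modules\<close>
definition coord :: "('r, 'g) gring \<Rightarrow> ('r, 'm, 'g) gmodule \<Rightarrow> 'm set \<Rightarrow> 'm \<Rightarrow> 'm \<Rightarrow> 'r" where
  "coord R F E x = (THE c. (\<forall>b. c b \<in> carrier R) \<and> finite {b. c b \<noteq> \<zero>\<^bsub>R\<^esub>} \<and>
     {b. c b \<noteq> \<zero>\<^bsub>R\<^esub>} \<subseteq> E \<and> x = (\<Oplus>\<^bsub>F\<^esub>b\<in>{b. c b \<noteq> \<zero>\<^bsub>R\<^esub>}. c b \<odot>\<^bsub>F\<^esub> b))"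

locale free_module = module R F for R :: "('r, 'g) gring" and F :: "('r, 'm, 'g) gmodule" +
  fixes E assumes basis: "is_basis R F E"
begin

lemma basis_carrier: "E \<subseteq> carrier F"
  using basis by (simp add: is_basis_def)

lemma coord_ex1:
  assumes "x \<in> carrier F"
  shows "\<exists>!c. (\<forall>b. c b \<in> carrier R) \<and> finite {b. c b \<noteq> \<zero>\<^bsub>R\<^esub>} \<and>
     {b. c b \<noteq> \<zero>\<^bsub>R\<^esub>} \<subseteq> E \<and> x = (\<Oplus>\<^bsub>F\<^esub>b\<in>{b. c b \<noteq> \<zero>\<^bsub>R\<^esub>}. c b \<odot>\<^bsub>F\<^esub> b)"
  using basis assms unfolding is_basis_def by blast

lemma coord:
  assumes "x \<in> carrier F"
  shows "coord R F E x b \<in> carrier R" "finite {b. coord R F E x b \<noteq> \<zero>\<^bsub>R\<^esub>}"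
    "{b. coord R F E x b \<noteq> \<zero>\<^bsub>R\<^esub>} \<subseteq> E"
    "x = (\<Oplus>\<^bsub>F\<^esub>b\<in>{b. coord R F E x b \<noteq> \<zero>\<^bsub>R\<^esub>}. coord R F E x b \<odot>\<^bsub>F\<^esub> b)"
  using theI'[OF coord_ex1[OF assms]] unfolding coord_def by blast+

lemma combination_support:
  assumes "finite B" "{b. c b \<noteq> \<zero>\<^bsub>R\<^esub>} \<subseteq> B" "B \<subseteq> E" "\<And>b. c b \<in> carrier R"
  shows "(\<Oplus>\<^bsub>F\<^esub>b\<in>{b. c b \<noteq> \<zero>\<^bsub>R\<^esub>}. c b \<odot>\<^bsub>F\<^esub> b) = (\<Oplus>\<^bsub>F\<^esub>b\<in>B. c b \<odot>\<^bsub>F\<^esub> b)"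
  using assms basis_carrier by (intro M.add.finprod_mono_neutral_cong_left) auto

lemma coord_sum:
  assumes "x \<in> carrier F" "finite B" "{b. coord R F E x b \<noteq> \<zero>\<^bsub>R\<^esub>} \<subseteq> B" "B \<subseteq> E"
  shows "x = (\<Oplus>\<^bsub>F\<^esub>b\<in>B. coord R F E x b \<odot>\<^bsub>F\<^esub> b)"
  by (rule trans[OF coord(4)[OF assms(1)] combination_support[OF assms(2-4) coord(1)[OF assms(1)]]])

lemma coord_unique:
  assumes x: "x \<in> carrier F" and c: "\<And>b. c b \<in> carrier R"
    and B: "finite B" "{b. c b \<noteq> \<zero>\<^bsub>R\<^esub>} \<subseteq> B" "B \<subseteq> E"
    and sum: "x = (\<Oplus>\<^bsub>F\<^esub>b\<in>B. c b \<odot>\<^bsub>F\<^esub> b)"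
  shows "coord R F E x = c"
proof -
  have "finite {b. c b \<noteq> \<zero>\<^bsub>R\<^esub>}" using B by (auto intro: finite_subset)
  moreover have "{b. c b \<noteq> \<zero>\<^bsub>R\<^esub>} \<subseteq> E" using B by blast
  moreover have "x = (\<Oplus>\<^bsub>F\<^esub>b\<in>{b. c b \<noteq> \<zero>\<^bsub>R\<^esub>}. c b \<odot>\<^bsub>F\<^esub> b)"
    unfolding sum using combination_support[of B c] B c by simp
  ultimately show ?thesis unfolding coord_def using c
    by (intro the1_equality[OF coord_ex1[OF x]]) blast
qed

lemma coord_add:
  assumes x: "x \<in> carrier F" and y: "y \<in> carrier F"
  shows "coord R F E (x \<oplus>\<^bsub>F\<^esub> y) b = coord R F E x b \<oplus>\<^bsub>R\<^esub> coord R F E y b"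
proof -
  let ?c = "coord R F E x" and ?d = "coord R F E y"
  let ?B = "{b. ?c b \<noteq> \<zero>\<^bsub>R\<^esub>} \<union> {b. ?d b \<noteq> \<zero>\<^bsub>R\<^esub>}"
  note cx = coord[OF x] and cy = coord[OF y]
  have fin: "finite ?B" and BE: "?B \<subseteq> E" using cx cy by auto
  have "coord R F E (x \<oplus>\<^bsub>F\<^esub> y) = (\<lambda>b. ?c b \<oplus>\<^bsub>R\<^esub> ?d b)"
  proof (rule coord_unique[of _ _ ?B])
    have "x \<oplus>\<^bsub>F\<^esub> y = (\<Oplus>\<^bsub>F\<^esub>b\<in>?B. ?c b \<odot>\<^bsub>F\<^esub> b) \<oplus>\<^bsub>F\<^esub> (\<Oplus>\<^bsub>F\<^esub>b\<in>?B. ?d b \<odot>\<^bsub>F\<^esub> b)"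
      using coord_sum[OF x fin _ BE] coord_sum[OF y fin _ BE] by simp
    also have "\<dots> = (\<Oplus>\<^bsub>F\<^esub>b\<in>?B. ?c b \<odot>\<^bsub>F\<^esub> b \<oplus>\<^bsub>F\<^esub> ?d b \<odot>\<^bsub>F\<^esub> b)"
      using BE basis_carrier cx(1) cy(1) by (intro M.finsum_addf[symmetric]) auto
    also have "\<dots> = (\<Oplus>\<^bsub>F\<^esub>b\<in>?B. (?c b \<oplus>\<^bsub>R\<^esub> ?d b) \<odot>\<^bsub>F\<^esub> b)"
    proof (intro M.finsum_cong')
      fix b assume "b \<in> ?B"
      then have "b \<in> carrier F" using BE basis_carrier by blast
      then show "?c b \<odot>\<^bsub>F\<^esub> b \<oplus>\<^bsub>F\<^esub> ?d b \<odot>\<^bsub>F\<^esub> b = (?c b \<oplus>\<^bsub>R\<^esub> ?d b) \<odot>\<^bsub>F\<^esub> b"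
        using cx(1) cy(1) by (simp add: smult_l_distr)
    next
      show "(\<lambda>b. (?c b \<oplus>\<^bsub>R\<^esub> ?d b) \<odot>\<^bsub>F\<^esub> b) \<in> ?B \<rightarrow> carrier F"
        using BE basis_carrier cx(1) cy(1) by blast
    qed simp
    finally show "x \<oplus>\<^bsub>F\<^esub> y = (\<Oplus>\<^bsub>F\<^esub>b\<in>?B. (?c b \<oplus>\<^bsub>R\<^esub> ?d b) \<odot>\<^bsub>F\<^esub> b)" .
  qed (use x y fin BE cx(1) cy(1) in auto)
  then show ?thesis by simp
qed

lemma coord_smult:
  assumes x: "x \<in> carrier F" and r: "r \<in> carrier R"
  shows "coord R F E (r \<odot>\<^bsub>F\<^esub> x) b = r \<otimes>\<^bsub>R\<^esub> coord R F E x b"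
proof -
  let ?c = "coord R F E x"
  let ?B = "{b. ?c b \<noteq> \<zero>\<^bsub>R\<^esub>}"
  note cx = coord[OF x]
  have bc: "b \<in> carrier F" if "b \<in> ?B" for b using that cx(3) basis_carrier by blast
  have "coord R F E (r \<odot>\<^bsub>F\<^esub> x) = (\<lambda>b. r \<otimes>\<^bsub>R\<^esub> ?c b)"
  proof (rule coord_unique[of _ _ ?B])
    have "r \<odot>\<^bsub>F\<^esub> x = r \<odot>\<^bsub>F\<^esub> (\<Oplus>\<^bsub>F\<^esub>b\<in>?B. ?c b \<odot>\<^bsub>F\<^esub> b)" using cx(4) by simp
    also have "\<dots> = (\<Oplus>\<^bsub>F\<^esub>b\<in>?B. r \<odot>\<^bsub>F\<^esub> (?c b \<odot>\<^bsub>F\<^esub> b))"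
      using cx(1,2) r bc by (intro finsum_smult_ldistr) auto
    also have "\<dots> = (\<Oplus>\<^bsub>F\<^esub>b\<in>?B. (r \<otimes>\<^bsub>R\<^esub> ?c b) \<odot>\<^bsub>F\<^esub> b)"
      using r bc cx(1) by (intro M.finsum_cong') (auto simp: smult_assoc1)
    finally show "r \<odot>\<^bsub>F\<^esub> x = (\<Oplus>\<^bsub>F\<^esub>b\<in>?B. (r \<otimes>\<^bsub>R\<^esub> ?c b) \<odot>\<^bsub>F\<^esub> b)" .
  qed (use x r cx in auto)
  then show ?thesis by simp
qed

end

context graded_poly
begin

text \<open>Finitely many basis elements occur in a chain, and the coordinates of a cycle are cycles over the
polynomial ring.\<close>
lemma free_koszul_exact:
  assumes F: "graded_koszul R F n indet \<gamma> \<pi>" and E: "is_basis R F E" and q: "q \<ge> 1"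
  shows "koszul_exact indet n \<gamma> F \<mu> q"
proof -
  interpret F: graded_koszul R F n indet \<gamma> \<pi> by fact
  interpret F: free_module R F E by (intro free_module.intro free_module_axioms.intro F.module_axioms E)
  let ?A = "regular_gmodule R"
  show ?thesis
  proof (rule F.koszul_exactI)
    fix y assume y: "y \<in> koszul_chains n \<gamma> F \<mu> q" and cycle: "\<And>I. koszul_d indet n F y I = \<zero>\<^bsub>F\<^esub>"
    have yc: "y I \<in> carrier F" for I using F.koszul_chains_carrier[OF y] .
    have lin: "linear_map R F ?A (\<lambda>x. coord R F E x b)" for b
      by (auto simp: linear_map_def additive_map_def regular_sel F.coord(1) F.coord_add F.coord_smult)
    have coord_zero: "coord R F E \<zero>\<^bsub>F\<^esub> b = \<zero>\<^bsub>R\<^esub>" for b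
      using additive_map_zero[OF F.M.abelian_group_axioms reg.M.abelian_group_axioms linear_mapD(1)[OF lin[of b]]]
      by (simp add: regular_sel)
    have "\<exists>w. (\<forall>I. w I \<in> carrier R) \<and> (\<forall>I. coord R F E (y I) b = koszul_d indet n ?A w I)" for b
    proof (rule regular_koszul_acyclic)
      show "koszul_d indet n ?A (\<lambda>I. coord R F E (y I) b) I = \<zero>\<^bsub>R\<^esub>" for I
        using F.linear_map_koszul_d[of ?A "\<lambda>x. coord R F E x b" y I, OF module_regular lin yc] cycle coord_zero by simp
      show "coord R F E (y I) b = \<zero>\<^bsub>R\<^esub>" if "\<not> (I \<subseteq> {..<n} \<and> I \<noteq> {})" for I
        using that koszul_chainsD(2)[OF y, of I] q coord_zero by fastforce
    qed (use F.coord(1) yc in auto)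
    then obtain w where w: "\<And>b I. w b I \<in> carrier R" "\<And>b I. coord R F E (y I) b = koszul_d indet n ?A (w b) I"
      by metis
    define B where "B = (\<Union>I\<in>Pow {..<n}. {b. coord R F E (y I) b \<noteq> \<zero>\<^bsub>R\<^esub>})"
    have B: "finite B" "B \<subseteq> E" unfolding B_def using F.coord(2,3)[OF yc] by auto
    have Bc: "b \<in> carrier F" if "b \<in> B" for b using that B F.basis_carrier by blast
    have support: "{b. coord R F E (y I) b \<noteq> \<zero>\<^bsub>R\<^esub>} \<subseteq> B" for I
    proof (cases "I \<subseteq> {..<n}")
      case False
      then show ?thesis using koszul_chainsD(2)[OF y, of I] coord_zero by auto
    qed (auto simp: B_def)
    let ?w = "\<lambda>I. \<Oplus>\<^bsub>F\<^esub>b\<in>B. w b I \<odot>\<^bsub>F\<^esub> b"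
    have wc: "?w I \<in> carrier F" for I using w(1) Bc by (intro F.M.finsum_closed) auto
    have "y I = koszul_d indet n F ?w I" for I
    proof -
      have "y I = (\<Oplus>\<^bsub>F\<^esub>b\<in>B. coord R F E (y I) b \<odot>\<^bsub>F\<^esub> b)"
        by (rule F.coord_sum[OF yc B(1) support B(2)])
      also have "\<dots> = (\<Oplus>\<^bsub>F\<^esub>b\<in>B. koszul_d indet n F (\<lambda>I. w b I \<odot>\<^bsub>F\<^esub> b) I)"
      proof (intro F.M.finsum_cong')
        fix b assume b: "b \<in> B"
        have "linear_map R ?A F (\<lambda>r. r \<odot>\<^bsub>F\<^esub> b)"
          using Bc[OF b] by (auto simp: linear_map_def additive_map_def regular_sel F.smult_l_distr F.smult_assoc1)
        then show "coord R F E (y I) b \<odot>\<^bsub>F\<^esub> b = koszul_d indet n F (\<lambda>I. w b I \<odot>\<^bsub>F\<^esub> b) I"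
          unfolding w(2) using reg.linear_map_koszul_d[of F "\<lambda>r. r \<odot>\<^bsub>F\<^esub> b" "w b" I] F.module_axioms w(1)
          by (simp add: regular_sel)
      qed (use w(1) Bc in \<open>auto intro!: F.koszul_d_closed\<close>)
      also have "\<dots> = koszul_d indet n F ?w I"
        using w(1) Bc by (intro F.koszul_d_finsum[symmetric] B(1)) auto
      finally show ?thesis .
    qed
    then show "\<exists>w. (\<forall>I. w I \<in> carrier F) \<and> (\<forall>I. y I = koszul_d indet n F w I)"
      using wc by (intro exI[of _ ?w] conjI allI)
  qed
qed

end

lemma (in graded_koszul) koszul_d_koszul_chains_0:
  assumes "y \<in> koszul_chains n \<gamma> N \<mu> 0"
  shows "koszul_d x n N y I = \<zero>\<^bsub>N\<^esub>"
proof (cases "I \<subseteq> {..<n}")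
  case True
  then have "finite I" by (rule finite_subset) simp
  then have "y (insert k I) = \<zero>\<^bsub>N\<^esub>" for k using koszul_chainsD(2)[OF assms, of "insert k I"] by simp
  then show ?thesis unfolding koszul_d_def using x_closed by (auto intro!: M.add.finprod_one_eqI)
qed (simp add: koszul_d_def)

section \<open>The chase through a free resolution\<close>
lemma graded_free_resolutionD:
  assumes "graded_free_resolution R M F d \<epsilon>"
  shows "graded_module R (F i)" "\<exists>E. is_basis R (F i) E"
    "d i \<in> graded_hom R (F (Suc i)) (F i)" "\<epsilon> \<in> graded_hom R (F 0) M" "\<epsilon> ` carrier (F 0) = carrier M"
    "d 0 ` carrier (F (Suc 0)) = {x \<in> carrier (F 0). \<epsilon> x = \<zero>\<^bsub>M\<^esub>}"
    "d (Suc i) ` carrier (F (Suc (Suc i))) = {x \<in> carrier (F (Suc i)). d i x = \<zero>\<^bsub>F i\<^esub>}"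
proof -
  note r = assms[unfolded graded_free_resolution_def]
  note r' = r[THEN conjunct2] note r'' = r'[THEN conjunct2] note r''' = r''[THEN conjunct2, THEN conjunct2]
  have "graded_free R (F i)" using r[THEN conjunct1] by (rule spec)
  then show "graded_module R (F i)" "\<exists>E. is_basis R (F i) E" by (auto simp: graded_free_def)
  show "d i \<in> graded_hom R (F (Suc i)) (F i)" using r'[THEN conjunct1] by (rule spec)
  show "\<epsilon> \<in> graded_hom R (F 0) M" using r''[THEN conjunct1] .
  show "\<epsilon> ` carrier (F 0) = carrier M" using r''[THEN conjunct2, THEN conjunct1] .
  show "d 0 ` carrier (F (Suc 0)) = {x \<in> carrier (F 0). \<epsilon> x = \<zero>\<^bsub>M\<^esub>}"
    using r'''[THEN conjunct1] unfolding One_nat_def .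
  show "d (Suc i) ` carrier (F (Suc (Suc i))) = {x \<in> carrier (F (Suc i)). d i x = \<zero>\<^bsub>F i\<^esub>}"
    using r'''[THEN conjunct2] by (rule spec)
qed

context graded_poly
begin

lemma graded_koszul_module:
  "graded_module R N \<Longrightarrow> graded_koszul R N n indet \<gamma> (gcomp N)"
  by (rule graded_koszul_gcomp[OF _ indet_closed indet_homog])

context
  fixes M :: "(nat multiset \<Rightarrow> 's, 'm, 'g) gmodule" and F :: "nat \<Rightarrow> (nat multiset \<Rightarrow> 's, 'f, 'g) gmodule"
    and d \<epsilon> \<mu> j
  assumes M: "graded_module R M" and res: "graded_free_resolution R M F d \<epsilon>"
    and M_exact: "koszul_exact indet n \<gamma> M \<mu> j"
begin

private lemmas resD = graded_free_resolutionD[OF res]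

private lemma kF: "graded_koszul R (F i) n indet \<gamma> (gcomp (F i))" and kM: "graded_koszul R M n indet \<gamma> (gcomp M)"
  by (rule graded_koszul_module[OF resD(1)], rule graded_koszul_module[OF M])

private lemma koF: "koszul R (F i) n indet" and koM: "koszul R M n indet"
  by (rule graded_koszul.axioms(1)[OF kF], rule graded_koszul.axioms(1)[OF kM])

private lemma d_maps: "linear_map R (F (Suc i)) (F i) (d i)" "graded_map (F (Suc i)) (gcomp (F (Suc i))) (gcomp (F i)) (d i)"
  by (rule graded_hom_maps[OF resD(3) resD(1) resD(1)])+

private lemma \<epsilon>_maps: "linear_map R (F 0) M \<epsilon>" "graded_map (F 0) (gcomp (F 0)) (gcomp M) \<epsilon>"
  by (rule graded_hom_maps[OF resD(4) resD(1) M])+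

private lemma boundary_from_cycle:
  assumes T: "graded_koszul R T n indet \<gamma> \<pi>'" and P: "graded_koszul R P n indet \<gamma> \<pi>"
    and h: "linear_map R P T h" "graded_map P \<pi> \<pi>' h"
    and exact: "koszul_exact indet n \<gamma> T \<mu> q" and y: "y \<in> koszul_chains n \<gamma> P \<mu> q"
    and zero: "\<And>I. h (koszul_d indet n P y I) = \<zero>\<^bsub>T\<^esub>"
  shows "\<exists>y'\<in>koszul_chains n \<gamma> T \<mu> (Suc q). \<forall>I. h (y I) = koszul_d indet n T y' I"
proof -
  interpret P: graded_koszul R P n indet \<gamma> \<pi> by fact
  interpret T: graded_koszul R T n indet \<gamma> \<pi>' by fact
  have "(\<lambda>I. h (y I)) \<in> koszul_chains n \<gamma> T \<mu> q"
    by (rule koszul_chains_map[OF graded_map_grade[OF P T linear_mapD(1)[OF h(1)] h(2)]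
      additive_map_zero[OF P.M.abelian_group_axioms T.M.abelian_group_axioms linear_mapD(1)[OF h(1)]] y])
  moreover have "koszul_d indet n T (\<lambda>I. h (y I)) I = \<zero>\<^bsub>T\<^esub>" for I
    using P.linear_map_koszul_d[of T h y I] T.module_axioms h(1) P.koszul_chains_carrier[OF y] zero by simp
  ultimately show ?thesis using exact unfolding koszul_exact_def by blast
qed

text \<open>The chase runs along the antidiagonal \<open>p + q = j\<close> down to \<open>p = 0\<close>. The hypothesis that the image of \<open>y\<close>
is a Koszul boundary is passed on by exactness of the columns: of those of the free modules in
positive exterior degree, and at the last step of that of \<open>M\<close>, which is met in exterior degree \<open>j\<close>.\<close>
private lemma resolution_step:
  assumes "y \<in> koszul_chains n \<gamma> (F p) \<mu> q" and "p + q = j"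
    and "p = 0 \<Longrightarrow> \<exists>y'\<in>koszul_chains n \<gamma> M \<mu> (Suc q). \<forall>I. \<epsilon> (y I) = koszul_d indet n M y' I"
    and "\<And>p'. p = Suc p' \<Longrightarrow> \<exists>y'\<in>koszul_chains n \<gamma> (F p') \<mu> (Suc q). \<forall>I. d p' (y I) = koszul_d indet n (F p') y' I"
  shows "\<exists>w\<in>koszul_chains n \<gamma> (F p) \<mu> (Suc q). \<exists>v\<in>koszul_chains n \<gamma> (F (Suc p)) \<mu> q.
    \<forall>I. y I = koszul_d indet n (F p) w I \<oplus>\<^bsub>F p\<^esub> d p (v I)"
  using assms
proof (induction p arbitrary: q y)
  case 0
  interpret F0: graded_koszul R "F 0" n indet \<gamma> "gcomp (F 0)" by (rule kF)
  interpret M: graded_koszul R M n indet \<gamma> "gcomp M" by (rule kM)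
  obtain y' where y': "y' \<in> koszul_chains n \<gamma> M \<mu> (Suc q)" "\<And>I. \<epsilon> (y I) = koszul_d indet n M y' I"
    using "0.prems" by blast
  have "y' I \<in> \<epsilon> ` carrier (F 0)" for I using M.koszul_chains_carrier[OF y'(1)] resD(5) by blast
  then obtain v' where v': "v' \<in> koszul_chains n \<gamma> (F 0) \<mu> (Suc q)" "\<And>I. y' I = \<epsilon> (v' I)"
    using homogeneous_preimage[OF kF kM linear_mapD(1)[OF \<epsilon>_maps(1)] \<epsilon>_maps(2) y'(1)] by blast
  show ?case
  proof (rule staircase_step[OF kF koM \<epsilon>_maps(1) _ "0.prems"(1) y'(2), where w' = "\<lambda>_. \<zero>\<^bsub>M\<^esub>"])
    fix z assume z: "z \<in> koszul_chains n \<gamma> (F 0) \<mu> q" "\<And>I. \<epsilon> (z I) = \<zero>\<^bsub>M\<^esub>"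
    have "z I \<in> d 0 ` carrier (F (Suc 0))" for I using F0.koszul_chains_carrier[OF z(1)] z(2) resD(6) by blast
    then show "\<exists>v\<in>koszul_chains n \<gamma> (F (Suc 0)) \<mu> q. \<forall>I. z I = d 0 (v I)"
      using homogeneous_preimage[OF kF kF linear_mapD(1)[OF d_maps(1)] d_maps(2) z(1)] by blast
  next
    show "y' I = koszul_d indet n M (\<lambda>_. \<zero>\<^bsub>M\<^esub>) I \<oplus>\<^bsub>M\<^esub> \<epsilon> (v' I)" for I
      using v'(2) M.koszul_chains_carrier[OF y'(1)] by (simp add: M.koszul_d_zero)
  qed (use v' in auto)
next
  case (Suc p)
  interpret F1: graded_koszul R "F (Suc p)" n indet \<gamma> "gcomp (F (Suc p))" by (rule kF)
  interpret F0: graded_koszul R "F p" n indet \<gamma> "gcomp (F p)" by (rule kF)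
  obtain y' where y': "y' \<in> koszul_chains n \<gamma> (F p) \<mu> (Suc q)" "\<And>I. d p (y I) = koszul_d indet n (F p) y' I"
    using Suc.prems by blast
  have yc: "y I \<in> carrier (F (Suc p))" for I using F1.koszul_chains_carrier[OF Suc.prems(1)] .
  have "\<exists>w'\<in>koszul_chains n \<gamma> (F p) \<mu> (Suc (Suc q)). \<exists>v'\<in>koszul_chains n \<gamma> (F (Suc p)) \<mu> (Suc q).
      \<forall>I. y' I = koszul_d indet n (F p) w' I \<oplus>\<^bsub>F p\<^esub> d p (v' I)"
  proof (rule Suc.IH[OF y'(1)])
    show "p + Suc q = j" using Suc.prems by simp
    show "\<exists>y''\<in>koszul_chains n \<gamma> M \<mu> (Suc (Suc q)). \<forall>I. \<epsilon> (y' I) = koszul_d indet n M y'' I" if "p = 0"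
    proof -
      have "\<epsilon> (d 0 (y I)) = \<zero>\<^bsub>M\<^esub>" for I using yc[of I] resD(6) that by blast
      then show ?thesis using boundary_from_cycle[OF kM kF \<epsilon>_maps, of "Suc q" y'] M_exact y' Suc.prems(2) that by simp
    qed
    show "\<exists>y''\<in>koszul_chains n \<gamma> (F p') \<mu> (Suc (Suc q)). \<forall>I. d p' (y' I) = koszul_d indet n (F p') y'' I" if p: "p = Suc p'" for p'
    proof -
      have "d p' (d p (y I)) = \<zero>\<^bsub>F p'\<^esub>" for I using yc[of I] resD(7)[of p'] p by blast
      moreover obtain E where "is_basis R (F p') E" using resD(2) by blast
      then have "koszul_exact indet n \<gamma> (F p') \<mu> (Suc q)" using free_koszul_exact[OF kF] by simp
      ultimately show ?thesis using boundary_from_cycle[OF kF kF d_maps, of p' "Suc q" y'] y' p by simp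
    qed
  qed
  then obtain w' v' where wv: "w' \<in> koszul_chains n \<gamma> (F p) \<mu> (Suc (Suc q))" "v' \<in> koszul_chains n \<gamma> (F (Suc p)) \<mu> (Suc q)"
      "\<And>I. y' I = koszul_d indet n (F p) w' I \<oplus>\<^bsub>F p\<^esub> d p (v' I)"
    by blast
  show ?case
  proof (rule staircase_step[OF kF koF d_maps(1) _ Suc.prems(1) y'(2) _ wv(2,3)])
    fix z assume z: "z \<in> koszul_chains n \<gamma> (F (Suc p)) \<mu> q" "\<And>I. d p (z I) = \<zero>\<^bsub>F p\<^esub>"
    have "z I \<in> d (Suc p) ` carrier (F (Suc (Suc p)))" for I using F1.koszul_chains_carrier[OF z(1)] z(2) resD(7) by blast
    then show "\<exists>v\<in>koszul_chains n \<gamma> (F (Suc (Suc p))) \<mu> q. \<forall>I. z I = d (Suc p) (v I)"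
      using homogeneous_preimage[OF kF kF linear_mapD(1)[OF d_maps(1)] d_maps(2) z(1)] by blast
  qed (use F0.koszul_chains_carrier[OF wv(1)] in auto)
qed

text \<open>Elements of the form \<open>koszul_d indet n N w {}\<close> are those of \<open>(X) N\<close>. So the hypothesis says that \<open>z\<close> is a
cycle modulo \<open>(X)\<close>, and the conclusion that it is a boundary modulo \<open>(X)\<close>.\<close>
lemma resolution_cycle_mod_irrelevant:
  assumes z: "z \<in> grade (F j) \<mu>"
    and u: "\<And>i. j = Suc i \<Longrightarrow> \<exists>u. (\<forall>I. u I \<in> carrier (F i)) \<and> d i z = koszul_d indet n (F i) u {}"
  shows "\<exists>w v. (\<forall>I. w I \<in> carrier (F j)) \<and> v \<in> carrier (F (Suc j)) \<and> z = koszul_d indet n (F j) w {} \<oplus>\<^bsub>F j\<^esub> d j v"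
proof -
  interpret Fj: graded_koszul R "F j" n indet \<gamma> "gcomp (F j)" by (rule kF)
  interpret Fj': graded_koszul R "F (Suc j)" n indet \<gamma> "gcomp (F (Suc j))" by (rule kF)
  let ?y = "\<lambda>I. if I = {} then z else \<zero>\<^bsub>F j\<^esub>"
  have single: "(\<lambda>I. if I = {} then z' else \<zero>\<^bsub>N\<^esub>) \<in> koszul_chains n \<gamma> N \<mu> 0" if "z' \<in> grade N \<mu>"
    for N :: "(nat multiset \<Rightarrow> 's, 'f, 'g) gmodule" and z'
  proof (rule koszul_chainsI)
    fix I assume "I \<subseteq> {..<n}" "card I = 0"
    then have "I = {}" using finite_subset[of I "{..<n}"] by simp
    then show "(if I = {} then z' else \<zero>\<^bsub>N\<^esub>) \<in> grade N (\<mu> - sum \<gamma> I)" using that by simp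
  qed auto
  have y: "?y \<in> koszul_chains n \<gamma> (F j) \<mu> 0" using single z by blast
  have "\<exists>w\<in>koszul_chains n \<gamma> (F j) \<mu> (Suc 0). \<exists>v\<in>koszul_chains n \<gamma> (F (Suc j)) \<mu> 0.
    \<forall>I. ?y I = koszul_d indet n (F j) w I \<oplus>\<^bsub>F j\<^esub> d j (v I)"
  proof (rule resolution_step[OF y])
    show "\<exists>y'\<in>koszul_chains n \<gamma> M \<mu> (Suc 0). \<forall>I. \<epsilon> (?y I) = koszul_d indet n M y' I" if j: "j = 0"
    proof -
      interpret M: graded_koszul R M n indet \<gamma> "gcomp M" by (rule kM)
      have y0: "?y \<in> koszul_chains n \<gamma> (F 0) \<mu> 0" using y j by simp
      interpret F0: graded_koszul R "F 0" n indet \<gamma> "gcomp (F 0)" by (rule kF)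
      have "\<epsilon> (koszul_d indet n (F 0) ?y I) = \<zero>\<^bsub>M\<^esub>" for I
        using F0.koszul_d_koszul_chains_0[OF y0] additive_map_zero[OF F0.M.abelian_group_axioms M.M.abelian_group_axioms
            linear_mapD(1)[OF \<epsilon>_maps(1)]] by simp
      then show ?thesis using boundary_from_cycle[OF kM kF \<epsilon>_maps, of 0 ?y] M_exact y0 j by simp
    qed
    show "\<exists>y'\<in>koszul_chains n \<gamma> (F i) \<mu> (Suc 0). \<forall>I. d i (?y I) = koszul_d indet n (F i) y' I" if j: "j = Suc i" for i
    proof -
      interpret Fi: graded_koszul R "F i" n indet \<gamma> "gcomp (F i)" by (rule kF)
      obtain u where u: "\<And>I. u I \<in> carrier (F i)" "d i z = koszul_d indet n (F i) u {}" using assms(2)[OF j] by blast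
      have dz: "d i z \<in> grade (F i) \<mu>" 
        using z j resD(3)[of i] unfolding graded_hom_def image_subset_iff by blast
      let ?u = "\<lambda>J. if card J = 1 \<and> J \<subseteq> {..<n} then u J else \<zero>\<^bsub>F i\<^esub>"
      have d0: "d i \<zero>\<^bsub>F j\<^esub> = \<zero>\<^bsub>F i\<^esub>"
        using additive_map_zero[OF Fj.M.abelian_group_axioms Fi.M.abelian_group_axioms, of "d i"]
          linear_mapD(1)[OF d_maps(1)[of i]] j by simp
      have "d i (?y I) = koszul_d indet n (F i) ?u I" for I
      proof (cases "I = {}")
        case True
        then show ?thesis using u by (auto simp: koszul_d_def indet_closed intro!: Fi.M.finsum_cong')
      next
        case False
        have "koszul_d indet n (F i) ?u I = \<zero>\<^bsub>F i\<^esub>"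
        proof (cases "I \<subseteq> {..<n}")
          case True
          then have "finite I" by (rule finite_subset) simp
          then have "card (insert k I) \<noteq> Suc 0" if "k \<notin> I" for k using that False by simp
          then show ?thesis unfolding koszul_d_def
            by (auto intro!: Fi.M.add.finprod_one_eqI simp: indet_closed)
        qed (simp add: koszul_d_def)
        then show ?thesis using False d0 by simp
      qed
      moreover have "(\<lambda>I. d i (?y I)) \<in> koszul_chains n \<gamma> (F i) \<mu> 0"
        using single[OF dz] d0 by (simp add: if_distrib[of "d i"] cong: if_cong)
      ultimately show ?thesis using u(1) by (intro Fi.homogeneous_koszul_d_preimage) auto
    qed
  qed simp
  then obtain w v where wv: "w\<in>koszul_chains n \<gamma> (F j) \<mu> (Suc 0)" "v\<in>koszul_chains n \<gamma> (F (Suc j)) \<mu> 0"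
    "\<And>I. ?y I = koszul_d indet n (F j) w I \<oplus>\<^bsub>F j\<^esub> d j (v I)" by blast
  then show ?thesis using wv(3)[of "{}"] Fj.koszul_chains_carrier[OF wv(1)] Fj'.koszul_chains_carrier[OF wv(2)]
    by (intro exI[of _ w] exI[of _ "v {}"]) simp
qed

end

end

section \<open>Tensor products with the residue ring\<close>
lemma (in abelian_monoid) finsum_in_submonoid:
  assumes "finite A" "\<And>a. a \<in> A \<Longrightarrow> f a \<in> Q" "Q \<subseteq> carrier G" "\<zero> \<in> Q" "\<And>x y. x \<in> Q \<Longrightarrow> y \<in> Q \<Longrightarrow> x \<oplus> y \<in> Q"
  shows "(\<Oplus>a\<in>A. f a) \<in> Q"
  using assms(1,2)
proof (induction A)
  case (insert a A)
  then have "(\<Oplus>a\<in>insert a A. f a) = f a \<oplus> (\<Oplus>a\<in>A. f a)"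
    using assms(3) by (intro finsum_insert) auto
  then show ?case using insert assms(5) by simp
qed (simp add: assms(4))

locale tensor = M: module R M + N: module R N
  for R :: "('r, 'g::ab_group_add) gring" and M :: "('r, 'm, 'g) gmodule" and N :: "('r, 'k, 'g) gmodule"
begin

abbreviation (input) "FG \<equiv> tensor_free M N"
abbreviation (input) "T \<equiv> generate (tensor_free M N) (tensor_relators R M N)"
abbreviation (input) "cl z \<equiv> tensor_class R M N z"

lemma relator_cases:
  assumes "t \<in> tensor_relators R M N"
  obtains
    (1) x x' y where "t = frag_of (x \<oplus>\<^bsub>M\<^esub> x', y) - frag_of (x, y) - frag_of (x', y)"
      "x \<in> carrier M" "x' \<in> carrier M" "y \<in> carrier N"
  | (2) x y y' where "t = frag_of (x, y \<oplus>\<^bsub>N\<^esub> y') - frag_of (x, y) - frag_of (x, y')"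
      "x \<in> carrier M" "y \<in> carrier N" "y' \<in> carrier N"
  | (3) r x y where "t = frag_of (r \<odot>\<^bsub>M\<^esub> x, y) - frag_of (x, r \<odot>\<^bsub>N\<^esub> y)"
      "r \<in> carrier R" "x \<in> carrier M" "y \<in> carrier N"
  using assms unfolding tensor_relators_def by blast

lemma tensor_relators_carrier: "tensor_relators R M N \<subseteq> carrier FG"
proof -
  have "a - b \<in> carrier FG" if "a \<in> carrier FG" "b \<in> carrier FG" for a b
    using that keys_diff[of a b] by auto
  then show ?thesis
    by (auto simp: tensor_relators_def simp del: carrier_free_Abelian_group_iff
        intro!: frag_of_in_free_Abelian_group[THEN iffD2])
qed

lemma subgroup_T: "subgroup T FG"
  by (rule group.generate_is_subgroup[OF group_free_Abelian_group tensor_relators_carrier])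

lemma T_closed: "0 \<in> T" "a \<in> T \<Longrightarrow> b \<in> T \<Longrightarrow> a + b \<in> T" "a \<in> T \<Longrightarrow> - a \<in> T" "a \<in> T \<Longrightarrow> b \<in> T \<Longrightarrow> a - b \<in> T"
proof -
  show 0: "0 \<in> T" using subgroup.one_closed[OF subgroup_T] by simp
  show add: "a + b \<in> T" if "a \<in> T" "b \<in> T" for a b using subgroup.m_closed[OF subgroup_T that] by simp
  show neg: "- a \<in> T" if "a \<in> T" for a
  proof -
    have "a \<in> carrier FG" using subgroup.subset[OF subgroup_T] that by blast
    then have "Poly_Mapping.keys a \<subseteq> carrier M \<times> carrier N" by (simp only: carrier_free_Abelian_group_iff)
    then show ?thesis using subgroup.m_inv_closed[OF subgroup_T that] by simp
  qed
  show "a - b \<in> T" if "a \<in> T" "b \<in> T" using add[OF that(1) neg[OF that(2)]] by simp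
qed

lemma relator_in_T: "t \<in> tensor_relators R M N \<Longrightarrow> t \<in> T"
  by (rule generate.incl)

lemma in_class: "z \<in> cl a \<longleftrightarrow> z - a \<in> T"
proof -
  have "z \<in> cl a \<longleftrightarrow> (\<exists>t\<in>T. z = t + a)" by (auto simp: tensor_class_def r_coset_def)
  also have "\<dots> \<longleftrightarrow> z - a \<in> T" by (metis add_diff_cancel diff_add_cancel)
  finally show ?thesis .
qed

lemma class_eq_iff: "cl a = cl b \<longleftrightarrow> a - b \<in> T"
proof
  assume "cl a = cl b"
  moreover have "a \<in> cl a" using T_closed(1) by (simp add: in_class)
  ultimately show "a - b \<in> T" by (simp add: in_class)
next
  assume ab: "a - b \<in> T"
  have "z - a \<in> T \<longleftrightarrow> z - b \<in> T" for z
    using T_closed(2)[OF _ ab, of "z - a"] T_closed(4)[OF _ ab, of "z - b"] by auto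
  then show "cl a = cl b" using in_class by blast
qed

lemma class_add: "cl a \<oplus>\<^bsub>gtensor R M N\<^esub> cl b = cl (a + b)"
proof -
  have "cl a \<oplus>\<^bsub>gtensor R M N\<^esub> cl b = {u + v | u v. u \<in> cl a \<and> v \<in> cl b}"
    by (auto simp: gtensor_def set_mult_def)
  also have "\<dots> = cl (a + b)"
  proof (intro equalityI subsetI)
    fix z assume "z \<in> {u + v | u v. u \<in> cl a \<and> v \<in> cl b}"
    then obtain u v where "z = u + v" "u - a \<in> T" "v - b \<in> T" by (auto simp: in_class)
    then have "z - (a + b) \<in> T" using T_closed(2)[of "u - a" "v - b"] by (simp add: algebra_simps)
    then show "z \<in> cl (a + b)" by (simp add: in_class)
  next
    fix z assume "z \<in> cl (a + b)"
    then have "z - b \<in> cl a" "b \<in> cl b" using T_closed(1) by (simp_all add: in_class algebra_simps)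
    then show "z \<in> {u + v | u v. u \<in> cl a \<and> v \<in> cl b}" by force
  qed
  finally show ?thesis .
qed

lemma relators:
  assumes "x \<in> carrier M" "y \<in> carrier N"
  shows "x' \<in> carrier M \<Longrightarrow> frag_of (x \<oplus>\<^bsub>M\<^esub> x', y) - frag_of (x, y) - frag_of (x', y) \<in> T"
    and "r \<in> carrier R \<Longrightarrow> frag_of (r \<odot>\<^bsub>M\<^esub> x, y) - frag_of (x, r \<odot>\<^bsub>N\<^esub> y) \<in> T"
  using assms by (intro relator_in_T; force simp: tensor_relators_def)+

end

lemma (in graded_poly) irrelevant_ideal: "ideal (irrelevant_ideal S n \<gamma>) R" "irrelevant_ideal S n \<gamma> = Idl\<^bsub>R\<^esub> (indet ` {..<n})"
proof -
  show eq: "irrelevant_ideal S n \<gamma> = Idl\<^bsub>R\<^esub> (indet ` {..<n})" by (simp add: irrelevant_ideal_def indet_def)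
  show "ideal (irrelevant_ideal S n \<gamma>) R" unfolding eq using indet_closed by (intro R.genideal_ideal) auto
qed

context graded_poly
begin

abbreviation (input) "\<mm> \<equiv> irrelevant_ideal S n \<gamma>"
abbreviation (input) "K \<equiv> base_gmodule S n \<gamma>"

definition residue :: "(nat multiset \<Rightarrow> 's) \<Rightarrow> (nat multiset \<Rightarrow> 's) set" where
  "residue r = irrelevant_ideal S n \<gamma> +>\<^bsub>R\<^esub> r"

lemma base_sel:
  "carrier K = residue ` carrier R" "grade K \<nu> = residue ` homog R \<nu>" "\<zero>\<^bsub>K\<^esub> = \<mm>"
proof -
  have coset: "\<mm> +>\<^bsub>regular_gmodule R\<^esub> r = residue r" for r by (simp add: residue_def a_r_coset_def' regular_sel)
  show "carrier K = residue ` carrier R"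
    by (auto simp: base_gmodule_def gquot_def A_RCOSETS_def' regular_sel coset)
  show "grade K \<nu> = residue ` homog R \<nu>" "\<zero>\<^bsub>K\<^esub> = \<mm>"
    by (auto simp: base_gmodule_def gquot_def coset) (auto simp: regular_gmodule_def)
qed

lemma residue_eq_iff: "r \<in> carrier R \<Longrightarrow> s \<in> carrier R \<Longrightarrow> residue r = residue s \<longleftrightarrow> r \<ominus>\<^bsub>R\<^esub> s \<in> \<mm>"
  unfolding residue_def using R.quotient_eq_iff_same_a_r_cos[OF irrelevant_ideal(1)] by simp

lemma residue_self: "r \<in> carrier R \<Longrightarrow> r \<in> residue r"
  using additive_subgroup.zero_closed[OF ideal.axioms(1)[OF irrelevant_ideal(1)]] R.l_zero[of r]
  unfolding residue_def a_r_coset_def' by (metis UN_I singletonI)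

lemma base_add: "r \<in> carrier R \<Longrightarrow> s \<in> carrier R \<Longrightarrow> residue r \<oplus>\<^bsub>K\<^esub> residue s = residue (r \<oplus>\<^bsub>R\<^esub> s)"
proof -
  assume rs: "r \<in> carrier R" "s \<in> carrier R"
  have "residue r \<oplus>\<^bsub>K\<^esub> residue s = residue r <+>\<^bsub>R\<^esub> residue s"
    by (simp add: base_gmodule_def gquot_def set_add_def' regular_sel)
  then show ?thesis unfolding residue_def using ideal.a_rcos_sum[OF irrelevant_ideal(1) rs] by simp
qed

lemma base_smult:
  assumes r: "r \<in> carrier R" and s: "s \<in> carrier R"
  shows "r \<odot>\<^bsub>K\<^esub> residue s = residue (r \<otimes>\<^bsub>R\<^esub> s)"
proof -
  interpret I: ideal \<mm> R by (rule irrelevant_ideal(1))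
  have coset: "\<mm> +>\<^bsub>regular_gmodule R\<^esub> r = residue r" for r by (simp add: residue_def a_r_coset_def' regular_sel)
  have "r \<odot>\<^bsub>K\<^esub> residue s = (\<Union>x\<in>residue s. residue (r \<otimes>\<^bsub>R\<^esub> x))"
    by (simp add: base_gmodule_def gquot_def coset regular_sel)
  also have "\<dots> = (\<Union>x\<in>residue s. residue (r \<otimes>\<^bsub>R\<^esub> s))"
  proof (rule SUP_cong[OF refl])
    fix x assume "x \<in> residue s"
    then obtain i where i: "i \<in> \<mm>" "x = i \<oplus>\<^bsub>R\<^esub> s" by (auto simp: residue_def a_r_coset_def')
    then have ic: "i \<in> carrier R" using I.a_subset by blast
    have "r \<otimes>\<^bsub>R\<^esub> x \<ominus>\<^bsub>R\<^esub> r \<otimes>\<^bsub>R\<^esub> s = r \<otimes>\<^bsub>R\<^esub> i"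
      using r s ic i(2) by (simp add: R.r_distr a_minus_def R.a_assoc R.r_neg)
    then have "r \<otimes>\<^bsub>R\<^esub> x \<ominus>\<^bsub>R\<^esub> r \<otimes>\<^bsub>R\<^esub> s \<in> \<mm>" using I.I_l_closed[OF i(1) r] by simp
    then show "residue (r \<otimes>\<^bsub>R\<^esub> x) = residue (r \<otimes>\<^bsub>R\<^esub> s)" using residue_eq_iff r s ic i(2) by simp
  qed
  also have "\<dots> = residue (r \<otimes>\<^bsub>R\<^esub> s)" using residue_self[OF s] by auto
  finally show ?thesis .
qed

lemma module_base: "module R K"
proof (rule moduleI[OF R.cring_axioms])
  show "abelian_group K"
  proof (rule abelian_groupI)
    have z: "\<zero>\<^bsub>K\<^esub> = residue \<zero>\<^bsub>R\<^esub>"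
      unfolding base_sel residue_def by (metis R.add.coset_mult_one a_r_coset_def ideal.Icarr irrelevant_ideal(1) monoid.simps(2) partial_object.select_convs(1) subsetI)
    show "\<zero>\<^bsub>K\<^esub> \<in> carrier K" unfolding z base_sel by simp
    fix x assume "x \<in> carrier K"
    then obtain r where r: "r \<in> carrier R" "x = residue r" by (auto simp: base_sel)
    show "\<zero>\<^bsub>K\<^esub> \<oplus>\<^bsub>K\<^esub> x = x" using r by (simp add: z base_add)
    show "\<exists>y\<in>carrier K. y \<oplus>\<^bsub>K\<^esub> x = \<zero>\<^bsub>K\<^esub>"
      using r by (intro bexI[of _ "residue (\<ominus>\<^bsub>R\<^esub> r)"]) (auto simp: z base_add base_sel(1) R.l_neg)
  qed (auto simp: base_sel(1) base_add R.a_ac)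
qed (auto simp: base_sel(1) base_add base_smult R.l_distr R.r_distr R.m_assoc)

end

context graded_poly
begin

text \<open>The submodule \<open>(X) F\<close>, in the form in which the chase through the resolution produces it.\<close>
definition irrelevant_span :: "(nat multiset \<Rightarrow> 's, 'f, 'g) gmodule \<Rightarrow> 'f set" where
  "irrelevant_span F = {koszul_d indet n F w {} | w. \<forall>I. w I \<in> carrier F}"

definition residue_rep :: "(nat multiset \<Rightarrow> 's) set \<Rightarrow> (nat multiset \<Rightarrow> 's)" where
  "residue_rep U = (SOME r. r \<in> carrier R \<and> residue r = U)"

definition unit_tensor :: "(nat multiset \<Rightarrow> 's, 'f, 'g) gmodule \<Rightarrow> 'f \<Rightarrow> ('f \<times> (nat multiset \<Rightarrow> 's) set \<Rightarrow>\<^sub>0 int) set" where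
  "unit_tensor F x = tensor_class R F K (frag_of (x, residue \<one>\<^bsub>R\<^esub>))"

context
  fixes F :: "(nat multiset \<Rightarrow> 's, 'f, 'g) gmodule"
  assumes F: "module R F"
begin

interpretation F: koszul R F n indet
  by (rule koszul.intro[OF F]) (simp add: koszul_axioms_def indet_closed)

interpretation t: tensor R F K
  by (intro tensor.intro F module_base)

lemma irrelevant_span_closed:
  "irrelevant_span F \<subseteq> carrier F" "\<zero>\<^bsub>F\<^esub> \<in> irrelevant_span F"
  "z \<in> irrelevant_span F \<Longrightarrow> z' \<in> irrelevant_span F \<Longrightarrow> z \<oplus>\<^bsub>F\<^esub> z' \<in> irrelevant_span F"
  "z \<in> irrelevant_span F \<Longrightarrow> \<ominus>\<^bsub>F\<^esub> z \<in> irrelevant_span F"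
proof -
  show "irrelevant_span F \<subseteq> carrier F" by (auto simp: irrelevant_span_def intro: F.koszul_d_closed)
  show "\<zero>\<^bsub>F\<^esub> \<in> irrelevant_span F"
    unfolding irrelevant_span_def by (intro CollectI exI[of _ "\<lambda>_. \<zero>\<^bsub>F\<^esub>"]) (simp add: F.koszul_d_zero)
  assume "z \<in> irrelevant_span F"
  then obtain w where w: "z = koszul_d indet n F w {}" "\<And>I. w I \<in> carrier F" by (auto simp: irrelevant_span_def)
  show "\<ominus>\<^bsub>F\<^esub> z \<in> irrelevant_span F"
    unfolding irrelevant_span_def w(1)
    by (intro CollectI exI[of _ "\<lambda>I. \<ominus>\<^bsub>F\<^esub> w I"]) (simp add: F.koszul_d_minus w(2))
  assume "z' \<in> irrelevant_span F"
  then obtain w' where w': "z' = koszul_d indet n F w' {}" "\<And>I. w' I \<in> carrier F" by (auto simp: irrelevant_span_def)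
  show "z \<oplus>\<^bsub>F\<^esub> z' \<in> irrelevant_span F"
    unfolding irrelevant_span_def w(1) w'(1)
    by (intro CollectI exI[of _ "\<lambda>I. w I \<oplus>\<^bsub>F\<^esub> w' I"]) (simp add: F.koszul_d_add w(2) w'(2))
qed

lemma irrelevant_smult:
  assumes r: "r \<in> \<mm>" and x: "x \<in> carrier F"
  shows "r \<odot>\<^bsub>F\<^esub> x \<in> irrelevant_span F"
proof -
  let ?y = "\<lambda>I :: nat set. if I = {} then x else \<zero>\<^bsub>F\<^esub>"
  have cycle: "koszul_d indet n F ?y I = \<zero>\<^bsub>F\<^esub>" for I
    unfolding koszul_d_def by (auto intro!: F.M.add.finprod_one_eqI simp: indet_closed)
  have y: "?y I \<in> carrier F" "\<not> I \<subseteq> {..<n} \<Longrightarrow> ?y I = \<zero>\<^bsub>F\<^esub>" for I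
    using x by auto
  obtain w where w: "\<forall>I. w I \<in> carrier F" "\<forall>I. r \<odot>\<^bsub>F\<^esub> ?y I = koszul_d indet n F w I"
    using F.ideal_kills_koszul_cycles[of ?y r, OF y cycle] r unfolding irrelevant_ideal(2) by blast
  have "r \<odot>\<^bsub>F\<^esub> x = koszul_d indet n F w {}" using spec[OF w(2), of "{}"] by simp
  then show ?thesis unfolding irrelevant_span_def using w(1) by blast
qed

lemma residue_rep: "U \<in> carrier K \<Longrightarrow> residue_rep U \<in> carrier R" "U \<in> carrier K \<Longrightarrow> residue (residue_rep U) = U"
proof -
  assume "U \<in> carrier K"
  then have "\<exists>r. r \<in> carrier R \<and> residue r = U" by (auto simp: base_sel(1))
  from someI_ex[OF this] show "residue_rep U \<in> carrier R" "residue (residue_rep U) = U" by (simp_all add: residue_rep_def)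
qed

text \<open>This is injectivity of \<open>F / (X) F \<longrightarrow> F \<otimes> S\<close>. The inverse map is induced by \<open>(x, U) \<mapsto> r x\<close> with \<open>r\<close> a
representative of \<open>U\<close>. The choice of representatives is not additive, but it is so modulo \<open>(X)\<close>, hence
the relators are mapped to \<open>(X) F\<close>.\<close>
lemma tensor_one_in_relations_imp_span:
  assumes x: "x \<in> carrier F" and T: "frag_of (x, residue \<one>\<^bsub>R\<^esub>) \<in> generate (tensor_free F K) (tensor_relators R F K)"
  shows "x \<in> irrelevant_span F"
proof -
  interpret K: module R K by (rule module_base)
  define f where "f = (\<lambda>(x, U). residue_rep U \<odot>\<^bsub>F\<^esub> x)"
  have img: "f ` (carrier F \<times> carrier K) \<subseteq> carrier (add_monoid F)"
    using residue_rep(1) by (auto simp: f_def)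
  have "\<exists>h. h \<in> hom (tensor_free F K) (add_monoid F) \<and> (\<forall>p\<in>carrier F \<times> carrier K. h (frag_of p) = f p)"
  proof (rule comm_group.free_Abelian_group_universal[OF F.M.a_comm_group img])
    fix h assume h: "h \<in> hom (tensor_free F K) (add_monoid F)" "\<And>p. p \<in> carrier F \<times> carrier K \<Longrightarrow> h (frag_of p) = f p"
    show ?thesis by (rule exI[of _ h], rule conjI, rule h(1), rule ballI, rule h(2))
  qed
  then obtain h where "h \<in> hom (tensor_free F K) (add_monoid F) \<and> (\<forall>p\<in>carrier F \<times> carrier K. h (frag_of p) = f p)" ..
  then have h: "h \<in> hom (tensor_free F K) (add_monoid F)" "\<And>p. p \<in> carrier F \<times> carrier K \<Longrightarrow> h (frag_of p) = f p"
    by auto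
  have ho: "h (frag_of (x, U)) = residue_rep U \<odot>\<^bsub>F\<^esub> x" if "x \<in> carrier F" "U \<in> carrier K" for x U
    using h(2)[of "(x, U)"] that by (simp add: f_def)
  have hc: "h a \<in> carrier F" if "Poly_Mapping.keys a \<subseteq> carrier F \<times> carrier K" for a
    using hom_in_carrier[OF h(1), of a] that by simp
  have kd: "Poly_Mapping.keys (a + b) \<subseteq> A" "Poly_Mapping.keys (a - b) \<subseteq> A" "Poly_Mapping.keys (- a) \<subseteq> A"
    if "Poly_Mapping.keys a \<subseteq> A" "Poly_Mapping.keys b \<subseteq> A" for a b :: "('f \<times> (nat multiset \<Rightarrow> 's) set) \<Rightarrow>\<^sub>0 int" and A
    using that keys_add[of a b] keys_diff[of a b] by auto
  have hadd: "h (a + b) = h a \<oplus>\<^bsub>F\<^esub> h b"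
    if "Poly_Mapping.keys a \<subseteq> carrier F \<times> carrier K" "Poly_Mapping.keys b \<subseteq> carrier F \<times> carrier K" for a b
    using hom_mult[OF h(1), of a b] that by simp
  have hzero: "h 0 = \<zero>\<^bsub>F\<^esub>"
    using hadd[of 0 0] hc[of 0] F.M.add.l_cancel_one by simp
  have hminus: "h (- a) = \<ominus>\<^bsub>F\<^esub> h a" if a: "Poly_Mapping.keys a \<subseteq> carrier F \<times> carrier K" for a
  proof (rule F.M.minus_equality[symmetric])
    show "h (- a) \<oplus>\<^bsub>F\<^esub> h a = \<zero>\<^bsub>F\<^esub>" using hadd[of "- a" a] a hzero by simp
  qed (use hc a in auto)
  have hdiff: "h (a - b) = h a \<ominus>\<^bsub>F\<^esub> h b"
    if "Poly_Mapping.keys a \<subseteq> carrier F \<times> carrier K" "Poly_Mapping.keys b \<subseteq> carrier F \<times> carrier K" for a b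
    using hadd[of a "- b"] hminus[OF that(2)] that by (simp add: a_minus_def)
  let ?Q = "{a. Poly_Mapping.keys a \<subseteq> carrier F \<times> carrier K \<and> h a \<in> irrelevant_span F}"
  have subgroup: "subgroup ?Q (tensor_free F K)"
  proof (rule group.subgroupI[OF group_free_Abelian_group])
    have "0 \<in> ?Q" using hzero irrelevant_span_closed(2) by simp
    then show "?Q \<noteq> {}" by blast
    show "?Q \<subseteq> carrier (tensor_free F K)" by auto
    show "a \<otimes>\<^bsub>tensor_free F K\<^esub> b \<in> ?Q" if "a \<in> ?Q" "b \<in> ?Q" for a b
      using that hadd kd irrelevant_span_closed(3) by simp
    show "inv\<^bsub>tensor_free F K\<^esub> a \<in> ?Q" if "a \<in> ?Q" for a
      using that hminus irrelevant_span_closed(4) by simp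
  qed
  have keys1: "Poly_Mapping.keys (frag_of (x, y)) \<subseteq> carrier F \<times> carrier K" if "x \<in> carrier F" "y \<in> carrier K" for x y
    using that by simp
  have repdiff: "r \<odot>\<^bsub>F\<^esub> x \<ominus>\<^bsub>F\<^esub> s \<odot>\<^bsub>F\<^esub> x \<in> irrelevant_span F"
    if "r \<in> carrier R" "s \<in> carrier R" "residue r = residue s" "x \<in> carrier F" for r s x
  proof -
    have "r \<ominus>\<^bsub>R\<^esub> s \<in> \<mm>" using that residue_eq_iff by simp
    moreover have "(r \<ominus>\<^bsub>R\<^esub> s) \<odot>\<^bsub>F\<^esub> x = r \<odot>\<^bsub>F\<^esub> x \<ominus>\<^bsub>F\<^esub> s \<odot>\<^bsub>F\<^esub> x"
      using that by (simp add: a_minus_def F.smult_l_distr F.smult_l_minus)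
    ultimately show ?thesis using irrelevant_smult[OF _ that(4)] by metis
  qed
  have "tensor_relators R F K \<subseteq> ?Q"
  proof
    fix a assume "a \<in> tensor_relators R F K"
    then show "a \<in> ?Q"
    proof (cases rule: t.relator_cases)
      case (1 x x' y)
      have "h a = residue_rep y \<odot>\<^bsub>F\<^esub> (x \<oplus>\<^bsub>F\<^esub> x') \<ominus>\<^bsub>F\<^esub> residue_rep y \<odot>\<^bsub>F\<^esub> x \<ominus>\<^bsub>F\<^esub> residue_rep y \<odot>\<^bsub>F\<^esub> x'"
        unfolding 1(1) using 1(2-) by (simp add: hdiff kd keys1 ho del: keys_frag_of)
      also have "\<dots> = \<zero>\<^bsub>F\<^esub>"
        using 1(2-) residue_rep(1) by (simp add: a_minus_def F.smult_r_distr F.M.a_ac F.M.r_neg F.M.minus_add F.M.r_neg1)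
      finally show ?thesis using 1 kd keys1 irrelevant_span_closed(2) by (simp del: keys_frag_of)
    next
      case (2 x y y')
      note r = residue_rep[OF 2(3)] residue_rep[OF 2(4)]
      have y: "y \<oplus>\<^bsub>K\<^esub> y' \<in> carrier K" using 2 by simp
      have "residue (residue_rep (y \<oplus>\<^bsub>K\<^esub> y')) = residue (residue_rep y \<oplus>\<^bsub>R\<^esub> residue_rep y')"
        using residue_rep(2)[OF y] base_add[OF r(1) r(3)] r by simp
      then have "residue_rep (y \<oplus>\<^bsub>K\<^esub> y') \<odot>\<^bsub>F\<^esub> x \<ominus>\<^bsub>F\<^esub> (residue_rep y \<oplus>\<^bsub>R\<^esub> residue_rep y') \<odot>\<^bsub>F\<^esub> x \<in> irrelevant_span F"
        using repdiff[OF residue_rep(1)[OF y]] r 2(2) by simp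
      moreover have "h a = residue_rep (y \<oplus>\<^bsub>K\<^esub> y') \<odot>\<^bsub>F\<^esub> x \<ominus>\<^bsub>F\<^esub> residue_rep y \<odot>\<^bsub>F\<^esub> x \<ominus>\<^bsub>F\<^esub> residue_rep y' \<odot>\<^bsub>F\<^esub> x"
        unfolding 2(1) using 2(2-) y by (simp add: hdiff kd keys1 ho del: keys_frag_of)
      moreover have "\<dots> = residue_rep (y \<oplus>\<^bsub>K\<^esub> y') \<odot>\<^bsub>F\<^esub> x \<ominus>\<^bsub>F\<^esub> (residue_rep y \<oplus>\<^bsub>R\<^esub> residue_rep y') \<odot>\<^bsub>F\<^esub> x"
        using r residue_rep(1)[OF y] 2(2) by (simp add: a_minus_def F.smult_l_distr F.M.minus_add F.M.a_ac)
      ultimately show ?thesis using 2 y kd keys1 by (simp del: keys_frag_of)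
    next
      case (3 r x y)
      note r = residue_rep[OF 3(4)]
      have y: "r \<odot>\<^bsub>K\<^esub> y \<in> carrier K" using 3 by simp
      have "residue (residue_rep y \<otimes>\<^bsub>R\<^esub> r) = residue (residue_rep (r \<odot>\<^bsub>K\<^esub> y))"
        using residue_rep(2)[OF y] base_smult[OF 3(2) r(1)] r 3(2) by (simp add: R.m_comm)
      then have "(residue_rep y \<otimes>\<^bsub>R\<^esub> r) \<odot>\<^bsub>F\<^esub> x \<ominus>\<^bsub>F\<^esub> residue_rep (r \<odot>\<^bsub>K\<^esub> y) \<odot>\<^bsub>F\<^esub> x \<in> irrelevant_span F"
        using repdiff[OF _ residue_rep(1)[OF y]] r 3 by simp
      moreover have "h a = (residue_rep y \<otimes>\<^bsub>R\<^esub> r) \<odot>\<^bsub>F\<^esub> x \<ominus>\<^bsub>F\<^esub> residue_rep (r \<odot>\<^bsub>K\<^esub> y) \<odot>\<^bsub>F\<^esub> x"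
        unfolding 3(1) using 3(2-) y r by (simp add: hdiff keys1 ho F.smult_assoc1 del: keys_frag_of)
      ultimately show ?thesis using 3 y kd keys1 by (simp del: keys_frag_of)
    qed
  qed
  then have "frag_of (x, residue \<one>\<^bsub>R\<^esub>) \<in> ?Q"
    using group.generate_subgroup_incl[OF group_free_Abelian_group _ subgroup] T by blast
  moreover have 1: "residue \<one>\<^bsub>R\<^esub> \<in> carrier K" by (simp add: base_sel(1))
  ultimately have "residue_rep (residue \<one>\<^bsub>R\<^esub>) \<odot>\<^bsub>F\<^esub> x \<in> irrelevant_span F" using ho[OF x 1] by simp
  moreover have "\<one>\<^bsub>R\<^esub> \<odot>\<^bsub>F\<^esub> x \<ominus>\<^bsub>F\<^esub> residue_rep (residue \<one>\<^bsub>R\<^esub>) \<odot>\<^bsub>F\<^esub> x \<in> irrelevant_span F"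
    using repdiff[of "\<one>\<^bsub>R\<^esub>" "residue_rep (residue \<one>\<^bsub>R\<^esub>)" x] residue_rep[OF 1] x by simp
  ultimately have "(\<one>\<^bsub>R\<^esub> \<odot>\<^bsub>F\<^esub> x \<ominus>\<^bsub>F\<^esub> residue_rep (residue \<one>\<^bsub>R\<^esub>) \<odot>\<^bsub>F\<^esub> x) \<oplus>\<^bsub>F\<^esub> residue_rep (residue \<one>\<^bsub>R\<^esub>) \<odot>\<^bsub>F\<^esub> x \<in> irrelevant_span F"
    by (intro irrelevant_span_closed(3))
  then show ?thesis using residue_rep(1)[OF 1] x by (simp add: a_minus_def F.M.a_assoc F.M.l_neg)
qed

lemma residue_one: "residue \<one>\<^bsub>R\<^esub> \<in> carrier K"
  by (simp add: base_sel(1))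

lemma unit_tensor_add: "x \<in> carrier F \<Longrightarrow> y \<in> carrier F \<Longrightarrow> unit_tensor F (x \<oplus>\<^bsub>F\<^esub> y) = unit_tensor F x \<oplus>\<^bsub>gtensor R F K\<^esub> unit_tensor F y"
  unfolding unit_tensor_def t.class_add t.class_eq_iff using t.relators(1)[OF _ residue_one, of x y] by (simp add: algebra_simps)

lemma unit_tensor_in_carrier: "x \<in> carrier F \<Longrightarrow> unit_tensor F x \<in> carrier (gtensor R F K)"
  unfolding unit_tensor_def using residue_one by (auto simp: gtensor_def)

lemma unit_tensor_zero: "unit_tensor F \<zero>\<^bsub>F\<^esub> = \<zero>\<^bsub>gtensor R F K\<^esub>"
proof -
  have "frag_of (\<zero>\<^bsub>F\<^esub>, residue \<one>\<^bsub>R\<^esub>) \<in> t.T"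
    using t.relators(1)[OF F.M.zero_closed residue_one F.M.zero_closed] t.T_closed(3) by fastforce
  then show ?thesis unfolding unit_tensor_def gtensor_def using t.class_eq_iff by simp
qed

text \<open>One direction is the preceding injectivity, the other is \<open>X\<^sub>k w \<otimes> 1 = w \<otimes> X\<^sub>k = w \<otimes> 0\<close>.\<close>
lemma unit_tensor_eq_zero_iff: "x \<in> carrier F \<Longrightarrow> unit_tensor F x = \<zero>\<^bsub>gtensor R F K\<^esub> \<longleftrightarrow> x \<in> irrelevant_span F"
proof -
  assume x: "x \<in> carrier F"
  have iff: "unit_tensor F x = \<zero>\<^bsub>gtensor R F K\<^esub> \<longleftrightarrow> frag_of (x, residue \<one>\<^bsub>R\<^esub>) \<in> t.T" for x
    unfolding unit_tensor_def gtensor_def using t.class_eq_iff by simp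
  let ?Q = "{x \<in> carrier F. frag_of (x, residue \<one>\<^bsub>R\<^esub>) \<in> t.T}"
  have add: "x \<oplus>\<^bsub>F\<^esub> y \<in> ?Q" if "x \<in> ?Q" "y \<in> ?Q" for x y
  proof -
    have "(frag_of (x \<oplus>\<^bsub>F\<^esub> y, residue \<one>\<^bsub>R\<^esub>) - frag_of (x, residue \<one>\<^bsub>R\<^esub>) - frag_of (y, residue \<one>\<^bsub>R\<^esub>)) + (frag_of (x, residue \<one>\<^bsub>R\<^esub>) + frag_of (y, residue \<one>\<^bsub>R\<^esub>)) \<in> t.T"
      using that by (intro t.T_closed(2) t.relators(1) residue_one) auto
    then show ?thesis using that by (simp add: algebra_simps)
  qed
  have zero: "\<zero>\<^bsub>F\<^esub> \<in> ?Q" using unit_tensor_zero iff by simp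
  have mul: "signed F m (indet k \<odot>\<^bsub>F\<^esub> z) \<in> ?Q" if k: "k < n" and z: "z \<in> carrier F" for k z m
  proof -
    have in_Q: "indet k \<odot>\<^bsub>F\<^esub> z \<in> ?Q" if z: "z \<in> carrier F" for z
    proof -
      have xk: "indet k \<in> carrier R" "indet k \<in> \<mm>"
        using k indet_closed R.genideal_self[of "indet ` {..<n}"] unfolding irrelevant_ideal(2) by auto
      have "indet k \<odot>\<^bsub>K\<^esub> residue \<one>\<^bsub>R\<^esub> = residue \<zero>\<^bsub>R\<^esub>"
        using xk residue_eq_iff[of "indet k" "\<zero>\<^bsub>R\<^esub>"] by (simp add: base_smult a_minus_def)
      then have "frag_of (indet k \<odot>\<^bsub>F\<^esub> z, residue \<one>\<^bsub>R\<^esub>) - frag_of (z, residue \<zero>\<^bsub>R\<^esub>) \<in> t.T"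
        using t.relators(2)[OF z residue_one xk(1)] by simp
      moreover have "frag_of (z, residue \<zero>\<^bsub>R\<^esub>) \<in> t.T"
      proof -
        have c0: "residue \<zero>\<^bsub>R\<^esub> \<in> carrier K" "residue \<zero>\<^bsub>R\<^esub> \<oplus>\<^bsub>K\<^esub> residue \<zero>\<^bsub>R\<^esub> = residue \<zero>\<^bsub>R\<^esub>" by (simp_all add: base_sel(1) base_add)
        have "frag_of (z, residue \<zero>\<^bsub>R\<^esub> \<oplus>\<^bsub>K\<^esub> residue \<zero>\<^bsub>R\<^esub>) - frag_of (z, residue \<zero>\<^bsub>R\<^esub>) - frag_of (z, residue \<zero>\<^bsub>R\<^esub>) \<in> t.T"
          using z c0(1) by (intro t.relator_in_T) (unfold tensor_relators_def, blast)
        then show ?thesis using t.T_closed(3) c0(2) by fastforce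
      qed
      ultimately have "frag_of (indet k \<odot>\<^bsub>F\<^esub> z, residue \<one>\<^bsub>R\<^esub>) \<in> t.T" using t.T_closed(2) by fastforce
      then show ?thesis using z xk by simp
    qed
    have "signed F m (indet k \<odot>\<^bsub>F\<^esub> z) = indet k \<odot>\<^bsub>F\<^esub> signed F m z" using F.smult_signed k indet_closed z by simp
    then show ?thesis using in_Q z by simp
  qed
  have "koszul_d indet n F w {} \<in> ?Q" if w: "\<And>I. w I \<in> carrier F" for w
  proof -
    have "koszul_d indet n F w {} = (\<Oplus>\<^bsub>F\<^esub>k\<in>{..<n}. signed F (below k {}) (indet k \<odot>\<^bsub>F\<^esub> w {k}))"
      by (simp add: koszul_d_def)
    also have "\<dots> \<in> ?Q"
    proof (rule F.M.finsum_in_submonoid[OF _ _ _ zero add])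
      show "signed F (below k {}) (indet k \<odot>\<^bsub>F\<^esub> w {k}) \<in> ?Q" if "k \<in> {..<n}" for k
        using mul[OF _ w] that by simp
    qed auto
    finally show ?thesis .
  qed
  then have "frag_of (x, residue \<one>\<^bsub>R\<^esub>) \<in> t.T" if "x \<in> irrelevant_span F"
    using that unfolding irrelevant_span_def by blast
  then show ?thesis unfolding iff using tensor_one_in_relations_imp_span[OF x] by blast
qed

text \<open>Taking all of \<open>F\<close>, or a homogeneous part of it, for \<open>V\<close>, this reduces the description of the tensor
product and of its grading to pure tensors.\<close>
lemma subgroup_unit_tensor_representable:
  assumes V: "V \<subseteq> carrier F" "\<zero>\<^bsub>F\<^esub> \<in> V" "\<And>x y. x \<in> V \<Longrightarrow> y \<in> V \<Longrightarrow> x \<ominus>\<^bsub>F\<^esub> y \<in> V"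
  shows "subgroup {z \<in> carrier (tensor_free F K). \<exists>x\<in>V. tensor_class R F K z = unit_tensor F x} (tensor_free F K)"
    (is "subgroup ?Q _")
proof -
  have zero: "0 \<in> ?Q"
    using unit_tensor_zero V(2) by (auto simp: gtensor_def)
  have diff: "a - b \<in> ?Q" if "a \<in> ?Q" "b \<in> ?Q" for a b
  proof -
    obtain x y where xy: "x \<in> V" "y \<in> V" "a - frag_of (x, residue \<one>\<^bsub>R\<^esub>) \<in> t.T" "b - frag_of (y, residue \<one>\<^bsub>R\<^esub>) \<in> t.T"
      using \<open>a \<in> ?Q\<close> \<open>b \<in> ?Q\<close> unfolding unit_tensor_def t.class_eq_iff by blast
    have c: "x \<in> carrier F" "y \<in> carrier F" using xy V by auto
    have "unit_tensor F (x \<ominus>\<^bsub>F\<^esub> y) \<oplus>\<^bsub>gtensor R F K\<^esub> unit_tensor F y = unit_tensor F x"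
      using unit_tensor_add[of "x \<ominus>\<^bsub>F\<^esub> y" y] c by (simp add: a_minus_def F.M.a_assoc F.M.l_neg)
    then have "frag_of (x \<ominus>\<^bsub>F\<^esub> y, residue \<one>\<^bsub>R\<^esub>) + frag_of (y, residue \<one>\<^bsub>R\<^esub>) - frag_of (x, residue \<one>\<^bsub>R\<^esub>) \<in> t.T"
      unfolding unit_tensor_def t.class_add t.class_eq_iff .
    from t.T_closed(4)[OF t.T_closed(4)[OF xy(3,4)] this]
    have "(a - frag_of (x, residue \<one>\<^bsub>R\<^esub>)) - (b - frag_of (y, residue \<one>\<^bsub>R\<^esub>))
      - (frag_of (x \<ominus>\<^bsub>F\<^esub> y, residue \<one>\<^bsub>R\<^esub>) + frag_of (y, residue \<one>\<^bsub>R\<^esub>) - frag_of (x, residue \<one>\<^bsub>R\<^esub>)) \<in> t.T"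
      .
    then have "tensor_class R F K (a - b) = unit_tensor F (x \<ominus>\<^bsub>F\<^esub> y)"
      unfolding unit_tensor_def t.class_eq_iff by (simp add: algebra_simps)
    moreover have "a - b \<in> carrier (tensor_free F K)" using that keys_diff[of a b] by auto
    ultimately show ?thesis using V(3)[OF xy(1,2)] by blast
  qed
  show ?thesis
  proof (rule group.subgroupI[OF group_free_Abelian_group])
    show "?Q \<noteq> {}" using zero by blast
    show "?Q \<subseteq> carrier (tensor_free F K)" by auto
    have minus: "- a \<in> ?Q" if "a \<in> ?Q" for a using diff[OF zero that] by simp
    then show "inv\<^bsub>tensor_free F K\<^esub> a \<in> ?Q" if "a \<in> ?Q" for a using that by simp
    show "a \<otimes>\<^bsub>tensor_free F K\<^esub> b \<in> ?Q" if "a \<in> ?Q" "b \<in> ?Q" for a b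
      using diff[OF that(1) minus[OF that(2)]] by simp
  qed
qed

lemma class_frag_of:
  assumes "x \<in> carrier F" "r \<in> carrier R"
  shows "tensor_class R F K (frag_of (x, residue r)) = unit_tensor F (r \<odot>\<^bsub>F\<^esub> x)"
proof -
  have "r \<odot>\<^bsub>K\<^esub> residue \<one>\<^bsub>R\<^esub> = residue r" using assms by (simp add: base_smult)
  then have "frag_of (r \<odot>\<^bsub>F\<^esub> x, residue \<one>\<^bsub>R\<^esub>) - frag_of (x, residue r) \<in> t.T"
    using t.relators(2)[OF assms(1) residue_one assms(2)] by simp
  then show ?thesis unfolding unit_tensor_def t.class_eq_iff using t.T_closed(3) by fastforce
qed

lemma carrier_gtensor_unit_tensor: "carrier (gtensor R F K) = unit_tensor F ` carrier F"
proof -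
  have "\<exists>x\<in>carrier F. tensor_class R F K z = unit_tensor F x" if z: "z \<in> carrier (tensor_free F K)" for z
  proof -
    let ?Q = "{z \<in> carrier (tensor_free F K). \<exists>x\<in>carrier F. tensor_class R F K z = unit_tensor F x}"
    note sg = subgroup_unit_tensor_representable[OF subset_refl F.M.zero_closed F.M.minus_closed]
    have "Poly_Mapping.keys z \<subseteq> carrier F \<times> carrier K" using z by simp
    then have "z \<in> ?Q"
    proof (rule free_Abelian_group_induct[where P = "\<lambda>z. z \<in> ?Q"])
      show "0 \<in> ?Q" using subgroup.one_closed[OF sg] by simp
      show "a - b \<in> ?Q" if "Poly_Mapping.keys b \<subseteq> carrier F \<times> carrier K" "a \<in> ?Q" "b \<in> ?Q" for a b
      proof -
        have "a \<otimes>\<^bsub>tensor_free F K\<^esub> inv\<^bsub>tensor_free F K\<^esub> b \<in> ?Q"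
          using that by (intro subgroup.m_closed[OF sg] subgroup.m_inv_closed[OF sg])
        then show ?thesis using that(1) by simp
      qed
      show "frag_of p \<in> ?Q" if p: "p \<in> carrier F \<times> carrier K" for p
      proof -
        obtain x r where xr: "p = (x, residue r)" "x \<in> carrier F" "r \<in> carrier R" using p by (auto simp: base_sel(1))
        then have "tensor_class R F K (frag_of p) = unit_tensor F (r \<odot>\<^bsub>F\<^esub> x)" "r \<odot>\<^bsub>F\<^esub> x \<in> carrier F"
          using class_frag_of by simp_all
        then show ?thesis using p by auto
      qed
    qed
    then show ?thesis by blast
  qed
  then have "tensor_class R F K ` carrier (tensor_free F K) \<subseteq> unit_tensor F ` carrier F" by blast
  moreover have "carrier (gtensor R F K) = tensor_class R F K ` carrier (tensor_free F K)"
    by (simp add: gtensor_def)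
  moreover have "unit_tensor F ` carrier F \<subseteq> carrier (gtensor R F K)"
    using unit_tensor_in_carrier by auto
  ultimately show ?thesis by (intro equalityI) simp_all
qed

lemma grade_gtensor_unit_tensor:
  assumes "graded_koszul R F n indet \<gamma> \<pi>"
    and smult: "\<And>\<alpha> \<beta> r x. r \<in> homog R \<alpha> \<Longrightarrow> x \<in> grade F \<beta> \<Longrightarrow> r \<odot>\<^bsub>F\<^esub> x \<in> grade F (\<alpha> + \<beta>)"
  shows "grade (gtensor R F K) \<nu> = unit_tensor F ` grade F \<nu>"
proof -
  interpret g: graded_koszul R F n indet \<gamma> \<pi> by fact
  let ?gens = "{frag_of (x, y) | x y \<alpha> \<beta>. x \<in> grade F \<alpha> \<and> y \<in> grade K \<beta> \<and> \<alpha> + \<beta> = \<nu>}"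
  let ?Q = "{z \<in> carrier (tensor_free F K). \<exists>x\<in>grade F \<nu>. tensor_class R F K z = unit_tensor F x}"
  have gr: "grade (gtensor R F K) \<nu> = tensor_class R F K ` generate (tensor_free F K) ?gens"
    by (simp add: gtensor_def)
  have "grade F \<nu> \<subseteq> carrier F" using g.grade_carrier by blast
  then have sg: "subgroup ?Q (tensor_free F K)"
    by (intro subgroup_unit_tensor_representable g.grade_zero g.grade_diff)
  have "?gens \<subseteq> ?Q"
  proof
    fix z assume "z \<in> ?gens"
    then obtain x r \<alpha> \<beta> where z: "z = frag_of (x, residue r)" "x \<in> grade F \<alpha>" "r \<in> homog R \<beta>" "\<alpha> + \<beta> = \<nu>"
      by (auto simp: base_sel(2))
    have c: "x \<in> carrier F" "r \<in> carrier R" using z g.grade_carrier homog_iff by auto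
    have "r \<odot>\<^bsub>F\<^esub> x \<in> grade F \<nu>" using smult[OF z(3,2)] z(4) by (simp add: add.commute)
    then show "z \<in> ?Q" using class_frag_of[OF c] c z(1) by (auto simp: base_sel(1))
  qed
  then have "generate (tensor_free F K) ?gens \<subseteq> ?Q"
    by (rule group.generate_subgroup_incl[OF group_free_Abelian_group _ sg])
  then have "grade (gtensor R F K) \<nu> \<subseteq> unit_tensor F ` grade F \<nu>" unfolding gr by blast
  moreover have "unit_tensor F x \<in> grade (gtensor R F K) \<nu>" if "x \<in> grade F \<nu>" for x
  proof -
    have "frag_of (x, residue \<one>\<^bsub>R\<^esub>) \<in> ?gens"
      using that homog_one by (fastforce simp: base_sel(2))
    then show ?thesis unfolding gr unit_tensor_def by (intro imageI generate.incl)
  qed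
  ultimately show ?thesis by blast
qed

end

lemma tensor_map_unit_tensor:
  fixes F :: "(nat multiset \<Rightarrow> 's, 'f, 'g) gmodule" and F' :: "(nat multiset \<Rightarrow> 's, 'h, 'g) gmodule"
  assumes F: "module R F" and F': "module R F'" and h: "linear_map R F F' h" and x: "x \<in> carrier F"
  shows "tensor_map R F' K h (unit_tensor F x) = unit_tensor F' (h x)"
proof -
  interpret t: tensor R F K by (intro tensor.intro F module_base)
  interpret t': tensor R F' K by (intro tensor.intro F' module_base)
  let ?e = "frag_extend (\<lambda>(x, y). frag_of (h x, y))"
  have e: "?e (frag_of (x, y)) = frag_of (h x, y)" for x y by simp
  note hD = additive_mapD[OF linear_mapD(1)[OF h]]
  let ?Q = "{z \<in> carrier (tensor_free F K). ?e z \<in> t'.T}"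
  have sg: "subgroup ?Q (tensor_free F K)"
  proof (rule group.subgroupI[OF group_free_Abelian_group])
    show "?Q \<noteq> {}" using t'.T_closed(1) by (auto intro!: exI[of _ 0])
    show "a \<otimes>\<^bsub>tensor_free F K\<^esub> b \<in> ?Q" if "a \<in> ?Q" "b \<in> ?Q" for a b
      using that t'.T_closed(2) keys_add[of a b] by (auto simp: frag_extend_add)
    show "inv\<^bsub>tensor_free F K\<^esub> a \<in> ?Q" if "a \<in> ?Q" for a
      using that t'.T_closed(3) by (auto simp: frag_extend_minus)
  qed auto
  have "tensor_relators R F K \<subseteq> ?Q"
  proof
    fix a assume a: "a \<in> tensor_relators R F K"
    then have "?e a \<in> tensor_relators R F' K"
    proof (cases rule: t.relator_cases)
      case (1 x x' y)
      then have "?e a = frag_of (h x \<oplus>\<^bsub>F'\<^esub> h x', y) - frag_of (h x, y) - frag_of (h x', y)"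
        by (simp add: frag_extend_diff hD(2))
      then show ?thesis unfolding tensor_relators_def using hD(1)[OF 1(2)] hD(1)[OF 1(3)] 1(4) by blast
    next
      case (2 x y y')
      then have "?e a = frag_of (h x, y \<oplus>\<^bsub>K\<^esub> y') - frag_of (h x, y) - frag_of (h x, y')"
        by (simp add: frag_extend_diff)
      then show ?thesis unfolding tensor_relators_def using hD(1)[OF 2(2)] 2(3,4) by blast
    next
      case (3 r x y)
      then have "?e a = frag_of (r \<odot>\<^bsub>F'\<^esub> h x, y) - frag_of (h x, r \<odot>\<^bsub>K\<^esub> y)"
        by (simp add: frag_extend_diff linear_mapD(2)[OF h])
      then show ?thesis unfolding tensor_relators_def using hD(1)[OF 3(3)] 3(2,4) by blast
    qed
    then show "a \<in> ?Q" using t'.relator_in_T t.tensor_relators_carrier a by blast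
  qed
  then have T: "t.T \<subseteq> ?Q"
    by (rule group.generate_subgroup_incl[OF group_free_Abelian_group _ sg])
  have "tensor_map R F' K h (unit_tensor F x) = (\<Union>z\<in>unit_tensor F x. tensor_class R F' K (?e z))"
    by (simp add: tensor_map_def)
  also have "\<dots> = (\<Union>z\<in>unit_tensor F x. unit_tensor F' (h x))"
  proof (rule SUP_cong[OF refl])
    fix z assume "z \<in> unit_tensor F x"
    then have "z - frag_of (x, residue \<one>\<^bsub>R\<^esub>) \<in> t.T" unfolding unit_tensor_def t.in_class .
    then have "?e (z - frag_of (x, residue \<one>\<^bsub>R\<^esub>)) \<in> t'.T" using T by blast
    then show "tensor_class R F' K (?e z) = unit_tensor F' (h x)"
      unfolding unit_tensor_def t'.class_eq_iff by (simp add: frag_extend_diff)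
  qed
  also have "\<dots> = unit_tensor F' (h x)"
  proof -
    have "frag_of (x, residue \<one>\<^bsub>R\<^esub>) \<in> unit_tensor F x" unfolding unit_tensor_def t.in_class using t.T_closed(1) by simp
    then show ?thesis by auto
  qed
  finally show ?thesis .
qed

end

section \<open>Localization\<close>
lemma UN_const_on:
  assumes "p \<in> A" "\<And>q. q \<in> A \<Longrightarrow> G q = G p"
  shows "(\<Union>q\<in>A. G q) = G p"
proof -
  have "(\<Union>q\<in>A. G q) = (\<Union>q\<in>A. G p)" by (rule SUP_cong) (simp_all only: assms(2))
  then show ?thesis using assms(1) by auto
qed

locale localizable = module R M for R :: "('r, 'g::ab_group_add) gring" and M :: "('r, 'm, 'g) gmodule"
begin

lemma pow_smult:
  assumes "f \<in> carrier R" "x \<in> carrier M"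
  shows "(f [^]\<^bsub>R\<^esub> (a::nat)) \<odot>\<^bsub>M\<^esub> ((f [^]\<^bsub>R\<^esub> (b::nat)) \<odot>\<^bsub>M\<^esub> x) = (f [^]\<^bsub>R\<^esub> (a + b)) \<odot>\<^bsub>M\<^esub> x"
  using assms by (simp add: smult_assoc1[symmetric] R.nat_pow_mult)

lemma smult_commute:
  assumes "r \<in> carrier R" "s \<in> carrier R" "x \<in> carrier M"
  shows "r \<odot>\<^bsub>M\<^esub> (s \<odot>\<^bsub>M\<^esub> x) = s \<odot>\<^bsub>M\<^esub> (r \<odot>\<^bsub>M\<^esub> x)"
  using assms by (simp add: smult_assoc1[symmetric] R.m_comm)

lemma loc_frac_iff:
  assumes "f \<in> carrier R" "x \<in> carrier M"
  shows "(y, b) \<in> loc_frac R M f x a \<longleftrightarrow>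
    y \<in> carrier M \<and> (\<exists>t::nat. (f [^]\<^bsub>R\<^esub> (t + b)) \<odot>\<^bsub>M\<^esub> x = (f [^]\<^bsub>R\<^esub> (t + a)) \<odot>\<^bsub>M\<^esub> y)"
  using assms by (auto simp: loc_frac_def pow_smult)

lemma loc_frac_trans:
  assumes f: "f \<in> carrier R" and xyz: "x \<in> carrier M" "y \<in> carrier M" "z \<in> carrier M"
    and 1: "(f [^]\<^bsub>R\<^esub> ((t::nat) + b)) \<odot>\<^bsub>M\<^esub> x = (f [^]\<^bsub>R\<^esub> (t + a)) \<odot>\<^bsub>M\<^esub> y"
    and 2: "(f [^]\<^bsub>R\<^esub> ((s::nat) + c)) \<odot>\<^bsub>M\<^esub> y = (f [^]\<^bsub>R\<^esub> (s + b)) \<odot>\<^bsub>M\<^esub> z"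
  shows "\<exists>u::nat. (f [^]\<^bsub>R\<^esub> (u + c)) \<odot>\<^bsub>M\<^esub> x = (f [^]\<^bsub>R\<^esub> (u + a)) \<odot>\<^bsub>M\<^esub> z"
proof
  have "(f [^]\<^bsub>R\<^esub> (t + s + b + c)) \<odot>\<^bsub>M\<^esub> x = (f [^]\<^bsub>R\<^esub> (s + c)) \<odot>\<^bsub>M\<^esub> ((f [^]\<^bsub>R\<^esub> (t + b)) \<odot>\<^bsub>M\<^esub> x)"
    using f xyz by (simp add: pow_smult ac_simps)
  also have "\<dots> = (f [^]\<^bsub>R\<^esub> (t + a)) \<odot>\<^bsub>M\<^esub> ((f [^]\<^bsub>R\<^esub> (s + c)) \<odot>\<^bsub>M\<^esub> y)"
    unfolding 1 using f xyz by (simp add: pow_smult ac_simps)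
  also have "\<dots> = (f [^]\<^bsub>R\<^esub> (t + s + b + a)) \<odot>\<^bsub>M\<^esub> z"
    unfolding 2 using f xyz by (simp add: pow_smult ac_simps)
  finally show "(f [^]\<^bsub>R\<^esub> (t + s + b + c)) \<odot>\<^bsub>M\<^esub> x = (f [^]\<^bsub>R\<^esub> (t + s + b + a)) \<odot>\<^bsub>M\<^esub> z" .
qed

lemma loc_frac_self: "f \<in> carrier R \<Longrightarrow> x \<in> carrier M \<Longrightarrow> (x, a) \<in> loc_frac R M f x a"
  by (auto simp: loc_frac_iff)

lemma loc_frac_eq_iff:
  assumes f: "f \<in> carrier R" and x: "x \<in> carrier M" and y: "y \<in> carrier M"
  shows "loc_frac R M f x a = loc_frac R M f y b \<longleftrightarrow>
    (\<exists>t::nat. (f [^]\<^bsub>R\<^esub> (t + b)) \<odot>\<^bsub>M\<^esub> x = (f [^]\<^bsub>R\<^esub> (t + a)) \<odot>\<^bsub>M\<^esub> y)"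
proof
  assume "loc_frac R M f x a = loc_frac R M f y b"
  then have "(y, b) \<in> loc_frac R M f x a" using loc_frac_self[OF f y] by simp
  then show "\<exists>t::nat. (f [^]\<^bsub>R\<^esub> (t + b)) \<odot>\<^bsub>M\<^esub> x = (f [^]\<^bsub>R\<^esub> (t + a)) \<odot>\<^bsub>M\<^esub> y"
    using loc_frac_iff[OF f x] by blast
next
  assume "\<exists>t::nat. (f [^]\<^bsub>R\<^esub> (t + b)) \<odot>\<^bsub>M\<^esub> x = (f [^]\<^bsub>R\<^esub> (t + a)) \<odot>\<^bsub>M\<^esub> y"
  then obtain t :: nat where t: "(f [^]\<^bsub>R\<^esub> (t + b)) \<odot>\<^bsub>M\<^esub> x = (f [^]\<^bsub>R\<^esub> (t + a)) \<odot>\<^bsub>M\<^esub> y" by blast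
  have "(z, c) \<in> loc_frac R M f x a \<longleftrightarrow> (z, c) \<in> loc_frac R M f y b" for z c
    unfolding loc_frac_iff[OF f x] loc_frac_iff[OF f y]
    using loc_frac_trans[OF f x y _ t] loc_frac_trans[OF f y x _ t[symmetric]] by metis
  then show "loc_frac R M f x a = loc_frac R M f y b" by auto
qed

lemma loc_frac_expand:
  "f \<in> carrier R \<Longrightarrow> x \<in> carrier M \<Longrightarrow> loc_frac R M f x a = loc_frac R M f ((f [^]\<^bsub>R\<^esub> (k::nat)) \<odot>\<^bsub>M\<^esub> x) (a + k)"
  by (subst loc_frac_eq_iff) (auto simp: pow_smult intro!: exI[of _ 0])

text \<open>Operations on fractions are defined as unions over all representatives of a class. The union is the
value at any representative if that value does not depend on the choice.\<close>
lemma loc_frac_class_fun: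
  assumes f: "f \<in> carrier R" and x: "x \<in> carrier M"
    and "\<And>y b t. y \<in> carrier M \<Longrightarrow> (f [^]\<^bsub>R\<^esub> ((t::nat) + b)) \<odot>\<^bsub>M\<^esub> x = (f [^]\<^bsub>R\<^esub> (t + a)) \<odot>\<^bsub>M\<^esub> y \<Longrightarrow> G (y, b) = G (x, a)"
  shows "(\<Union>q\<in>loc_frac R M f x a. G q) = G (x, a)"
proof (rule UN_const_on[OF loc_frac_self[OF f x]])
  fix q assume q: "q \<in> loc_frac R M f x a"
  obtain y b where yb: "q = (y, b)" by fastforce
  obtain t :: nat where t: "y \<in> carrier M" "(f [^]\<^bsub>R\<^esub> (t + b)) \<odot>\<^bsub>M\<^esub> x = (f [^]\<^bsub>R\<^esub> (t + a)) \<odot>\<^bsub>M\<^esub> y"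
    using q unfolding yb loc_frac_iff[OF f x] by blast
  show "G q = G (x, a)" unfolding yb by (rule assms(3)[OF t])
qed

lemma gloc_sel:
  "carrier (gloc R M f) = {loc_frac R M f x a | x a. x \<in> carrier M}"
  "\<zero>\<^bsub>gloc R M f\<^esub> = loc_frac R M f \<zero>\<^bsub>M\<^esub> 0"
  "grade (gloc R M f) = (\<lambda>\<gamma>. {loc_frac R M f x a | x a \<delta>. f [^]\<^bsub>R\<^esub> a \<in> homog R \<delta> \<and> x \<in> grade M (\<gamma> + \<delta>)})"
  by (simp_all add: gloc_def)

lemma gloc_smult:
  assumes f: "f \<in> carrier R" and x: "x \<in> carrier M" and r: "r \<in> carrier R"
  shows "r \<odot>\<^bsub>gloc R M f\<^esub> loc_frac R M f x a = loc_frac R M f (r \<odot>\<^bsub>M\<^esub> x) a"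
proof -
  have "(\<Union>q\<in>loc_frac R M f x a. case q of (x, a) \<Rightarrow> loc_frac R M f (r \<odot>\<^bsub>M\<^esub> x) a)
    = (case (x, a) of (x, a) \<Rightarrow> loc_frac R M f (r \<odot>\<^bsub>M\<^esub> x) a)"
  proof (rule loc_frac_class_fun[OF f x])
    fix y b and t :: nat assume y: "y \<in> carrier M" "(f [^]\<^bsub>R\<^esub> (t + b)) \<odot>\<^bsub>M\<^esub> x = (f [^]\<^bsub>R\<^esub> (t + a)) \<odot>\<^bsub>M\<^esub> y"
    have "(f [^]\<^bsub>R\<^esub> (t + b)) \<odot>\<^bsub>M\<^esub> (r \<odot>\<^bsub>M\<^esub> x) = (f [^]\<^bsub>R\<^esub> (t + a)) \<odot>\<^bsub>M\<^esub> (r \<odot>\<^bsub>M\<^esub> y)"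
      using f x r y smult_commute[of "f [^]\<^bsub>R\<^esub> (t + b)" r x] smult_commute[of "f [^]\<^bsub>R\<^esub> (t + a)" r y] by simp
    then have "loc_frac R M f (r \<odot>\<^bsub>M\<^esub> x) a = loc_frac R M f (r \<odot>\<^bsub>M\<^esub> y) b"
      using f x r y by (subst loc_frac_eq_iff) auto
    then show "(case (y, b) of (x, a) \<Rightarrow> loc_frac R M f (r \<odot>\<^bsub>M\<^esub> x) a) = (case (x, a) of (x, a) \<Rightarrow> loc_frac R M f (r \<odot>\<^bsub>M\<^esub> x) a)"
      by simp
  qed
  then show ?thesis by (simp add: gloc_def)
qed

lemma gloc_add:
  assumes f: "f \<in> carrier R" and x: "x \<in> carrier M" and y: "y \<in> carrier M"
  shows "loc_frac R M f x a \<oplus>\<^bsub>gloc R M f\<^esub> loc_frac R M f y b =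
    loc_frac R M f ((f [^]\<^bsub>R\<^esub> b) \<odot>\<^bsub>M\<^esub> x \<oplus>\<^bsub>M\<^esub> (f [^]\<^bsub>R\<^esub> a) \<odot>\<^bsub>M\<^esub> y) (a + b)"
proof -
  let ?g = "\<lambda>x a y b. loc_frac R M f ((f [^]\<^bsub>R\<^esub> b) \<odot>\<^bsub>M\<^esub> x \<oplus>\<^bsub>M\<^esub> (f [^]\<^bsub>R\<^esub> a) \<odot>\<^bsub>M\<^esub> y) (a + b)"
  have sym: "?g x a y b = ?g y b x a" if "x \<in> carrier M" "y \<in> carrier M" for x a y b
    using that f by (simp add: M.a_comm add.commute)
  have step: "?g x a y' b' = ?g x a y b"
    if x: "x \<in> carrier M" and y: "y \<in> carrier M" and y': "y' \<in> carrier M" "(f [^]\<^bsub>R\<^esub> ((t::nat) + b')) \<odot>\<^bsub>M\<^esub> y = (f [^]\<^bsub>R\<^esub> (t + b)) \<odot>\<^bsub>M\<^esub> y'"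
    for x a y b y' b' t
  proof -
    have "(f [^]\<^bsub>R\<^esub> (t + (a + b))) \<odot>\<^bsub>M\<^esub> ((f [^]\<^bsub>R\<^esub> a) \<odot>\<^bsub>M\<^esub> y') = (f [^]\<^bsub>R\<^esub> (a + a)) \<odot>\<^bsub>M\<^esub> ((f [^]\<^bsub>R\<^esub> (t + b)) \<odot>\<^bsub>M\<^esub> y')"
      using f y' by (simp add: pow_smult ac_simps)
    also have "\<dots> = (f [^]\<^bsub>R\<^esub> (t + (a + b'))) \<odot>\<^bsub>M\<^esub> ((f [^]\<^bsub>R\<^esub> a) \<odot>\<^bsub>M\<^esub> y)"
      unfolding y'(2)[symmetric] using f y by (simp add: pow_smult ac_simps)
    finally have *: "(f [^]\<^bsub>R\<^esub> (t + (a + b))) \<odot>\<^bsub>M\<^esub> ((f [^]\<^bsub>R\<^esub> a) \<odot>\<^bsub>M\<^esub> y') = (f [^]\<^bsub>R\<^esub> (t + (a + b'))) \<odot>\<^bsub>M\<^esub> ((f [^]\<^bsub>R\<^esub> a) \<odot>\<^bsub>M\<^esub> y)" .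
    have **: "(f [^]\<^bsub>R\<^esub> (t + (a + b))) \<odot>\<^bsub>M\<^esub> ((f [^]\<^bsub>R\<^esub> b') \<odot>\<^bsub>M\<^esub> x) = (f [^]\<^bsub>R\<^esub> (t + (a + b'))) \<odot>\<^bsub>M\<^esub> ((f [^]\<^bsub>R\<^esub> b) \<odot>\<^bsub>M\<^esub> x)"
      using f x by (simp add: pow_smult ac_simps)
    show ?thesis
      using f x y y' by (subst loc_frac_eq_iff) (auto simp: smult_r_distr * ** intro!: exI[of _ t])
  qed
  have inner: "(\<Union>q\<in>loc_frac R M f y b. case q of (y, b) \<Rightarrow> ?g x' a' y b) = ?g x' a' y b" if "x' \<in> carrier M" for x' a'
    using loc_frac_class_fun[OF f y, of b "\<lambda>(y, b). ?g x' a' y b"] step[OF that y] by simp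
  have "loc_frac R M f x a \<oplus>\<^bsub>gloc R M f\<^esub> loc_frac R M f y b =
      (\<Union>q\<in>loc_frac R M f x a. case q of (x, a) \<Rightarrow> \<Union>q\<in>loc_frac R M f y b. case q of (y, b) \<Rightarrow> ?g x a y b)"
    by (simp add: gloc_def)
  also have "\<dots> = (\<Union>q\<in>loc_frac R M f x a. case q of (x, a) \<Rightarrow> ?g x a y b)"
  proof (rule SUP_cong[OF refl])
    fix q assume q: "q \<in> loc_frac R M f x a"
    obtain x' a' where q': "q = (x', a')" by fastforce
    then have "x' \<in> carrier M" using q by (simp add: loc_frac_iff[OF f x])
    then show "(case q of (x, a) \<Rightarrow> \<Union>q\<in>loc_frac R M f y b. case q of (y, b) \<Rightarrow> ?g x a y b) = (case q of (x, a) \<Rightarrow> ?g x a y b)"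
      unfolding q' prod.case by (rule inner)
  qed
  also have "\<dots> = ?g x a y b"
    using loc_frac_class_fun[OF f x, of a "\<lambda>(x, a). ?g x a y b"] step[OF y x] sym[OF _ y] sym[OF x y] by simp
  finally show ?thesis .
qed

lemma gloc_add_same:
  assumes f: "f \<in> carrier R" and x: "x \<in> carrier M" and y: "y \<in> carrier M"
  shows "loc_frac R M f x a \<oplus>\<^bsub>gloc R M f\<^esub> loc_frac R M f y a = loc_frac R M f (x \<oplus>\<^bsub>M\<^esub> y) a"
  unfolding gloc_add[OF assms] using loc_frac_expand[of f "x \<oplus>\<^bsub>M\<^esub> y" a a] assms by (simp add: smult_r_distr)

lemma loc_frac_zero: "f \<in> carrier R \<Longrightarrow> loc_frac R M f \<zero>\<^bsub>M\<^esub> a = loc_frac R M f \<zero>\<^bsub>M\<^esub> b"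
  by (subst loc_frac_eq_iff) auto

text \<open>Over a common denominator the module laws for fractions are those for numerators.\<close>
lemma gloc_common_denominator:
  assumes f: "f \<in> carrier R" and UV: "U \<in> carrier (gloc R M f)" "V \<in> carrier (gloc R M f)"
  obtains x y a where "x \<in> carrier M" "y \<in> carrier M" "U = loc_frac R M f x a" "V = loc_frac R M f y a"
proof -
  obtain x a y b where "x \<in> carrier M" "U = loc_frac R M f x a" "y \<in> carrier M" "V = loc_frac R M f y b"
    using UV by (auto simp: gloc_sel)
  then show thesis
    using that[of "(f [^]\<^bsub>R\<^esub> b) \<odot>\<^bsub>M\<^esub> x" "(f [^]\<^bsub>R\<^esub> a) \<odot>\<^bsub>M\<^esub> y" "a + b"] f
      loc_frac_expand[of f x a b] loc_frac_expand[of f y b a] by (simp add: add.commute)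
qed

lemma abelian_group_gloc:
  assumes f: "f \<in> carrier R"
  shows "abelian_group (gloc R M f)"
proof (rule abelian_groupI)
  fix U V assume U: "U \<in> carrier (gloc R M f)" and V: "V \<in> carrier (gloc R M f)"
  obtain x y a where xy: "x \<in> carrier M" "y \<in> carrier M" "U = loc_frac R M f x a" "V = loc_frac R M f y a"
    using gloc_common_denominator[OF f U V] .
  show "U \<oplus>\<^bsub>gloc R M f\<^esub> V \<in> carrier (gloc R M f)"
    using xy gloc_add_same[OF f] by (auto simp: gloc_sel)
  show "U \<oplus>\<^bsub>gloc R M f\<^esub> V = V \<oplus>\<^bsub>gloc R M f\<^esub> U"
    using xy gloc_add_same[OF f] by (simp add: M.a_comm)
  fix W assume W: "W \<in> carrier (gloc R M f)"
  then obtain z b where z: "z \<in> carrier M" "W = loc_frac R M f z b" by (auto simp: gloc_sel)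
  have UVW: "U = loc_frac R M f ((f [^]\<^bsub>R\<^esub> b) \<odot>\<^bsub>M\<^esub> x) (a + b)" "V = loc_frac R M f ((f [^]\<^bsub>R\<^esub> b) \<odot>\<^bsub>M\<^esub> y) (a + b)"
    "W = loc_frac R M f ((f [^]\<^bsub>R\<^esub> a) \<odot>\<^bsub>M\<^esub> z) (a + b)"
    using loc_frac_expand[OF f xy(1), of a b] loc_frac_expand[OF f xy(2), of a b] loc_frac_expand[OF f z(1), of b a]
      xy z by (simp_all add: add.commute)
  show "U \<oplus>\<^bsub>gloc R M f\<^esub> V \<oplus>\<^bsub>gloc R M f\<^esub> W = U \<oplus>\<^bsub>gloc R M f\<^esub> (V \<oplus>\<^bsub>gloc R M f\<^esub> W)"
    unfolding UVW using f xy z by (simp add: gloc_add_same M.a_assoc)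
next
  show "\<zero>\<^bsub>gloc R M f\<^esub> \<in> carrier (gloc R M f)" by (auto simp: gloc_sel)
next
  fix U assume "U \<in> carrier (gloc R M f)"
  then obtain x a where x: "x \<in> carrier M" "U = loc_frac R M f x a" by (auto simp: gloc_sel)
  show "\<zero>\<^bsub>gloc R M f\<^esub> \<oplus>\<^bsub>gloc R M f\<^esub> U = U"
    unfolding gloc_sel loc_frac_zero[OF f, of 0 a] x(2) using f x by (simp add: gloc_add_same)
  show "\<exists>V\<in>carrier (gloc R M f). V \<oplus>\<^bsub>gloc R M f\<^esub> U = \<zero>\<^bsub>gloc R M f\<^esub>"
  proof
    show "loc_frac R M f (\<ominus>\<^bsub>M\<^esub> x) a \<oplus>\<^bsub>gloc R M f\<^esub> U = \<zero>\<^bsub>gloc R M f\<^esub>"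
      unfolding gloc_sel loc_frac_zero[OF f, of 0 a] x(2) using f x by (simp add: gloc_add_same M.l_neg)
  qed (use x in \<open>auto simp: gloc_sel\<close>)
qed

lemma module_gloc:
  assumes f: "f \<in> carrier R"
  shows "module R (gloc R M f)"
proof (rule moduleI)
  fix r s U V assume r: "r \<in> carrier R" and s: "s \<in> carrier R" and U: "U \<in> carrier (gloc R M f)" and V: "V \<in> carrier (gloc R M f)"
  obtain x y a where xy: "x \<in> carrier M" "y \<in> carrier M" "U = loc_frac R M f x a" "V = loc_frac R M f y a"
    using gloc_common_denominator[OF f U V] .
  show "r \<odot>\<^bsub>gloc R M f\<^esub> (U \<oplus>\<^bsub>gloc R M f\<^esub> V) = r \<odot>\<^bsub>gloc R M f\<^esub> U \<oplus>\<^bsub>gloc R M f\<^esub> r \<odot>\<^bsub>gloc R M f\<^esub> V"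
    using xy f r by (simp add: gloc_add_same gloc_smult smult_r_distr)
next
  fix U assume U: "U \<in> carrier (gloc R M f)"
  obtain x a where x: "x \<in> carrier M" "U = loc_frac R M f x a" using U by (auto simp: gloc_sel)
  show "\<one>\<^bsub>R\<^esub> \<odot>\<^bsub>gloc R M f\<^esub> U = U" using x f by (simp add: gloc_smult)
  fix r assume r: "r \<in> carrier R"
  show "r \<odot>\<^bsub>gloc R M f\<^esub> U \<in> carrier (gloc R M f)"
    using x f r by (auto simp: gloc_smult gloc_sel)
  fix s assume s: "s \<in> carrier R"
  show "(r \<oplus>\<^bsub>R\<^esub> s) \<odot>\<^bsub>gloc R M f\<^esub> U = r \<odot>\<^bsub>gloc R M f\<^esub> U \<oplus>\<^bsub>gloc R M f\<^esub> s \<odot>\<^bsub>gloc R M f\<^esub> U"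
    using x f r s by (simp add: gloc_add_same gloc_smult smult_l_distr)
  show "(r \<otimes>\<^bsub>R\<^esub> s) \<odot>\<^bsub>gloc R M f\<^esub> U = r \<odot>\<^bsub>gloc R M f\<^esub> (s \<odot>\<^bsub>gloc R M f\<^esub> U)"
    using x f r s by (simp add: gloc_smult smult_assoc1)
qed (use f R.cring_axioms abelian_group_gloc in \<open>auto simp: gloc_sel gloc_smult\<close>)

lemma gloc_smult_bij:
  assumes f: "f \<in> carrier R"
  shows "V \<in> carrier (gloc R M f) \<Longrightarrow> \<exists>U\<in>carrier (gloc R M f). f \<odot>\<^bsub>gloc R M f\<^esub> U = V"
    and "U \<in> carrier (gloc R M f) \<Longrightarrow> f \<odot>\<^bsub>gloc R M f\<^esub> U = \<zero>\<^bsub>gloc R M f\<^esub> \<Longrightarrow> U = \<zero>\<^bsub>gloc R M f\<^esub>"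
proof -
  assume "V \<in> carrier (gloc R M f)"
  then obtain x a where x: "x \<in> carrier M" "V = loc_frac R M f x a" by (auto simp: gloc_sel)
  have "f \<odot>\<^bsub>gloc R M f\<^esub> loc_frac R M f x (a + 1) = V"
    using x f loc_frac_expand[of f x a 1] by (simp add: gloc_smult)
  moreover have "loc_frac R M f x (a + 1) \<in> carrier (gloc R M f)" using x by (auto simp: gloc_sel)
  ultimately show "\<exists>U\<in>carrier (gloc R M f). f \<odot>\<^bsub>gloc R M f\<^esub> U = V" by blast
next
  assume "U \<in> carrier (gloc R M f)" and z: "f \<odot>\<^bsub>gloc R M f\<^esub> U = \<zero>\<^bsub>gloc R M f\<^esub>"
  then obtain x a where x: "x \<in> carrier M" "U = loc_frac R M f x a" by (auto simp: gloc_sel)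
  have "loc_frac R M f (f \<odot>\<^bsub>M\<^esub> x) a = loc_frac R M f \<zero>\<^bsub>M\<^esub> a"
    using z f x loc_frac_zero[OF f, of 0 a] by (simp add: gloc_smult gloc_sel)
  then obtain t :: nat where t: "(f [^]\<^bsub>R\<^esub> (t + a)) \<odot>\<^bsub>M\<^esub> (f \<odot>\<^bsub>M\<^esub> x) = \<zero>\<^bsub>M\<^esub>"
    using f x by (subst (asm) loc_frac_eq_iff) auto
  have "(f [^]\<^bsub>R\<^esub> (Suc (t + a))) \<odot>\<^bsub>M\<^esub> x = \<zero>\<^bsub>M\<^esub>"
    using t f x by (simp add: smult_assoc1)
  then have "loc_frac R M f x a = loc_frac R M f \<zero>\<^bsub>M\<^esub> a"
    using f x by (subst loc_frac_eq_iff) (auto intro!: exI[of _ "Suc t"])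
  then show "U = \<zero>\<^bsub>gloc R M f\<^esub>" using x loc_frac_zero[OF f, of 0 a] by (simp add: gloc_sel)
qed

lemma loc_map_frac:
  assumes f: "f \<in> carrier R" and g: "g \<in> carrier R" and x: "x \<in> carrier M"
  shows "loc_map R M f g (loc_frac R M f x a) = loc_frac R M (f \<otimes>\<^bsub>R\<^esub> g) ((g [^]\<^bsub>R\<^esub> a) \<odot>\<^bsub>M\<^esub> x) a"
proof -
  let ?G = "\<lambda>(x, a). loc_frac R M (f \<otimes>\<^bsub>R\<^esub> g) ((g [^]\<^bsub>R\<^esub> a) \<odot>\<^bsub>M\<^esub> x) a"
  have "(\<Union>q\<in>loc_frac R M f x a. ?G q) = ?G (x, a)"
  proof (rule loc_frac_class_fun[OF f x])
    fix y b and t :: nat assume y: "y \<in> carrier M" "(f [^]\<^bsub>R\<^esub> (t + b)) \<odot>\<^bsub>M\<^esub> x = (f [^]\<^bsub>R\<^esub> (t + a)) \<odot>\<^bsub>M\<^esub> y"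
    have fg: "((f \<otimes>\<^bsub>R\<^esub> g) [^]\<^bsub>R\<^esub> (t + c)) \<odot>\<^bsub>M\<^esub> ((g [^]\<^bsub>R\<^esub> c') \<odot>\<^bsub>M\<^esub> z)
        = (g [^]\<^bsub>R\<^esub> (t + (c + c'))) \<odot>\<^bsub>M\<^esub> ((f [^]\<^bsub>R\<^esub> (t + c)) \<odot>\<^bsub>M\<^esub> z)" if "z \<in> carrier M" for c c' :: nat and z
    proof -
      have "((f \<otimes>\<^bsub>R\<^esub> g) [^]\<^bsub>R\<^esub> (t + c)) \<odot>\<^bsub>M\<^esub> ((g [^]\<^bsub>R\<^esub> c') \<odot>\<^bsub>M\<^esub> z)
          = (f [^]\<^bsub>R\<^esub> (t + c)) \<odot>\<^bsub>M\<^esub> ((g [^]\<^bsub>R\<^esub> (t + c)) \<odot>\<^bsub>M\<^esub> ((g [^]\<^bsub>R\<^esub> c') \<odot>\<^bsub>M\<^esub> z))"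
        using f g that by (simp add: R.nat_pow_distrib smult_assoc1)
      also have "\<dots> = (g [^]\<^bsub>R\<^esub> (t + (c + c'))) \<odot>\<^bsub>M\<^esub> ((f [^]\<^bsub>R\<^esub> (t + c)) \<odot>\<^bsub>M\<^esub> z)"
        unfolding pow_smult[OF g that] add.assoc using f g that by (intro smult_commute) auto
      finally show ?thesis .
    qed
    have "((f \<otimes>\<^bsub>R\<^esub> g) [^]\<^bsub>R\<^esub> (t + b)) \<odot>\<^bsub>M\<^esub> ((g [^]\<^bsub>R\<^esub> a) \<odot>\<^bsub>M\<^esub> x) = ((f \<otimes>\<^bsub>R\<^esub> g) [^]\<^bsub>R\<^esub> (t + a)) \<odot>\<^bsub>M\<^esub> ((g [^]\<^bsub>R\<^esub> b) \<odot>\<^bsub>M\<^esub> y)"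
      unfolding fg[OF x] fg[OF y(1)] y(2) by (simp add: add.commute[of a b])
    then show "?G (y, b) = ?G (x, a)"
      using f g x y(1) by (simp, subst loc_frac_eq_iff) (auto intro: exI[of _ t] simp: eq_commute)
  qed
  then show ?thesis by (simp add: loc_map_def)
qed

lemma linear_map_loc_map:
  assumes f: "f \<in> carrier R" and g: "g \<in> carrier R"
  shows "linear_map R (gloc R M f) (gloc R M (f \<otimes>\<^bsub>R\<^esub> g)) (loc_map R M f g)"
  unfolding linear_map_def additive_map_def
proof (intro conjI ballI funcsetI)
  fix U assume U: "U \<in> carrier (gloc R M f)"
  obtain x a where x: "x \<in> carrier M" "U = loc_frac R M f x a" using U by (auto simp: gloc_sel)
  show "loc_map R M f g U \<in> carrier (gloc R M (f \<otimes>\<^bsub>R\<^esub> g))"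
    using x f g by (auto simp: loc_map_frac gloc_sel)
  show "loc_map R M f g (r \<odot>\<^bsub>gloc R M f\<^esub> U) = r \<odot>\<^bsub>gloc R M (f \<otimes>\<^bsub>R\<^esub> g)\<^esub> loc_map R M f g U" if r: "r \<in> carrier R" for r
    using x f g r smult_commute[of "g [^]\<^bsub>R\<^esub> a" r x] by (simp add: loc_map_frac gloc_smult)
  fix V assume V: "V \<in> carrier (gloc R M f)"
  obtain x y a where xy: "x \<in> carrier M" "y \<in> carrier M" "U = loc_frac R M f x a" "V = loc_frac R M f y a"
    using gloc_common_denominator[OF f U V] .
  show "loc_map R M f g (U \<oplus>\<^bsub>gloc R M f\<^esub> V) = loc_map R M f g U \<oplus>\<^bsub>gloc R M (f \<otimes>\<^bsub>R\<^esub> g)\<^esub> loc_map R M f g V"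
    using xy f g by (simp add: loc_map_frac gloc_add_same smult_r_distr)
qed

lemma loc_map_loc_map_commute:
  assumes f: "f \<in> carrier R" and g: "g \<in> carrier R" and h: "h \<in> carrier R" and U: "U \<in> carrier (gloc R M f)"
  shows "loc_map R M (f \<otimes>\<^bsub>R\<^esub> g) h (loc_map R M f g U) = loc_map R M (f \<otimes>\<^bsub>R\<^esub> h) g (loc_map R M f h U)"
proof -
  obtain x a where x: "x \<in> carrier M" "U = loc_frac R M f x a" using U by (auto simp: gloc_sel)
  have "f \<otimes>\<^bsub>R\<^esub> g \<otimes>\<^bsub>R\<^esub> h = f \<otimes>\<^bsub>R\<^esub> h \<otimes>\<^bsub>R\<^esub> g" using f g h by (simp add: R.m_ac)
  then show ?thesis using x f g h smult_commute[of "g [^]\<^bsub>R\<^esub> a" "h [^]\<^bsub>R\<^esub> a" x] by (simp add: loc_map_frac)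
qed

end

section \<open>Finite products of modules\<close>
lemma gprod_sel:
  "carrier (gprod A N) = (\<Pi>\<^sub>E i\<in>A. carrier (N i))"
  "\<zero>\<^bsub>gprod A N\<^esub> = (\<lambda>i\<in>A. \<zero>\<^bsub>N i\<^esub>)"
  "x \<oplus>\<^bsub>gprod A N\<^esub> y = (\<lambda>i\<in>A. x i \<oplus>\<^bsub>N i\<^esub> y i)"
  "r \<odot>\<^bsub>gprod A N\<^esub> x = (\<lambda>i\<in>A. r \<odot>\<^bsub>N i\<^esub> x i)"
  "grade (gprod A N) \<nu> = (\<Pi>\<^sub>E i\<in>A. grade (N i) \<nu>)"
  by (simp_all add: gprod_def)

lemma gprod_eqI:
  assumes "x \<in> carrier (gprod A N)" "y \<in> carrier (gprod A N)" "\<And>i. i \<in> A \<Longrightarrow> x i = y i"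
  shows "x = y"
  using assms by (auto simp: gprod_sel intro: PiE_ext)

lemma module_gprod:
  fixes N :: "'i \<Rightarrow> ('r, 'm, 'g) gmodule"
  assumes R: "cring R" and N: "\<And>i. i \<in> A \<Longrightarrow> module R (N i)"
  shows "module R (gprod A N)"
proof -
  have ag: "abelian_group (N i)" if "i \<in> A" for i using N[OF that] by (simp add: module_def)
  note cl = abelian_monoid.a_closed[OF abelian_group.axioms(1)[OF ag]]
    abelian_monoid.zero_closed[OF abelian_group.axioms(1)[OF ag]] module.smult_closed[OF N]
  have "abelian_group (gprod A N)"
  proof (rule abelian_groupI)
    fix x assume x: "x \<in> carrier (gprod A N)"
    let ?y = "\<lambda>i\<in>A. \<ominus>\<^bsub>N i\<^esub> x i"
    have "?y \<oplus>\<^bsub>gprod A N\<^esub> x = \<zero>\<^bsub>gprod A N\<^esub>"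
      using x by (auto simp: gprod_sel restrict_def fun_eq_iff PiE_iff intro!: abelian_group.l_neg[OF ag])
    moreover have "?y \<in> carrier (gprod A N)"
      using x by (auto simp: gprod_sel PiE_iff intro!: abelian_group.a_inv_closed[OF ag])
    ultimately show "\<exists>y\<in>carrier (gprod A N). y \<oplus>\<^bsub>gprod A N\<^esub> x = \<zero>\<^bsub>gprod A N\<^esub>" by blast
    show "\<zero>\<^bsub>gprod A N\<^esub> \<oplus>\<^bsub>gprod A N\<^esub> x = x"
      using x by (intro gprod_eqI[of _ A N])
        (auto simp: gprod_sel PiE_iff cl intro!: abelian_monoid.l_zero[OF abelian_group.axioms(1)[OF ag]])
  qed (auto simp: gprod_sel PiE_iff restrict_def fun_eq_iff extensional_def cl
      intro!: abelian_monoid.a_assoc[OF abelian_group.axioms(1)[OF ag]] abelian_monoid.a_comm[OF abelian_group.axioms(1)[OF ag]])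
  then show ?thesis
  proof (rule moduleI[OF R])
    fix x assume x: "x \<in> carrier (gprod A N)"
    show "\<one>\<^bsub>R\<^esub> \<odot>\<^bsub>gprod A N\<^esub> x = x"
      using x cring.cring_simprules(6)[OF R] by (intro gprod_eqI[of _ A N]) (auto simp: gprod_sel PiE_iff cl module.smult_one[OF N])
  qed (auto simp: gprod_sel PiE_iff restrict_def fun_eq_iff extensional_def cl module.smult_l_distr[OF N] module.smult_r_distr[OF N] module.smult_assoc1[OF N])
qed

lemma linear_map_gprod_eval:
  assumes "i \<in> A"
  shows "linear_map R (gprod A N) (N i) (\<lambda>x. x i)"
  using assms by (auto simp: linear_map_def additive_map_def gprod_sel)

lemma graded_koszul_gprod:
  fixes N :: "'i \<Rightarrow> ('r, 'm, 'g::ab_group_add) gmodule"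
  assumes R: "cring R" and x: "\<And>k. k < n \<Longrightarrow> x k \<in> carrier R"
    and N: "\<And>i. i \<in> A \<Longrightarrow> graded_koszul R (N i) n x \<gamma> (\<pi> i)"
  shows "graded_koszul R (gprod A N) n x \<gamma> (\<lambda>\<nu> y. \<lambda>i\<in>A. \<pi> i \<nu> (y i))"
proof (intro graded_koszul.intro koszul.intro koszul_axioms.intro graded_koszul_axioms.intro x)
  have mN: "module R (N i)" if "i \<in> A" for i
    using N[OF that] by (simp add: graded_koszul_def koszul_def)
  show "module R (gprod A N)" by (rule module_gprod[OF R mN])
  fix \<nu>
  show "additive_map (gprod A N) (gprod A N) (\<lambda>y. \<lambda>i\<in>A. \<pi> i \<nu> (y i))"
    using graded_koszul.\<pi>_closed[OF N] additive_mapD(2)[OF graded_koszul.\<pi>_additive[OF N]]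
    by (auto simp: additive_map_def gprod_sel PiE_iff restrict_def fun_eq_iff)
  show "(\<lambda>i\<in>A. \<pi> i \<nu> (y i)) \<in> grade (gprod A N) \<nu>" if "y \<in> carrier (gprod A N)" for y
    using that graded_koszul.\<pi>_grade[OF N] by (auto simp: gprod_sel PiE_iff)
  show y: "y \<in> carrier (gprod A N)" if "y \<in> grade (gprod A N) \<nu>" for y
    using that graded_koszul.grade_carrier[OF N] by (auto simp: gprod_sel PiE_iff)
  show "(\<lambda>i\<in>A. \<pi> i \<nu> (y i)) = y" if "y \<in> grade (gprod A N) \<nu>" for y
    using that graded_koszul.\<pi>_id[OF N]
    by (auto simp: gprod_sel PiE_iff restrict_def fun_eq_iff extensional_def)
  show "x k \<odot>\<^bsub>gprod A N\<^esub> (\<lambda>i\<in>A. \<pi> i \<nu> (y i)) = (\<lambda>i\<in>A. \<pi> i (\<gamma> k + \<nu>) ((x k \<odot>\<^bsub>gprod A N\<^esub> y) i))"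
    if "k < n" "y \<in> carrier (gprod A N)" for k y
    using that graded_koszul.\<pi>_shift[OF N] by (auto simp: gprod_sel PiE_iff restrict_def fun_eq_iff)
qed


section \<open>Homogeneous components of fractions\<close>
definition nat_multiple :: "nat \<Rightarrow> 'g::ab_group_add \<Rightarrow> 'g" where
  "nat_multiple a \<delta> = (\<Sum>i<a. \<delta>)"

lemma nat_multiple_simps [simp]: "nat_multiple 0 \<delta> = 0" "nat_multiple (Suc a) \<delta> = \<delta> + nat_multiple a \<delta>"
  by (simp_all add: nat_multiple_def)

lemma nat_multiple_add: "nat_multiple (a + b) \<delta> = nat_multiple a \<delta> + nat_multiple b \<delta>"
  by (induction a) (simp_all add: add.assoc)

lemma nat_multiple_plus: "nat_multiple a (\<delta> + \<epsilon>) = nat_multiple a \<delta> + nat_multiple a \<epsilon>"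
  by (simp add: nat_multiple_def sum.distrib)

text \<open>The component of degree \<open>\<nu>\<close> of a fraction \<open>x / f\<^sup>a\<close>, where \<open>f\<close> has degree \<open>\<delta>\<close> and hence the numerator
must be taken in degree \<open>\<nu> + a \<delta>\<close>.\<close>
definition loc_comp ::
    "('r, 'g::ab_group_add) gring \<Rightarrow> ('r, 'm, 'g) gmodule \<Rightarrow> 'r \<Rightarrow> 'g \<Rightarrow> 'g \<Rightarrow> ('m \<times> nat) set \<Rightarrow> ('m \<times> nat) set" where
  "loc_comp R M f \<delta> \<nu> U = (\<Union>(x, a)\<in>U. loc_frac R M f (gcomp M (\<nu> + nat_multiple a \<delta>) x) a)"

context graded_poly
begin

lemma homog_pow: "f \<in> homog R \<delta> \<Longrightarrow> f [^]\<^bsub>R\<^esub> (a::nat) \<in> homog R (nat_multiple a \<delta>)"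
proof (induction a)
  case (Suc a)
  then have "f [^]\<^bsub>R\<^esub> a \<otimes>\<^bsub>R\<^esub> f \<in> homog R (nat_multiple a \<delta> + \<delta>)" by (intro homog_mult) auto
  then show ?case by (simp add: add.commute)
qed (simp add: homog_one)

lemma homog_closed: "f \<in> homog R \<delta> \<Longrightarrow> f \<in> carrier R"
  by (simp add: homog_iff)

context
  fixes M :: "(nat multiset \<Rightarrow> 's, 'm, 'g) gmodule"
  assumes M: "graded_module R M"
begin

interpretation M: localizable R M
  by (intro localizable.intro graded_moduleD(1)[OF M])

interpretation gM: graded_koszul R M n indet \<gamma> "gcomp M"
  by (rule graded_koszul_gcomp[OF M indet_closed indet_homog])

lemma loc_comp_frac:
  assumes f: "f \<in> homog R \<delta>" and x: "x \<in> carrier M"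
  shows "loc_comp R M f \<delta> \<nu> (loc_frac R M f x a) = loc_frac R M f (gcomp M (\<nu> + nat_multiple a \<delta>) x) a"
proof -
  let ?G = "\<lambda>(x, a). loc_frac R M f (gcomp M (\<nu> + nat_multiple a \<delta>) x) a"
  note fc = homog_closed[OF f]
  have "(\<Union>q\<in>loc_frac R M f x a. ?G q) = ?G (x, a)"
  proof (rule M.loc_frac_class_fun[OF fc x])
    fix y b and t :: nat assume y: "y \<in> carrier M" and eq: "(f [^]\<^bsub>R\<^esub> (t + b)) \<odot>\<^bsub>M\<^esub> x = (f [^]\<^bsub>R\<^esub> (t + a)) \<odot>\<^bsub>M\<^esub> y"
    have pow: "(f [^]\<^bsub>R\<^esub> (t + c)) \<odot>\<^bsub>M\<^esub> gcomp M \<alpha> z = gcomp M (nat_multiple (t + c) \<delta> + \<alpha>) ((f [^]\<^bsub>R\<^esub> (t + c)) \<odot>\<^bsub>M\<^esub> z)"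
      if "z \<in> carrier M" for c \<alpha> z
      using gcomp_smult[OF M homog_pow[OF f] _ that] fc by simp
    have deg: "nat_multiple (t + b) \<delta> + (\<nu> + nat_multiple a \<delta>) = nat_multiple (t + a) \<delta> + (\<nu> + nat_multiple b \<delta>)"
      by (simp add: nat_multiple_add algebra_simps)
    have "(f [^]\<^bsub>R\<^esub> (t + b)) \<odot>\<^bsub>M\<^esub> gcomp M (\<nu> + nat_multiple a \<delta>) x = (f [^]\<^bsub>R\<^esub> (t + a)) \<odot>\<^bsub>M\<^esub> gcomp M (\<nu> + nat_multiple b \<delta>) y"
      unfolding pow[OF x] pow[OF y] eq deg ..
    then show "?G (y, b) = ?G (x, a)"
      using M.loc_frac_eq_iff[OF fc gM.\<pi>_closed[OF x] gM.\<pi>_closed[OF y]] by (simp add: eq_commute) blast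
  qed
  then show ?thesis by (simp add: loc_comp_def)
qed

text \<open>The grading of the localization admits every degree in which the denominator is homogeneous. This agrees
with the degree computed from \<open>\<delta>\<close> if the denominator is not zero; otherwise there is only one
fraction.\<close>
lemma graded_koszul_gloc:
  assumes f: "f \<in> homog R \<delta>"
  shows "graded_koszul R (gloc R M f) n indet \<gamma> (loc_comp R M f \<delta>)"
proof (intro graded_koszul.intro koszul.intro koszul_axioms.intro graded_koszul_axioms.intro indet_closed)
  note fc = homog_closed[OF f]
  show "module R (gloc R M f)" by (rule M.module_gloc[OF fc])
  fix \<nu>
  have frac: "\<exists>x a. x \<in> carrier M \<and> U = loc_frac R M f x a" if "U \<in> carrier (gloc R M f)" for U
    using that by (auto simp: M.gloc_sel)
  show gr: "loc_comp R M f \<delta> \<nu> U \<in> grade (gloc R M f) \<nu>" if U: "U \<in> carrier (gloc R M f)" for U \<nu>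
  proof -
    obtain x a where x: "x \<in> carrier M" "U = loc_frac R M f x a" using frac[OF U] by blast
    show ?thesis using x homog_pow[OF f, of a] gM.\<pi>_grade[OF x(1)] by (auto simp: M.gloc_sel loc_comp_frac[OF f])
  qed
  show cl: "U \<in> carrier (gloc R M f)" if "U \<in> grade (gloc R M f) \<nu>" for U \<nu>
    using that gM.grade_carrier by (auto simp: M.gloc_sel)
  show "additive_map (gloc R M f) (gloc R M f) (loc_comp R M f \<delta> \<nu>)"
    unfolding additive_map_def
  proof (intro conjI funcsetI ballI)
    fix U assume U: "U \<in> carrier (gloc R M f)"
    show "loc_comp R M f \<delta> \<nu> U \<in> carrier (gloc R M f)" using cl[OF gr[OF U]] .
    fix V assume V: "V \<in> carrier (gloc R M f)"
    obtain x y a where xy: "x \<in> carrier M" "y \<in> carrier M" "U = loc_frac R M f x a" "V = loc_frac R M f y a"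
      using M.gloc_common_denominator[OF fc U V] .
    show "loc_comp R M f \<delta> \<nu> (U \<oplus>\<^bsub>gloc R M f\<^esub> V) = loc_comp R M f \<delta> \<nu> U \<oplus>\<^bsub>gloc R M f\<^esub> loc_comp R M f \<delta> \<nu> V"
      using xy by (simp add: M.gloc_add_same[OF fc] loc_comp_frac[OF f] gM.\<pi>_closed additive_mapD(2)[OF gM.\<pi>_additive])
  qed
  show "loc_comp R M f \<delta> \<nu> U = U" if U: "U \<in> grade (gloc R M f) \<nu>" for U
  proof -
    obtain x a \<delta>' where x: "U = loc_frac R M f x a" "f [^]\<^bsub>R\<^esub> a \<in> homog R \<delta>'" "x \<in> grade M (\<nu> + \<delta>')"
      using U by (auto simp: M.gloc_sel)
    have xc: "x \<in> carrier M" using x gM.grade_carrier by blast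
    show ?thesis
    proof (cases "f [^]\<^bsub>R\<^esub> a = \<zero>\<^bsub>R\<^esub>")
      case True
      have "(f [^]\<^bsub>R\<^esub> (a + b)) \<odot>\<^bsub>M\<^esub> z = \<zero>\<^bsub>M\<^esub>" if "z \<in> carrier M" for b z
        using True fc that by (simp add: R.nat_pow_mult[symmetric])
      then show ?thesis unfolding x(1) loc_comp_frac[OF f xc]
        using M.loc_frac_eq_iff[OF fc gM.\<pi>_closed[OF xc] xc] gM.\<pi>_closed[OF xc] xc by (auto intro!: exI[of _ a])
    next
      case False
      then have "\<delta>' = nat_multiple a \<delta>" using homog_unique[OF x(2) homog_pow[OF f]] by simp
      then show ?thesis unfolding x(1) loc_comp_frac[OF f xc] using gM.\<pi>_id x(3) by simp
    qed
  qed
  show "indet k \<odot>\<^bsub>gloc R M f\<^esub> loc_comp R M f \<delta> \<nu> U = loc_comp R M f \<delta> (\<gamma> k + \<nu>) (indet k \<odot>\<^bsub>gloc R M f\<^esub> U)"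
    if k: "k < n" and U: "U \<in> carrier (gloc R M f)" for k U
  proof -
    obtain x a where x: "x \<in> carrier M" "U = loc_frac R M f x a" using frac[OF U] by blast
    show ?thesis
      using x k indet_closed[OF k] by (simp add: M.gloc_smult[OF fc] loc_comp_frac[OF f] gM.\<pi>_closed gM.\<pi>_shift add.assoc)
  qed
qed

lemma loc_comp_loc_map:
  assumes f: "f \<in> homog R \<delta>" and g: "g \<in> homog R \<epsilon>" and U: "U \<in> carrier (gloc R M f)"
  shows "loc_comp R M (f \<otimes>\<^bsub>R\<^esub> g) (\<delta> + \<epsilon>) \<nu> (loc_map R M f g U) = loc_map R M f g (loc_comp R M f \<delta> \<nu> U)"
proof -
  note c = homog_closed[OF f] homog_closed[OF g]
  obtain x a where x: "x \<in> carrier M" "U = loc_frac R M f x a" using U by (auto simp: M.gloc_sel)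
  have deg: "\<nu> + nat_multiple a (\<delta> + \<epsilon>) = nat_multiple a \<epsilon> + (\<nu> + nat_multiple a \<delta>)" by (simp add: nat_multiple_plus algebra_simps)
  have "gcomp M (\<nu> + nat_multiple a (\<delta> + \<epsilon>)) ((g [^]\<^bsub>R\<^esub> a) \<odot>\<^bsub>M\<^esub> x) = (g [^]\<^bsub>R\<^esub> a) \<odot>\<^bsub>M\<^esub> gcomp M (\<nu> + nat_multiple a \<delta>) x"
    unfolding deg using c by (intro gcomp_smult[OF M homog_pow[OF g] _ x(1)]) simp
  then show ?thesis
    using x c by (simp add: M.loc_map_frac loc_comp_frac[OF f] loc_comp_frac[OF homog_mult[OF f g]] gM.\<pi>_closed)
qed

end

end

section \<open>The Cech complex\<close>
lemma cech_index_remove: "I \<in> cech_index fs (Suc p) \<Longrightarrow> k \<in> I \<Longrightarrow> I - {k} \<in> cech_index fs p"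
  by (auto simp: cech_index_def)

lemma cech_indexD:
  assumes "I \<in> cech_index fs p"
  shows "I \<subseteq> {..<length fs}" "finite I" "card I = p"
  using assms finite_subset[of I "{..<length fs}"] by (auto simp: cech_index_def)

locale cech = graded_poly S n \<gamma> for S :: "('s, 'b) ring_scheme" and n and \<gamma> :: "nat \<Rightarrow> 'g::ab_group_add" +
  fixes fs :: "(nat multiset \<Rightarrow> 's) list" and \<delta> :: "nat \<Rightarrow> 'g" and M :: "(nat multiset \<Rightarrow> 's, 'm, 'g) gmodule"
  assumes fs_homog: "i < length fs \<Longrightarrow> fs ! i \<in> homog (graded_poly_ring S n \<gamma>) (\<delta> i)"
    and fs_ideal: "i < length fs \<Longrightarrow> fs ! i \<in> Idl\<^bsub>graded_poly_ring S n \<gamma>\<^esub> (indet ` {..<n})"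
    and M: "graded_module (graded_poly_ring S n \<gamma>) M"
begin

abbreviation (input) "e I \<equiv> cech_elem R fs I"
abbreviation (input) "L I \<equiv> gloc R M (cech_elem R fs I)"
abbreviation (input) "restr I k \<equiv> loc_map R M (cech_elem R fs (I - {k})) (fs ! k)"
abbreviation (input) "C p \<equiv> cech_complex R fs M p"
abbreviation (input) "dC p \<equiv> cech_diff R fs M p"
abbreviation (input) "compL I \<equiv> loc_comp R M (cech_elem R fs I) (sum \<delta> I)"

definition cech_proj :: "nat \<Rightarrow> 'g \<Rightarrow> (nat set \<Rightarrow> ('m \<times> nat) set) \<Rightarrow> nat set \<Rightarrow> ('m \<times> nat) set" where
  "cech_proj p \<nu> y = (\<lambda>I\<in>cech_index fs p. loc_comp R M (cech_elem R fs I) (sum \<delta> I) \<nu> (y I))"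

lemma fs_closed: "i < length fs \<Longrightarrow> fs ! i \<in> carrier R"
  using fs_homog homog_closed by blast

lemma cech_elem_insert:
  assumes "insert k I \<subseteq> {..<length fs}" "k \<notin> I"
  shows "e (insert k I) = fs ! k \<otimes>\<^bsub>R\<^esub> e I"
proof -
  have "finite I" using assms(1) finite_subset[of I "{..<length fs}"] by simp
  then show ?thesis unfolding cech_elem_def using assms fs_closed by (intro R.finprod_insert) auto
qed

lemma cech_elem_homog:
  assumes "I \<subseteq> {..<length fs}"
  shows "e I \<in> homog R (sum \<delta> I)"
proof -
  have "finite I" using assms by (rule finite_subset) simp
  then show ?thesis using assms
  proof (induction I)
    case empty
    then show ?case by (simp add: cech_elem_def homog_one)
  next
    case (insert k I)
    then have "fs ! k \<otimes>\<^bsub>R\<^esub> e I \<in> homog R (\<delta> k + sum \<delta> I)"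
      by (intro homog_mult fs_homog) auto
    then show ?case using insert by (simp add: cech_elem_insert)
  qed
qed

lemma cech_elem_closed: "I \<subseteq> {..<length fs} \<Longrightarrow> e I \<in> carrier R"
  using cech_elem_homog homog_closed by blast

lemma cech_elem_remove:
  assumes "I \<subseteq> {..<length fs}" "k \<in> I"
  shows "e (I - {k}) \<otimes>\<^bsub>R\<^esub> fs ! k = e I"
proof -
  have I: "insert k (I - {k}) = I" "I - {k} \<subseteq> {..<length fs}" "k < length fs" using assms by auto
  have "e I = fs ! k \<otimes>\<^bsub>R\<^esub> e (I - {k})"
    using cech_elem_insert[of k "I - {k}"] I assms by simp
  then show ?thesis using R.m_comm[OF cech_elem_closed[OF I(2)] fs_closed[OF I(3)]] by simp
qed

lemma cech_elem_ideal:
  assumes "I \<subseteq> {..<length fs}" "I \<noteq> {}"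
  shows "e I \<in> Idl\<^bsub>R\<^esub> (indet ` {..<n})"
proof -
  obtain k where k: "k \<in> I" using assms by blast
  have "ideal (Idl\<^bsub>R\<^esub> (indet ` {..<n})) R" using indet_closed by (intro R.genideal_ideal) auto
  moreover have "fs ! k \<in> Idl\<^bsub>R\<^esub> (indet ` {..<n})" using fs_ideal k assms by auto
  moreover have "e (I - {k}) \<in> carrier R" using assms by (intro cech_elem_closed) auto
  ultimately show ?thesis using ideal.I_l_closed cech_elem_remove[OF assms(1) k] by metis
qed

interpretation M: localizable R M
  by (intro localizable.intro graded_moduleD(1)[OF M])

lemma graded_koszul_L:
  assumes "I \<subseteq> {..<length fs}"
  shows "graded_koszul R (L I) n indet \<gamma> (compL I)"
  by (rule graded_koszul_gloc[OF M cech_elem_homog[OF assms]])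

lemma abelian_group_L: "I \<subseteq> {..<length fs} \<Longrightarrow> abelian_group (L I)"
  by (rule M.abelian_group_gloc[OF cech_elem_closed])

lemma module_L: "I \<subseteq> {..<length fs} \<Longrightarrow> module R (L I)"
  by (rule M.module_gloc[OF cech_elem_closed])

lemma linear_map_restr:
  assumes "I \<subseteq> {..<length fs}" "k \<in> I"
  shows "linear_map R (L (I - {k})) (L I) (restr I k)"
proof -
  have "I - {k} \<subseteq> {..<length fs}" "k < length fs" using assms by auto
  then show ?thesis
    using M.linear_map_loc_map[OF cech_elem_closed fs_closed] unfolding cech_elem_remove[OF assms, symmetric] by simp
qed

lemma compL_restr:
  assumes "I \<subseteq> {..<length fs}" "k \<in> I" "U \<in> carrier (L (I - {k}))"
  shows "compL I \<nu> (restr I k U) = restr I k (compL (I - {k}) \<nu> U)"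
proof -
  have I: "I - {k} \<subseteq> {..<length fs}" "k < length fs" "finite I"
    using assms finite_subset[of I "{..<length fs}"] by auto
  have "sum \<delta> I = sum \<delta> (I - {k}) + \<delta> k" using I assms sum.remove[of I k \<delta>] by (simp add: add.commute)
  then show ?thesis
    using loc_comp_loc_map[OF M cech_elem_homog[OF I(1)] fs_homog[OF I(2)] assms(3)]
    unfolding cech_elem_remove[OF assms(1,2)] by simp
qed

lemma restr_commute:
  assumes I: "I \<subseteq> {..<length fs}" and kl: "k \<in> I" "l \<in> I" "k \<noteq> l" and U: "U \<in> carrier (L (I - {k} - {l}))"
  shows "restr I k (restr (I - {k}) l U) = restr I l (restr (I - {l}) k U)"
proof -
  have J: "I - {l} - {k} = I - {k} - {l}" "I - {k} \<subseteq> {..<length fs}" "I - {l} \<subseteq> {..<length fs}" "I - {k} - {l} \<subseteq> {..<length fs}"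
    "k < length fs" "l < length fs" using I kl by auto
  have "e (I - {k}) = e (I - {k} - {l}) \<otimes>\<^bsub>R\<^esub> fs ! l" "e (I - {l}) = e (I - {k} - {l}) \<otimes>\<^bsub>R\<^esub> fs ! k"
    using cech_elem_remove[OF J(2), of l] cech_elem_remove[OF J(3), of k] kl J(1) by auto
  then show ?thesis
    using M.loc_map_loc_map_commute[OF cech_elem_closed[OF J(4)] fs_closed[OF J(6)] fs_closed[OF J(5)] U] J(1) by simp
qed

lemma graded_koszul_C: "graded_koszul R (C p) n indet \<gamma> (cech_proj p)"
proof -
  have "graded_koszul R (gprod (cech_index fs p) (\<lambda>I. L I)) n indet \<gamma>
      (\<lambda>\<nu> y. \<lambda>I\<in>cech_index fs p. compL I \<nu> (y I))"
    by (rule graded_koszul_gprod[OF R.cring_axioms indet_closed graded_koszul_L[OF cech_indexD(1)]])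
  moreover have "cech_proj p = (\<lambda>\<nu> y. \<lambda>I\<in>cech_index fs p. compL I \<nu> (y I))"
    by (intro ext) (simp add: cech_proj_def)
  ultimately show ?thesis by (simp add: cech_complex_def)
qed

lemma module_C: "module R (C p)"
  using graded_koszul_C[of p] by (simp add: graded_koszul_def koszul_def)

lemma C_sel:
  "c \<in> carrier (C p) \<Longrightarrow> I \<in> cech_index fs p \<Longrightarrow> c I \<in> carrier (L I)"
  "I \<in> cech_index fs p \<Longrightarrow> (x \<oplus>\<^bsub>C p\<^esub> y) I = x I \<oplus>\<^bsub>L I\<^esub> y I"
  "I \<in> cech_index fs p \<Longrightarrow> (r \<odot>\<^bsub>C p\<^esub> y) I = r \<odot>\<^bsub>L I\<^esub> y I"
  "I \<in> cech_index fs p \<Longrightarrow> \<zero>\<^bsub>C p\<^esub> I = \<zero>\<^bsub>L I\<^esub>"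
  by (auto simp: cech_complex_def gprod_sel)

lemma C_eqI:
  "x \<in> carrier (C p) \<Longrightarrow> y \<in> carrier (C p) \<Longrightarrow> (\<And>I. I \<in> cech_index fs p \<Longrightarrow> x I = y I) \<Longrightarrow> x = y"
  unfolding cech_complex_def by (rule gprod_eqI)

lemma cech_diff_apply:
  assumes "I \<in> cech_index fs (Suc p)"
  shows "dC p c I = (\<Oplus>\<^bsub>L I\<^esub>k\<in>I. signed (L I) (below k I) (restr I k (c (I - {k}))))"
  using assms by (simp add: cech_diff_def Let_def signed_def below_def)

lemma restr_closed:
  assumes "I \<in> cech_index fs (Suc p)" "k \<in> I" "c \<in> carrier (C p)"
  shows "restr I k (c (I - {k})) \<in> carrier (L I)"
  by (rule additive_mapD(1)[OF linear_mapD(1)[OF linear_map_restr[OF cech_indexD(1)[OF assms(1)] assms(2)]]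
    C_sel(1)[OF assms(3) cech_index_remove[OF assms(1,2)]]])

lemma signed_restr_closed:
  assumes "I \<in> cech_index fs (Suc p)" "k \<in> I" "c \<in> carrier (C p)"
  shows "signed (L I) m (restr I k (c (I - {k}))) \<in> carrier (L I)"
  by (rule abelian_group.signed_closed[OF abelian_group_L[OF cech_indexD(1)[OF assms(1)]] restr_closed[OF assms]])

lemma cech_diff_closed:
  assumes "c \<in> carrier (C p)"
  shows "dC p c \<in> carrier (C (Suc p))"
proof -
  have "dC p c I \<in> carrier (L I)" if I: "I \<in> cech_index fs (Suc p)" for I
    unfolding cech_diff_apply[OF I]
    using signed_restr_closed[OF I _ assms]
    by (intro abelian_monoid.finsum_closed[OF abelian_group.axioms(1)[OF abelian_group_L[OF cech_indexD(1)[OF I]]]]) auto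
  then show ?thesis by (auto simp: cech_complex_def gprod_sel cech_diff_def)
qed

lemma linear_map_cech_diff: "linear_map R (C p) (C (Suc p)) (dC p)"
  unfolding linear_map_def additive_map_def
proof (intro conjI ballI funcsetI)
  interpret Cp: module R "C p" by (rule module_C)
  interpret Cp': module R "C (Suc p)" by (rule module_C)
  show cl: "dC p c \<in> carrier (C (Suc p))" if "c \<in> carrier (C p)" for c using cech_diff_closed[OF that] .
  fix c assume c: "c \<in> carrier (C p)"
  show "dC p (c \<oplus>\<^bsub>C p\<^esub> c') = dC p c \<oplus>\<^bsub>C (Suc p)\<^esub> dC p c'" if c': "c' \<in> carrier (C p)" for c'
  proof (rule C_eqI[of _ "Suc p"])
    fix I assume I: "I \<in> cech_index fs (Suc p)"
    interpret L: abelian_group "L I" by (rule abelian_group_L[OF cech_indexD(1)[OF I]])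
    have "dC p (c \<oplus>\<^bsub>C p\<^esub> c') I = (\<Oplus>\<^bsub>L I\<^esub>k\<in>I. signed (L I) (below k I) (restr I k (c (I - {k}))) \<oplus>\<^bsub>L I\<^esub>
        signed (L I) (below k I) (restr I k (c' (I - {k}))))"
      unfolding cech_diff_apply[OF I]
    proof (intro L.finsum_cong')
      fix k assume k: "k \<in> I"
      note J = cech_index_remove[OF I k]
      have "restr I k ((c \<oplus>\<^bsub>C p\<^esub> c') (I - {k})) = restr I k (c (I - {k})) \<oplus>\<^bsub>L I\<^esub> restr I k (c' (I - {k}))"
        unfolding C_sel(2)[OF J]
        by (rule additive_mapD(2)[OF linear_mapD(1)[OF linear_map_restr[OF cech_indexD(1)[OF I] k]] C_sel(1)[OF c J] C_sel(1)[OF c' J]])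
      then show "signed (L I) (below k I) (restr I k ((c \<oplus>\<^bsub>C p\<^esub> c') (I - {k}))) =
          signed (L I) (below k I) (restr I k (c (I - {k}))) \<oplus>\<^bsub>L I\<^esub> signed (L I) (below k I) (restr I k (c' (I - {k})))"
        using L.signed_add[OF restr_closed[OF I k c] restr_closed[OF I k c']] by simp
    qed (use signed_restr_closed[OF I] c c' in auto)
    also have "\<dots> = dC p c I \<oplus>\<^bsub>L I\<^esub> dC p c' I"
      unfolding cech_diff_apply[OF I] using signed_restr_closed[OF I] c c' by (intro L.finsum_addf) auto
    finally show "dC p (c \<oplus>\<^bsub>C p\<^esub> c') I = (dC p c \<oplus>\<^bsub>C (Suc p)\<^esub> dC p c') I" unfolding C_sel(2)[OF I] .
  qed (use c c' cl in auto)
  show "dC p (r \<odot>\<^bsub>C p\<^esub> c) = r \<odot>\<^bsub>C (Suc p)\<^esub> dC p c" if r: "r \<in> carrier R" for r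
  proof (rule C_eqI[of _ "Suc p"])
    fix I assume I: "I \<in> cech_index fs (Suc p)"
    interpret L: module R "L I" by (rule module_L[OF cech_indexD(1)[OF I]])
    have "r \<odot>\<^bsub>L I\<^esub> dC p c I = (\<Oplus>\<^bsub>L I\<^esub>k\<in>I. r \<odot>\<^bsub>L I\<^esub> signed (L I) (below k I) (restr I k (c (I - {k}))))"
      unfolding cech_diff_apply[OF I] using signed_restr_closed[OF I _ c] cech_indexD(2)[OF I] r
      by (intro L.finsum_smult_ldistr) auto
    also have "\<dots> = dC p (r \<odot>\<^bsub>C p\<^esub> c) I"
      unfolding cech_diff_apply[OF I]
    proof (intro L.finsum_cong')
      fix k assume k: "k \<in> I"
      note J = cech_index_remove[OF I k]
      have "restr I k ((r \<odot>\<^bsub>C p\<^esub> c) (I - {k})) = r \<odot>\<^bsub>L I\<^esub> restr I k (c (I - {k}))"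
        unfolding C_sel(3)[OF J]
        by (rule linear_mapD(2)[OF linear_map_restr[OF cech_indexD(1)[OF I] k] r C_sel(1)[OF c J]])
      then show "r \<odot>\<^bsub>L I\<^esub> signed (L I) (below k I) (restr I k (c (I - {k}))) =
          signed (L I) (below k I) (restr I k ((r \<odot>\<^bsub>C p\<^esub> c) (I - {k})))"
        using L.smult_signed[OF r restr_closed[OF I k c]] by simp
    qed (use signed_restr_closed[OF I] c r in auto)
    finally show "dC p (r \<odot>\<^bsub>C p\<^esub> c) I = (r \<odot>\<^bsub>C (Suc p)\<^esub> dC p c) I" unfolding C_sel(3)[OF I] by simp
  qed (use c r cl in auto)
qed

lemma graded_map_cech_diff: "graded_map (C p) (cech_proj p) (cech_proj (Suc p)) (dC p)"
  unfolding graded_map_def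
proof (intro allI ballI)
  interpret Cp: graded_koszul R "C p" n indet \<gamma> "cech_proj p" by (rule graded_koszul_C)
  interpret Cp': graded_koszul R "C (Suc p)" n indet \<gamma> "cech_proj (Suc p)" by (rule graded_koszul_C)
  fix \<nu> c assume c: "c \<in> carrier (C p)"
  have c': "cech_proj p \<nu> c \<in> carrier (C p)" using Cp.\<pi>_closed[OF c] .
  show "cech_proj (Suc p) \<nu> (dC p c) = dC p (cech_proj p \<nu> c)"
  proof (rule C_eqI[of _ "Suc p"])
    fix I assume I: "I \<in> cech_index fs (Suc p)"
    note Ii = cech_indexD[OF I]
    interpret L: graded_koszul R "L I" n indet \<gamma> "compL I" by (rule graded_koszul_L[OF Ii(1)])
    note ad = L.M.abelian_group_axioms L.M.abelian_group_axioms L.\<pi>_additive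
    have "cech_proj (Suc p) \<nu> (dC p c) I = compL I \<nu> (dC p c I)" using I by (simp add: cech_proj_def)
    also have "\<dots> = (\<Oplus>\<^bsub>L I\<^esub>k\<in>I. compL I \<nu> (signed (L I) (below k I) (restr I k (c (I - {k})))))"
      unfolding cech_diff_apply[OF I] using signed_restr_closed[OF I _ c] Ii(2)
      by (intro additive_map_finsum[OF ad]) auto
    also have "\<dots> = dC p (cech_proj p \<nu> c) I"
      unfolding cech_diff_apply[OF I]
    proof (intro L.M.finsum_cong')
      fix k assume k: "k \<in> I"
      note J = cech_index_remove[OF I k]
      show "compL I \<nu> (signed (L I) (below k I) (restr I k (c (I - {k})))) = signed (L I) (below k I) (restr I k (cech_proj p \<nu> c (I - {k})))"
        using additive_map_signed[OF ad restr_closed[OF I k c]] compL_restr[OF Ii(1) k C_sel(1)[OF c J]] J by (simp add: cech_proj_def)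
    qed (use signed_restr_closed[OF I _ c'] in auto)
    finally show "cech_proj (Suc p) \<nu> (dC p c) I = dC p (cech_proj p \<nu> c) I" .
  qed (use c c' cech_diff_closed Cp'.\<pi>_closed in auto)
qed

lemma cech_diff_cech_diff:
  assumes c: "c \<in> carrier (C p)"
  shows "dC (Suc p) (dC p c) = \<zero>\<^bsub>C (Suc (Suc p))\<^esub>"
proof (rule C_eqI[of _ "Suc (Suc p)"])
  interpret C'': module R "C (Suc (Suc p))" by (rule module_C)
  show "\<zero>\<^bsub>C (Suc (Suc p))\<^esub> \<in> carrier (C (Suc (Suc p)))" by simp
  fix I assume I: "I \<in> cech_index fs (Suc (Suc p))"
  note Ii = cech_indexD[OF I]
  interpret L: abelian_group "L I" by (rule abelian_group_L[OF Ii(1)])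
  let ?h = "\<lambda>k l. signed (L I) (below k I + below l (I - {k})) (restr I k (restr (I - {k}) l (c (I - {k} - {l}))))"
  have closed: "restr I k (restr (I - {k}) l (c (I - {k} - {l}))) \<in> carrier (L I)" if kl: "k \<in> I" "l \<in> I" "k \<noteq> l" for k l
  proof -
    have J: "I - {k} \<in> cech_index fs (Suc p)" using cech_index_remove[OF I kl(1)] .
    have "restr (I - {k}) l (c (I - {k} - {l})) \<in> carrier (L (I - {k}))" using kl by (intro restr_closed[OF J _ c]) auto
    then show ?thesis by (rule additive_mapD(1)[OF linear_mapD(1)[OF linear_map_restr[OF Ii(1) kl(1)]]])
  qed
  have inner: "signed (L I) (below k I) (restr I k (dC p c (I - {k}))) = (\<Oplus>\<^bsub>L I\<^esub>l\<in>I - {k}. ?h k l)" if k: "k \<in> I" for k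
  proof -
    have J: "I - {k} \<in> cech_index fs (Suc p)" using cech_index_remove[OF I k] .
    note Jg = abelian_group_L[OF cech_indexD(1)[OF J]]
    note lmk = linear_mapD(1)[OF linear_map_restr[OF Ii(1) k]]
    have "additive_map (L (I - {k})) (L I) (\<lambda>z. signed (L I) (below k I) (restr I k z))"
      using additive_mapD[OF lmk] by (auto simp: additive_map_def L.signed_add)
    note push = additive_map_finsum[OF Jg L.abelian_group_axioms this]
    have "signed (L I) (below k I) (restr I k (dC p c (I - {k}))) = (\<Oplus>\<^bsub>L I\<^esub>l\<in>I - {k}.
        signed (L I) (below k I) (restr I k (signed (L (I - {k})) (below l (I - {k})) (restr (I - {k}) l (c (I - {k} - {l}))))))"
      unfolding cech_diff_apply[OF J]
      by (rule push, use cech_indexD(2)[OF J] in simp, use signed_restr_closed[OF J _ c] in auto)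
    also have "\<dots> = (\<Oplus>\<^bsub>L I\<^esub>l\<in>I - {k}. ?h k l)"
    proof (intro L.finsum_cong')
      fix l assume l: "l \<in> I - {k}"
      have "restr I k (signed (L (I - {k})) (below l (I - {k})) (restr (I - {k}) l (c (I - {k} - {l})))) =
          signed (L I) (below l (I - {k})) (restr I k (restr (I - {k}) l (c (I - {k} - {l}))))"
        by (rule additive_map_signed[OF Jg L.abelian_group_axioms lmk restr_closed[OF J l c]])
      then show "signed (L I) (below k I) (restr I k (signed (L (I - {k})) (below l (I - {k})) (restr (I - {k}) l (c (I - {k} - {l}))))) = ?h k l"
        using L.signed_signed[OF closed] k l by simp
    qed (use closed k in auto)
    finally show ?thesis .
  qed
  have "dC (Suc p) (dC p c) I = (\<Oplus>\<^bsub>L I\<^esub>k\<in>I. \<Oplus>\<^bsub>L I\<^esub>l\<in>I - {k}. ?h k l)"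
    unfolding cech_diff_apply[OF I] by (intro L.finsum_cong') (use inner closed in \<open>auto intro!: L.finsum_closed\<close>)
  also have "\<dots> = \<zero>\<^bsub>L I\<^esub>"
  proof (rule L.finsum_antisymmetric[OF Ii(2)])
    fix k l assume kl: "k \<in> I" "l \<in> I" "k \<noteq> l"
    show "?h k l \<in> carrier (L I)" using closed[OF kl] by simp
    have J: "I - {l} - {k} = I - {k} - {l}" by auto
    have "c (I - {k} - {l}) \<in> carrier (L (I - {k} - {l}))"
      using C_sel(1)[OF c] cech_index_remove[OF cech_index_remove[OF I kl(1)], of l] kl by simp
    then have eq: "restr I l (restr (I - {l}) k (c (I - {l} - {k}))) = restr I k (restr (I - {k}) l (c (I - {k} - {l})))"
      using restr_commute[OF Ii(1) kl] by (simp add: J)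
    have "odd ((below k I + below l (I - {k})) + (below l I + below k (I - {l})))"
      using below_remove[OF Ii(2) kl(1), of l] below_remove[OF Ii(2) kl(2), of k] kl(3) by auto
    then show "?h k l \<oplus>\<^bsub>L I\<^esub> ?h l k = \<zero>\<^bsub>L I\<^esub>"
      unfolding eq using closed[OF kl] by (intro L.signed_Suc_cancel)
  qed
  finally show "dC (Suc p) (dC p c) I = \<zero>\<^bsub>C (Suc (Suc p))\<^esub> I" unfolding C_sel(4)[OF I] .
qed (use c cech_diff_closed in auto)

end

section \<open>The chase through the Cech complex\<close>
context cech
begin

text \<open>In positive Cech degree every factor is a localization at a product of at least one of the elements of
\<open>fs\<close>, so at an element of \<open>(X)\<close>, which acts bijectively there.\<close>
lemma cech_koszul_exact:
  assumes p: "p \<ge> 1"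
  shows "koszul_exact indet n \<gamma> (C p) \<mu> q"
proof -
  interpret Cp: graded_koszul R "C p" n indet \<gamma> "cech_proj p" by (rule graded_koszul_C)
  show ?thesis
  proof (rule Cp.koszul_exactI)
    fix y assume y: "y \<in> koszul_chains n \<gamma> (C p) \<mu> q" and cycle: "\<And>I. koszul_d indet n (C p) y I = \<zero>\<^bsub>C p\<^esub>"
    have yc: "y I \<in> carrier (C p)" for I using Cp.koszul_chains_carrier[OF y] .
    have eval: "linear_map R (C p) (L J) (\<lambda>z. z J)" if "J \<in> cech_index fs p" for J
      unfolding cech_complex_def by (rule linear_map_gprod_eval[OF that])
    have ev: "koszul_d indet n (C p) z I J = koszul_d indet n (L J) (\<lambda>I. z I J) I"
      if "J \<in> cech_index fs p" "\<And>I. z I \<in> carrier (C p)" for J z I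
      using Cp.linear_map_koszul_d[of "L J" "\<lambda>z. z J" z I] eval[OF that(1)] module_L[OF cech_indexD(1)[OF that(1)]] that(2) by simp
    have "\<exists>w. (\<forall>I. w I \<in> carrier (L J)) \<and> (\<forall>I. y I J = koszul_d indet n (L J) w I)" if J: "J \<in> cech_index fs p" for J
    proof -
      note Jc = cech_indexD(1)[OF J]
      have "J \<noteq> {}" using cech_indexD(3)[OF J] p by auto
      note id = cech_elem_ideal[OF Jc this] cech_elem_closed[OF Jc]
      interpret M: localizable R M by (intro localizable.intro graded_moduleD(1)[OF M])
      interpret LJ: graded_koszul R "L J" n indet \<gamma> "compL J" by (rule graded_koszul_L[OF Jc])
      show ?thesis
      proof (rule LJ.koszul_cycle_is_boundary_if_bij[OF _ _ _ id])
        show "y I J \<in> carrier (L J)" for I by (rule C_sel(1)[OF yc J])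
        show "y I J = \<zero>\<^bsub>L J\<^esub>" if "\<not> I \<subseteq> {..<n}" for I
          using koszul_chainsD(2)[OF y, of I] that C_sel(4)[OF J] by simp
        show "koszul_d indet n (L J) (\<lambda>I. y I J) I = \<zero>\<^bsub>L J\<^esub>" for I
          using ev[of J y I, OF J yc] cycle[of I] C_sel(4)[OF J] by simp
      qed (use M.gloc_smult_bij[OF id(2)] in auto)
    qed
    then obtain w where w: "\<And>J I. J \<in> cech_index fs p \<Longrightarrow> w J I \<in> carrier (L J)"
      "\<And>J I. J \<in> cech_index fs p \<Longrightarrow> y I J = koszul_d indet n (L J) (w J) I" by metis
    let ?w = "\<lambda>I. \<lambda>J\<in>cech_index fs p. w J I"
    have wc: "?w I \<in> carrier (C p)" for I using w(1) by (auto simp: cech_complex_def gprod_sel)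
    have "y I = koszul_d indet n (C p) ?w I" for I
    proof (rule C_eqI[OF yc Cp.koszul_d_closed[of ?w, OF wc]])
      fix J assume J: "J \<in> cech_index fs p"
      show "y I J = koszul_d indet n (C p) ?w I J" using ev[of J ?w I, OF J wc] w(2)[OF J] J by simp
    qed
    then show "\<exists>w. (\<forall>I. w I \<in> carrier (C p)) \<and> (\<forall>I. y I = koszul_d indet n (C p) w I)"
      using wc by (intro exI[of _ ?w] conjI allI)
  qed
qed

lemma cech_cohomology_grade_zeroD:
  assumes zero: "grade (cech_cohomology R fs M p) \<nu> = {\<zero>\<^bsub>cech_cohomology R fs M p\<^esub>}"
    and c: "c \<in> grade (C p) \<nu>" "dC p c = \<zero>\<^bsub>C (Suc p)\<^esub>"
  shows "c \<in> (if p = 0 then {\<zero>\<^bsub>C 0\<^esub>} else dC (p - 1) ` carrier (C (p - 1)))"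
proof -
  interpret Cp: graded_koszul R "C p" n indet \<gamma> "cech_proj p" by (rule graded_koszul_C)
  let ?N = "if p = 0 then {\<zero>\<^bsub>C 0\<^esub>} else dC (p - 1) ` carrier (C (p - 1))"
  let ?Z = "gsub (C p) {x \<in> carrier (C p). dC p x = \<zero>\<^bsub>C (Suc p)\<^esub>}"
  have cc: "c \<in> carrier (C p)" using Cp.grade_carrier[OF c(1)] .
  have "c \<in> grade ?Z \<nu>" using c cc by (simp add: gsub_def)
  then have "?N +>\<^bsub>?Z\<^esub> c \<in> grade (cech_cohomology R fs M p) \<nu>"
    by (auto simp: cech_cohomology_def cochain_cohomology_def gquot_def)
  also have "\<dots> = {?N}"
    unfolding zero by (simp add: cech_cohomology_def cochain_cohomology_def gquot_def)
  finally have eq: "?N +>\<^bsub>?Z\<^esub> c = ?N" by simp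
  have zero_in: "\<zero>\<^bsub>C p\<^esub> \<in> ?N"
  proof (cases p)
    case (Suc p')
    interpret Cp': graded_koszul R "C p'" n indet \<gamma> "cech_proj p'" by (rule graded_koszul_C)
    have "dC p' \<zero>\<^bsub>C p'\<^esub> = \<zero>\<^bsub>C p\<^esub>"
      using additive_map_zero[OF Cp'.M.abelian_group_axioms Cp.M.abelian_group_axioms, of "dC p'"]
        linear_mapD(1)[OF linear_map_cech_diff[of p']] Suc by simp
    then have "\<zero>\<^bsub>C p\<^esub> \<in> dC p' ` carrier (C p')" using Cp'.M.zero_closed by (metis imageI)
    then show ?thesis using Suc by simp
  qed simp
  have coset: "z \<oplus>\<^bsub>C p\<^esub> c \<in> N +>\<^bsub>?Z\<^esub> c" if "z \<in> N" for z N
    unfolding a_r_coset_def' using that by (auto simp: gsub_def)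
  have "\<zero>\<^bsub>C p\<^esub> \<oplus>\<^bsub>C p\<^esub> c \<in> ?N" using coset[OF zero_in] unfolding eq .
  then show ?thesis using cc by (simp only: Cp.M.l_zero)
qed

context
  fixes \<mu> :: 'g and j :: nat
  assumes vanish: "\<And>i I. I \<subseteq> {..<n} \<Longrightarrow> card I = i + j \<Longrightarrow>
    grade (cech_cohomology R fs M i) (\<mu> - sum \<gamma> I) = {\<zero>\<^bsub>cech_cohomology R fs M i\<^esub>}"
begin

text \<open>The vanishing of cohomology is used componentwise: the component of \<open>z\<close> at \<open>I\<close> is a cocycle of degree
\<open>\<mu> - \<gamma>\<^sub>I\<close>.\<close>
lemma cech_exact:
  assumes z: "z \<in> koszul_chains n \<gamma> (C p) \<mu> (p + j)" and cyc: "\<And>I. dC p (z I) = \<zero>\<^bsub>C (Suc p)\<^esub>"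
  shows "z I \<in> (if p = 0 then {\<zero>\<^bsub>C 0\<^esub>} else dC (p - 1) ` carrier (C (p - 1)))"
proof (cases "I \<subseteq> {..<n} \<and> card I = p + j")
  case True
  then show ?thesis
    using cech_cohomology_grade_zeroD[OF vanish koszul_chainsD(1)[OF z] cyc] by blast
next
  case False
  interpret Cp: graded_koszul R "C p" n indet \<gamma> "cech_proj p" by (rule graded_koszul_C)
  show ?thesis
  proof (cases p)
    case 0
    then show ?thesis using koszul_chainsD(2)[OF z False] by simp
  next
    case (Suc p')
    interpret Cp': graded_koszul R "C p'" n indet \<gamma> "cech_proj p'" by (rule graded_koszul_C)
    have "dC p' \<zero>\<^bsub>C p'\<^esub> = \<zero>\<^bsub>C p\<^esub>"
      using additive_map_zero[OF Cp'.M.abelian_group_axioms Cp.M.abelian_group_axioms, of "dC p'"]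
        linear_mapD(1)[OF linear_map_cech_diff[of p']] Suc by simp
    then have "\<zero>\<^bsub>C p\<^esub> \<in> dC p' ` carrier (C p')" using Cp'.M.zero_closed by (metis imageI)
    then show ?thesis using koszul_chainsD(2)[OF z False] Suc by simp
  qed
qed

text \<open>The incoming differential. At \<open>p = 0\<close> the index \<open>p - 1\<close> is \<open>0\<close> again, and the zero map on that term plays
the part of the differential out of the term of degree \<open>-1\<close>.\<close>
definition cech_prev :: "nat \<Rightarrow> (nat set \<Rightarrow> ('m \<times> nat) set) \<Rightarrow> (nat set \<Rightarrow> ('m \<times> nat) set)" where
  "cech_prev p = (if p = 0 then (\<lambda>_. \<zero>\<^bsub>C 0\<^esub>) else dC (p - 1))"

text \<open>The chase runs along \<open>(p, p + j)\<close> with \<open>p\<close> increasing, and it ends once the exterior degree exceeds the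
number of variables.\<close>
lemma cech_chase:
  assumes "y \<in> koszul_chains n \<gamma> (C p) \<mu> (p + j)" and "\<And>I. dC p (koszul_d indet n (C p) y I) = \<zero>\<^bsub>C (Suc p)\<^esub>"
  shows "\<exists>w\<in>koszul_chains n \<gamma> (C p) \<mu> (Suc (p + j)). \<exists>v\<in>koszul_chains n \<gamma> (C (p - 1)) \<mu> (p + j).
    \<forall>I. y I = koszul_d indet n (C p) w I \<oplus>\<^bsub>C p\<^esub> cech_prev p (v I)"
  using assms
proof (induction "Suc n - (p + j)" arbitrary: p y)
  case 0
  interpret Cp: graded_koszul R "C p" n indet \<gamma> "cech_proj p" by (rule graded_koszul_C)
  interpret C': graded_koszul R "C (p - 1)" n indet \<gamma> "cech_proj (p - 1)" by (rule graded_koszul_C)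
  have "\<not> (I \<subseteq> {..<n} \<and> card I = p + j)" for I
  proof
    assume "I \<subseteq> {..<n} \<and> card I = p + j"
    then show False using card_mono[of "{..<n}" I] "0.hyps" by simp
  qed
  then have "y I = \<zero>\<^bsub>C p\<^esub>" for I by (rule koszul_chainsD(2)[OF "0.prems"(1)])
  moreover have "cech_prev p \<zero>\<^bsub>C (p - 1)\<^esub> = \<zero>\<^bsub>C p\<^esub>"
  proof (cases p)
    case (Suc p')
    then show ?thesis
      using additive_map_zero[OF C'.M.abelian_group_axioms Cp.M.abelian_group_axioms, of "dC p'"]
        linear_mapD(1)[OF linear_map_cech_diff[of p']] by (simp add: cech_prev_def)
  qed (simp add: cech_prev_def)
  ultimately have "y I = koszul_d indet n (C p) (\<lambda>_. \<zero>\<^bsub>C p\<^esub>) I \<oplus>\<^bsub>C p\<^esub> cech_prev p \<zero>\<^bsub>C (p - 1)\<^esub>" for I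
    by (simp add: Cp.koszul_d_zero)
  then show ?case
    by (intro bexI[of _ "\<lambda>_. \<zero>\<^bsub>C p\<^esub>"] bexI[of _ "\<lambda>_. \<zero>\<^bsub>C (p - 1)\<^esub>"] allI Cp.koszul_chains_zero C'.koszul_chains_zero)
next
  case (Suc m)
  interpret Cp: graded_koszul R "C p" n indet \<gamma> "cech_proj p" by (rule graded_koszul_C)
  interpret Cs: graded_koszul R "C (Suc p)" n indet \<gamma> "cech_proj (Suc p)" by (rule graded_koszul_C)
  note y = Suc.prems(1)
  have yc: "y I \<in> carrier (C p)" for I using Cp.koszul_chains_carrier[OF y] .
  note lin = linear_map_cech_diff[of p]
  note add = linear_mapD(1)[OF lin]
  have dy: "(\<lambda>I. dC p (y I)) \<in> koszul_chains n \<gamma> (C (Suc p)) \<mu> (p + j)"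
    by (rule koszul_chains_map[OF graded_map_grade[OF graded_koszul_C graded_koszul_C add graded_map_cech_diff]
      additive_map_zero[OF Cp.M.abelian_group_axioms Cs.M.abelian_group_axioms add] y])
  have "koszul_d indet n (C (Suc p)) (\<lambda>I. dC p (y I)) I = \<zero>\<^bsub>C (Suc p)\<^esub>" for I
    using Cp.linear_map_koszul_d[of "C (Suc p)" "dC p" y I, OF Cs.module_axioms lin yc] Suc.prems(2)[of I] by simp
  then obtain y' where y': "y' \<in> koszul_chains n \<gamma> (C (Suc p)) \<mu> (Suc p + j)" "\<And>I. dC p (y I) = koszul_d indet n (C (Suc p)) y' I"
    using cech_koszul_exact[of "Suc p" \<mu> "p + j"] dy unfolding koszul_exact_def by auto
  have "dC (Suc p) (koszul_d indet n (C (Suc p)) y' I) = \<zero>\<^bsub>C (Suc (Suc p))\<^esub>" for I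
    using cech_diff_cech_diff[OF yc[of I]] y'(2)[of I] by simp
  then have "\<exists>w\<in>koszul_chains n \<gamma> (C (Suc p)) \<mu> (Suc (Suc p + j)). \<exists>v\<in>koszul_chains n \<gamma> (C (Suc p - 1)) \<mu> (Suc p + j).
      \<forall>I. y' I = koszul_d indet n (C (Suc p)) w I \<oplus>\<^bsub>C (Suc p)\<^esub> cech_prev (Suc p) (v I)"
    using Suc.hyps(2) by (intro Suc.hyps(1)[OF _ y'(1)]) auto
  then obtain w' v' where wv: "w' \<in> koszul_chains n \<gamma> (C (Suc p)) \<mu> (Suc (Suc p + j))" "v' \<in> koszul_chains n \<gamma> (C p) \<mu> (Suc (p + j))"
      "\<And>I. y' I = koszul_d indet n (C (Suc p)) w' I \<oplus>\<^bsub>C (Suc p)\<^esub> dC p (v' I)"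
    by (auto simp: cech_prev_def)
  show ?case
  proof (rule staircase_step[where h = "dC p" and y' = y' and w' = w' and v' = v',
      OF graded_koszul_C graded_koszul.axioms(1)[OF graded_koszul_C] lin _ y _ _ wv(2)])
    show "dC p (y I) = koszul_d indet n (C (Suc p)) y' I" for I by (rule y'(2))
    show "y' I = koszul_d indet n (C (Suc p)) w' I \<oplus>\<^bsub>C (Suc p)\<^esub> dC p (v' I)" for I by (rule wv(3))
    show "w' I \<in> carrier (C (Suc p))" for I using Cs.koszul_chains_carrier[OF wv(1)] .
    fix z assume z: "z \<in> koszul_chains n \<gamma> (C p) \<mu> (p + j)" "\<And>I. dC p (z I) = \<zero>\<^bsub>C (Suc p)\<^esub>"
    note ex = cech_exact[OF z]
    show "\<exists>v\<in>koszul_chains n \<gamma> (C (p - 1)) \<mu> (p + j). \<forall>I. z I = cech_prev p (v I)"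
    proof (cases p)
      case 0
      then have "z I = cech_prev p \<zero>\<^bsub>C (p - 1)\<^esub>" for I using ex[of I] by (simp add: cech_prev_def)
      moreover have "(\<lambda>_. \<zero>\<^bsub>C (p - 1)\<^esub>) \<in> koszul_chains n \<gamma> (C (p - 1)) \<mu> (p + j)" using 0 Cp.koszul_chains_zero by simp
      ultimately show ?thesis by (intro bexI[of _ "\<lambda>_. \<zero>\<^bsub>C (p - 1)\<^esub>"] allI)
    next
      case (Suc p')
      have zz: "z \<in> koszul_chains n \<gamma> (C (Suc p')) \<mu> (p + j)" using z(1) Suc by simp
      have "z I \<in> dC p' ` carrier (C p')" for I using ex[of I] Suc by simp
      then have "\<exists>v\<in>koszul_chains n \<gamma> (C p') \<mu> (p + j). \<forall>I. z I = dC p' (v I)"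
        by (rule homogeneous_preimage[OF graded_koszul_C graded_koszul_C linear_mapD(1)[OF linear_map_cech_diff]
          graded_map_cech_diff zz])
      then show ?thesis using Suc by (simp add: cech_prev_def)
    qed
  qed
qed

text \<open>The term of Cech degree \<open>0\<close> is \<open>M\<close> localized at \<open>1\<close>, hence isomorphic to \<open>M\<close>, and there the chase says
that a cycle is a boundary.\<close>
lemma koszul_exact_of_cech_vanishing: "koszul_exact indet n \<gamma> M \<mu> j"
proof -
  interpret M: localizable R M by (intro localizable.intro graded_moduleD(1)[OF M])
  interpret gM: graded_koszul R M n indet \<gamma> "gcomp M" by (rule graded_koszul_gcomp[OF M indet_closed indet_homog])
  interpret C0: graded_koszul R "C 0" n indet \<gamma> "cech_proj 0" by (rule graded_koszul_C)
  interpret C1: module R "C 1" by (rule module_C)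
  have idx: "cech_index fs 0 = {{}}"
  proof (intro equalityI subsetI)
    fix I assume "I \<in> cech_index fs 0"
    then show "I \<in> {{}}" using cech_indexD(2,3)[of I fs 0] by simp
  qed (simp add: cech_index_def)
  have e0: "e {} = \<one>\<^bsub>R\<^esub>" by (simp add: cech_elem_def)
  define \<iota> where "\<iota> = (\<lambda>x. \<lambda>I\<in>{{} :: nat set}. loc_frac R M \<one>\<^bsub>R\<^esub> x 0)"
  have \<iota>_eqI: "u = \<iota> x" if "u \<in> carrier (C 0)" "x \<in> carrier M" "u {} = loc_frac R M \<one>\<^bsub>R\<^esub> x 0" for u x
    using that by (intro C_eqI[of _ 0]) (auto simp: \<iota>_def cech_complex_def gprod_sel idx e0 M.gloc_sel)
  have \<iota>_closed: "\<iota> x \<in> carrier (C 0)" if "x \<in> carrier M" for x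
    using that by (auto simp: \<iota>_def cech_complex_def gprod_sel idx e0 M.gloc_sel)
  have \<iota>_apply: "\<iota> x {} = loc_frac R M \<one>\<^bsub>R\<^esub> x 0" for x by (simp add: \<iota>_def)
  have \<iota>_lin: "linear_map R M (C 0) \<iota>"
    unfolding linear_map_def additive_map_def
  proof (intro conjI funcsetI ballI)
    fix x assume x: "x \<in> carrier M"
    show "\<iota> x \<in> carrier (C 0)" using \<iota>_closed[OF x] .
    show "\<iota> (x \<oplus>\<^bsub>M\<^esub> y) = \<iota> x \<oplus>\<^bsub>C 0\<^esub> \<iota> y" if y: "y \<in> carrier M" for y
      using x y \<iota>_closed
      by (intro \<iota>_eqI[symmetric]) (auto simp: C_sel(2)[of _ 0] idx \<iota>_apply e0 M.gloc_add_same)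
    show "\<iota> (r \<odot>\<^bsub>M\<^esub> x) = r \<odot>\<^bsub>C 0\<^esub> \<iota> x" if r: "r \<in> carrier R" for r
      using x r \<iota>_closed
      by (intro \<iota>_eqI[symmetric]) (auto simp: C_sel(3)[of _ 0] idx \<iota>_apply e0 M.gloc_smult)
  qed
  have \<iota>_inj: "x = y" if "x \<in> carrier M" "y \<in> carrier M" "\<iota> x = \<iota> y" for x y
  proof -
    have "loc_frac R M \<one>\<^bsub>R\<^esub> x 0 = loc_frac R M \<one>\<^bsub>R\<^esub> y 0" using that(3) \<iota>_apply by metis
    then show ?thesis using that(1,2) M.loc_frac_eq_iff[OF R.one_closed that(1,2), of 0 0] by simp
  qed
  have \<iota>_surj: "\<exists>x\<in>carrier M. u = \<iota> x" if u: "u \<in> carrier (C 0)" for u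
  proof -
    have "u {} \<in> carrier (gloc R M \<one>\<^bsub>R\<^esub>)" using C_sel(1)[OF u, of "{}"] idx e0 by simp
    then obtain x a where x: "x \<in> carrier M" "u {} = loc_frac R M \<one>\<^bsub>R\<^esub> x a" by (auto simp: M.gloc_sel)
    moreover have "loc_frac R M \<one>\<^bsub>R\<^esub> x a = loc_frac R M \<one>\<^bsub>R\<^esub> x 0"
      using M.loc_frac_eq_iff[OF R.one_closed x(1) x(1), of a 0] by simp
    ultimately show ?thesis using \<iota>_eqI[OF u] by metis
  qed
  have \<iota>_grade: "\<iota> ` grade M \<nu> \<subseteq> grade (C 0) \<nu>" for \<nu>
  proof -
    have "loc_frac R M \<one>\<^bsub>R\<^esub> x 0 \<in> grade (gloc R M \<one>\<^bsub>R\<^esub>) \<nu>" if "x \<in> grade M \<nu>" for x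
      unfolding M.gloc_sel using that homog_one by (intro CollectI exI[of _ x] exI[of _ 0]) auto
    then show ?thesis
      unfolding image_subset_iff \<iota>_def cech_complex_def gprod_sel idx by (simp add: restrict_PiE_iff e0)
  qed
  have \<iota>_zero: "\<iota> \<zero>\<^bsub>M\<^esub> = \<zero>\<^bsub>C 0\<^esub>"
    by (rule additive_map_zero[OF graded_moduleD(2)[OF M] C0.M.abelian_group_axioms linear_mapD(1)[OF \<iota>_lin]])
  show ?thesis
  proof (rule gM.koszul_exactI)
    fix y assume y: "y \<in> koszul_chains n \<gamma> M \<mu> j" and cycle: "\<And>I. koszul_d indet n M y I = \<zero>\<^bsub>M\<^esub>"
    have yc: "y I \<in> carrier M" for I using gM.koszul_chains_carrier[OF y] .
    have \<iota>y: "(\<lambda>I. \<iota> (y I)) \<in> koszul_chains n \<gamma> (C 0) \<mu> (0 + j)"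
      using koszul_chains_map[OF \<iota>_grade \<iota>_zero y] by simp
    have "dC 0 (koszul_d indet n (C 0) (\<lambda>I. \<iota> (y I)) I) = \<zero>\<^bsub>C (Suc 0)\<^esub>" for I
      using gM.linear_map_koszul_d[of "C 0" \<iota> y I, OF C0.module_axioms \<iota>_lin yc] cycle[of I] \<iota>_zero
        additive_map_zero[OF C0.M.abelian_group_axioms C1.M.abelian_group_axioms, of "dC 0"]
        linear_mapD(1)[OF linear_map_cech_diff[of 0]] by simp
    from cech_chase[OF \<iota>y this] obtain w where w: "w \<in> koszul_chains n \<gamma> (C 0) \<mu> (Suc (0 + j))"
      "\<And>I. \<iota> (y I) = koszul_d indet n (C 0) w I \<oplus>\<^bsub>C 0\<^esub> \<zero>\<^bsub>C 0\<^esub>"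
      by (auto simp: cech_prev_def)
    have wc: "w I \<in> carrier (C 0)" for I using C0.koszul_chains_carrier[OF w(1)] .
    obtain w' where w': "\<And>I. w' I \<in> carrier M" "\<And>I. w I = \<iota> (w' I)" using \<iota>_surj[OF wc] by metis
    have "y I = koszul_d indet n M w' I" for I
    proof (rule \<iota>_inj[OF yc gM.koszul_d_closed[of w', OF w'(1)]])
      have "\<iota> (y I) = koszul_d indet n (C 0) w I" using w(2)[of I] C0.koszul_d_closed[of w I, OF wc] by simp
      also have "\<dots> = koszul_d indet n (C 0) (\<lambda>I. \<iota> (w' I)) I" by (simp add: w'(2)[symmetric])
      also have "\<dots> = \<iota> (koszul_d indet n M w' I)"
        using gM.linear_map_koszul_d[of "C 0" \<iota> w' I, OF C0.module_axioms \<iota>_lin w'(1)] by simp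
      finally show "\<iota> (y I) = \<iota> (koszul_d indet n M w' I)" .
    qed
    then show "\<exists>w. (\<forall>I. w I \<in> carrier M) \<and> (\<forall>I. y I = koszul_d indet n M w I)"
      using w'(1) by (intro exI[of _ w'] conjI allI)
  qed
qed

end

end

section \<open>Vanishing of Tor\<close>
context graded_poly
begin

text \<open>All classes in \<open>F\<^sub>i \<otimes> S\<close> have the form \<open>x \<otimes> 1\<close>, so a cycle of degree \<open>\<mu>\<close> is given by an element \<open>z\<close> of
\<open>F\<^sub>j\<close> of this degree, to which the chase through the resolution applies.\<close>
lemma Tor_vanishes_if_koszul_exact:
  fixes M :: "(nat multiset \<Rightarrow> 's, 'm, 'g) gmodule" and F :: "nat \<Rightarrow> (nat multiset \<Rightarrow> 's, 'f, 'g) gmodule"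
  assumes M: "graded_module R M" and res: "graded_free_resolution R M F d \<epsilon>"
    and exact: "koszul_exact indet n \<gamma> M \<mu> j"
  shows "\<mu> \<notin> Supp (gTor R F d K j)"
proof -
  note resD = graded_free_resolutionD[OF res]
  have mF: "module R (F i)" for i using graded_moduleD(1)[OF resD(1)] .
  have gF: "graded_koszul R (F i) n indet \<gamma> (gcomp (F i))" for i by (rule graded_koszul_module[OF resD(1)])
  have lin: "linear_map R (F (Suc i)) (F i) (d i)" for i by (rule graded_hom_maps(1)[OF resD(3) resD(1) resD(1)])
  let ?t = "\<lambda>i. unit_tensor (F i)"
  let ?C = "\<lambda>i. gtensor R (F i) K"
  let ?d = "\<lambda>i. tensor_map R (F i) K (d i)"
  have tm: "?d i (?t (Suc i) x) = ?t i (d i x)" if "x \<in> carrier (F (Suc i))" for i x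
    by (rule tensor_map_unit_tensor[OF mF mF lin that])
  have grade: "grade (?C i) \<nu> = ?t i ` grade (F i) \<nu>" for i \<nu>
    by (rule grade_gtensor_unit_tensor[OF mF gF graded_moduleD(4)[OF resD(1)]])
  interpret Fj: graded_koszul R "F j" n indet \<gamma> "gcomp (F j)" by (rule gF)
  interpret Fs: graded_koszul R "F (Suc j)" n indet \<gamma> "gcomp (F (Suc j))" by (rule gF)
  note dj = additive_mapD[OF linear_mapD(1)[OF lin[of j]]]
  define B where "B = ?d j ` carrier (?C (Suc j))"
  define Z where "Z = {x \<in> carrier (?C j). j = 0 \<or> ?d (j - 1) x = \<zero>\<^bsub>?C (j - 1)\<^esub>}"
  have B: "B = {?t j (d j v) | v. v \<in> carrier (F (Suc j))}"
    unfolding B_def carrier_gtensor_unit_tensor[OF mF] using tm by force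
  have cosets: "grade (gTor R F d K j) \<mu> = (\<lambda>U. B +>\<^bsub>gsub (?C j) Z\<^esub> U) ` (grade (?C j) \<mu> \<inter> Z)"
    "\<zero>\<^bsub>gTor R F d K j\<^esub> = B"
    by (simp_all add: gTor_def chain_homology_def gquot_def B_def Z_def) (simp add: gsub_def)
  have coset: "B +>\<^bsub>gsub (?C j) Z\<^esub> U = {V \<oplus>\<^bsub>?C j\<^esub> U | V. V \<in> B}" for U
    by (auto simp: a_r_coset_def' gsub_def)
  have in_B: "U \<in> B" if U: "U \<in> grade (?C j) \<mu> \<inter> Z" for U
  proof -
    obtain z where z: "z \<in> grade (F j) \<mu>" "U = ?t j z" using U grade by auto
    have zc: "z \<in> carrier (F j)" using Fj.grade_carrier[OF z(1)] .
    have "\<exists>w v. (\<forall>I. w I \<in> carrier (F j)) \<and> v \<in> carrier (F (Suc j)) \<and> z = koszul_d indet n (F j) w {} \<oplus>\<^bsub>F j\<^esub> d j v"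
    proof (rule resolution_cycle_mod_irrelevant[OF M res exact z(1)])
      fix i assume i: "j = Suc i"
      have zi: "z \<in> carrier (F (Suc i))" using zc i by simp
      have "?t i (d i z) = \<zero>\<^bsub>?C i\<^esub>" using U z(2) tm[OF zi] i by (simp add: Z_def)
      then have "d i z \<in> irrelevant_span (F i)"
        using unit_tensor_eq_zero_iff[OF mF additive_mapD(1)[OF linear_mapD(1)[OF lin] zi]] by simp
      then show "\<exists>u. (\<forall>I. u I \<in> carrier (F i)) \<and> d i z = koszul_d indet n (F i) u {}"
        unfolding irrelevant_span_def by blast
    qed
    then obtain w v where wv: "\<And>I. w I \<in> carrier (F j)" "v \<in> carrier (F (Suc j))" "z = koszul_d indet n (F j) w {} \<oplus>\<^bsub>F j\<^esub> d j v" by blast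
    have k: "koszul_d indet n (F j) w {} \<in> carrier (F j)" "koszul_d indet n (F j) w {} \<in> irrelevant_span (F j)"
      using Fj.koszul_d_closed[of w, OF wv(1)] wv(1) unfolding irrelevant_span_def by blast+
    have "?t j (koszul_d indet n (F j) w {}) = ?t j \<zero>\<^bsub>F j\<^esub>"
      using unit_tensor_eq_zero_iff[OF mF k(1)] k(2) unit_tensor_zero[OF mF] by simp
    then have "?t j z = ?t j (\<zero>\<^bsub>F j\<^esub> \<oplus>\<^bsub>F j\<^esub> d j v)"
      unfolding wv(3) unit_tensor_add[OF mF k(1) dj(1)[OF wv(2)]]
        unit_tensor_add[OF mF Fj.M.zero_closed dj(1)[OF wv(2)]] by simp
    then show ?thesis using z(2) B wv(2) dj(1)[OF wv(2)] by auto
  qed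
  \<comment> \<open>\<open>B\<close> is closed under addition and subtraction, so its translate by one of its elements is \<open>B\<close> again.\<close>
  have absorb: "B +>\<^bsub>gsub (?C j) Z\<^esub> U = B" if U: "U \<in> B" for U
  proof -
    obtain u where u: "u \<in> carrier (F (Suc j))" "U = ?t j (d j u)" using U B by auto
    have plus: "?t j (d j v) \<oplus>\<^bsub>?C j\<^esub> U = ?t j (d j (v \<oplus>\<^bsub>F (Suc j)\<^esub> u))" if "v \<in> carrier (F (Suc j))" for v
      using unit_tensor_add[OF mF dj(1)[OF that] dj(1)[OF u(1)]] dj(2)[OF that u(1)] u(2) by simp
    have "V \<in> {V \<oplus>\<^bsub>?C j\<^esub> U | V. V \<in> B}" if V: "V \<in> B" for V
    proof -
      obtain v where v: "v \<in> carrier (F (Suc j))" "V = ?t j (d j v)" using V B by auto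
      have "(v \<ominus>\<^bsub>F (Suc j)\<^esub> u) \<oplus>\<^bsub>F (Suc j)\<^esub> u = v"
        using v u by (simp add: a_minus_def Fs.M.a_assoc Fs.M.l_neg)
      then have "V = ?t j (d j (v \<ominus>\<^bsub>F (Suc j)\<^esub> u)) \<oplus>\<^bsub>?C j\<^esub> U" using plus[of "v \<ominus>\<^bsub>F (Suc j)\<^esub> u"] u v by simp
      moreover have "?t j (d j (v \<ominus>\<^bsub>F (Suc j)\<^esub> u)) \<in> B" unfolding B using u v by blast
      ultimately show ?thesis by blast
    qed
    moreover have "V \<oplus>\<^bsub>?C j\<^esub> U \<in> B" if V: "V \<in> B" for V
    proof -
      obtain v where v: "v \<in> carrier (F (Suc j))" "V = ?t j (d j v)" using V B by auto
      then show ?thesis unfolding v(2) plus[OF v(1)] B using u(1) Fs.M.a_closed by blast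
    qed
    ultimately show ?thesis unfolding coset by blast
  qed
  have "?t j \<zero>\<^bsub>F j\<^esub> \<in> grade (?C j) \<mu> \<inter> Z"
  proof
    show "?t j \<zero>\<^bsub>F j\<^esub> \<in> grade (?C j) \<mu>" unfolding grade using Fj.grade_zero by blast
    have "?d i (?t j \<zero>\<^bsub>F j\<^esub>) = \<zero>\<^bsub>?C i\<^esub>" if i: "j = Suc i" for i
    proof -
      have "d i \<zero>\<^bsub>F (Suc i)\<^esub> = \<zero>\<^bsub>F i\<^esub>"
        by (rule additive_map_zero[OF graded_moduleD(2)[OF resD(1)] graded_moduleD(2)[OF resD(1)] linear_mapD(1)[OF lin]])
      then show ?thesis using tm[of "\<zero>\<^bsub>F (Suc i)\<^esub>" i] unit_tensor_zero[OF mF] Fj.M.zero_closed i by simp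
    qed
    then show "?t j \<zero>\<^bsub>F j\<^esub> \<in> Z"
      unfolding Z_def using unit_tensor_in_carrier[OF mF Fj.M.zero_closed] by (cases j) auto
  qed
  then have "grade (gTor R F d K j) \<mu> = {B}"
    unfolding cosets(1) using in_B absorb by blast
  then show ?thesis unfolding Supp_def cosets(2) by simp
qed

end

section \<open>Supports\<close>
lemma degree_monoid_zero: "0 \<in> degree_monoid n \<gamma>"
  by (auto simp: degree_monoid_def hull_def)

lemma not_in_reg:
  assumes "\<alpha> \<in> Supp (cech_cohomology (graded_poly_ring S n \<gamma>) fs M i)" "\<beta> \<in> F_pred n \<gamma> i"
  shows "\<alpha> + \<beta> \<notin> reg S n \<gamma> fs M"
proof
  assume "\<alpha> + \<beta> \<in> reg S n \<gamma> fs M"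
  then have "weakly_regular S n \<gamma> fs M (\<alpha> + \<beta> + 0)"
    unfolding reg_def using degree_monoid_zero[of n \<gamma>] by (auto simp: set_plus_def)
  then show False using assms unfolding weakly_regular_def by (auto simp: set_plus_def)
qed

lemma sum_in_F_set:
  assumes "I \<subseteq> {..<n}"
  shows "sum \<gamma> I \<in> F_set n \<gamma> (card I)"
proof -
  have "finite I" using assms by (rule finite_subset) simp
  then have "sum \<gamma> I = mdegree \<gamma> (mset_set I)" "set_mset (mset_set I) \<subseteq> {..<n}" "size (mset_set I) = card I"
    using assms by (simp_all add: mdegree_def sum_unfold_sum_mset)
  then show ?thesis unfolding F_set_def by blast
qed

text \<open>For \<open>i > 0\<close> take \<open>j + 1\<close> of the \<open>i + j\<close> elements of \<open>I\<close>; the other \<open>i - 1\<close> give an element of \<open>\<F>\<^sub>i\<^sub>-\<^sub>1\<close>.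
For \<open>i = 0\<close> there are only \<open>j\<close> elements, one too few; a further variable exists because \<open>j < n\<close>, and the
negative of its degree is in \<open>\<F>\<^sub>-\<^sub>1\<close>.\<close>
lemma shifted_support_subset:
  assumes I: "I \<subseteq> {..<n}" "card I = i + j" and j: "j < n"
    and \<mu>: "\<mu> - sum \<gamma> I \<in> Supp (cech_cohomology (graded_poly_ring S n \<gamma>) fs M i)"
  shows "\<mu> \<in> E_set n \<gamma> (j + 1) + (- reg S n \<gamma> fs M)"
proof -
  have fin: "finite I" using I(1) by (rule finite_subset) simp
  have "\<exists>J \<beta>. J \<subseteq> {..<n} \<and> card J = j + 1 \<and> \<beta> \<in> F_pred n \<gamma> i \<and> \<mu> = sum \<gamma> J + (\<mu> - sum \<gamma> I + \<beta>)"
  proof (cases i)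
    case 0
    then have "I \<noteq> {..<n}" using I j by auto
    then obtain k where k: "k < n" "k \<notin> I" using I(1) by auto
    have "\<gamma> k \<in> F_set n \<gamma> 1" using sum_in_F_set[of "{k}" n \<gamma>] k by simp
    then have "- \<gamma> k \<in> F_pred n \<gamma> i" using 0 by (simp add: F_pred_def)
    moreover have "insert k I \<subseteq> {..<n}" "card (insert k I) = j + 1" using I k fin 0 by auto
    moreover have "\<mu> = sum \<gamma> (insert k I) + (\<mu> - sum \<gamma> I + - \<gamma> k)" using k fin by (simp add: algebra_simps)
    ultimately show ?thesis by blast
  next
    case (Suc i')
    then have "j + 1 \<le> card I" using I by simp
    then obtain J where J: "J \<subseteq> I" "card J = j + 1" using obtain_subset_with_card_n by metis
    have "sum \<gamma> (I - J) \<in> F_set n \<gamma> (card (I - J))" using I by (intro sum_in_F_set) auto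
    moreover have "card (I - J) = i'" using J I Suc fin finite_subset[OF J(1) fin] by (simp add: card_Diff_subset)
    ultimately have "sum \<gamma> (I - J) \<in> F_pred n \<gamma> i" using Suc by (simp add: F_pred_def)
    moreover have "\<mu> = sum \<gamma> J + (\<mu> - sum \<gamma> I + sum \<gamma> (I - J))"
      using sum.subset_diff[OF J(1) fin, of \<gamma>] by (simp add: algebra_simps)
    ultimately show ?thesis using J I by blast
  qed
  then obtain J \<beta> where "J \<subseteq> {..<n}" "card J = j + 1" "\<beta> \<in> F_pred n \<gamma> i" "\<mu> = sum \<gamma> J + (\<mu> - sum \<gamma> I + \<beta>)"
    by blast
  moreover from this have "sum \<gamma> J \<in> E_set n \<gamma> (j + 1)" by (auto simp: E_set_def)
  moreover from calculation have "\<mu> - sum \<gamma> I + \<beta> \<in> - reg S n \<gamma> fs M" using not_in_reg[OF \<mu>] by simp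
  ultimately show ?thesis by (metis set_plus_intro)
qed

theorem theorem4p7:
  fixes S :: "('s, 'b) ring_scheme"
    and n :: nat
    and \<gamma> :: "nat \<Rightarrow> 'g::ab_group_add"
    and R :: "(nat multiset \<Rightarrow> 's, 'g) gring"
    and B :: "(nat multiset \<Rightarrow> 's) set"
    and fs :: "(nat multiset \<Rightarrow> 's) list"
    and M :: "(nat multiset \<Rightarrow> 's, 'm, 'g) gmodule"
    and F :: "nat \<Rightarrow> (nat multiset \<Rightarrow> 's, 'f, 'g) gmodule"
    and d :: "nat \<Rightarrow> 'f \<Rightarrow> 'f"
    and \<epsilon> :: "'f \<Rightarrow> 'm"
  assumes "cring S"
    and "R = graded_poly_ring S n \<gamma>"
    and "set fs \<subseteq> (\<Union>\<delta>. homog R \<delta>)"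
    and "B = Idl\<^bsub>R\<^esub> (set fs)"
    and "B \<subseteq> irrelevant_ideal S n \<gamma>"
    and "graded_module R M"
    and "graded_free_resolution R M F d \<epsilon>"
  shows "(\<forall>j. j \<noteq> n \<longrightarrow>
            Supp (gTor R F d (base_gmodule S n \<gamma>) j) \<subseteq> E_set n \<gamma> (j + 1) + (- reg S n \<gamma> fs M)) \<and>
         Supp (gTor R F d (base_gmodule S n \<gamma>) n) \<subseteq>
            Supp (cech_cohomology R fs M 0) + E_set n \<gamma> n"
proof -
  note R = assms(2)
  have "cring R" using assms(6) by (simp add: graded_module_def module_def)
  then interpret P: graded_poly S n \<gamma>
    by (intro graded_poly.intro) (simp_all add: assms(1) R)
  have fs_carrier: "set fs \<subseteq> carrier R" using assms(3) P.homog_closed unfolding R by blast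
  have "\<forall>i. \<exists>\<delta>. i < length fs \<longrightarrow> fs ! i \<in> homog R \<delta>"
    using assms(3) nth_mem by blast
  then obtain \<delta> where \<delta>: "\<And>i. i < length fs \<Longrightarrow> fs ! i \<in> homog R (\<delta> i)" by metis
  have "set fs \<subseteq> irrelevant_ideal S n \<gamma>"
    using P.R.genideal_self[of "set fs"] fs_carrier assms(4,5) unfolding R by blast
  then have fs_ideal: "fs ! i \<in> irrelevant_ideal S n \<gamma>" if "i < length fs" for i
    using that nth_mem by blast
  interpret cech S n \<gamma> fs \<delta> M
    by (unfold_locales)
      (use \<delta> fs_ideal assms(6) in \<open>auto simp: R P.irrelevant_ideal(2)\<close>)
  have key: "\<exists>i I. I \<subseteq> {..<n} \<and> card I = i + j \<and> \<mu> - sum \<gamma> I \<in> Supp (cech_cohomology R fs M i)"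
    if \<mu>: "\<mu> \<in> Supp (gTor R F d (base_gmodule S n \<gamma>) j)" for \<mu> j
  proof (rule ccontr)
    assume none: "\<not> ?thesis"
    have "grade (cech_cohomology R fs M i) (\<mu> - sum \<gamma> I) = {\<zero>\<^bsub>cech_cohomology R fs M i\<^esub>}"
      if "I \<subseteq> {..<n}" "card I = i + j" for i I
      using none that unfolding Supp_def by blast
    then have "koszul_exact P.indet n \<gamma> M \<mu> j"
      unfolding R by (rule koszul_exact_of_cech_vanishing)
    then show False
      using P.Tor_vanishes_if_koszul_exact[of M F d \<epsilon> \<mu> j] assms(6,7) \<mu> unfolding R by blast
  qed
  have "Supp (gTor R F d (base_gmodule S n \<gamma>) j) \<subseteq> E_set n \<gamma> (j + 1) + (- reg S n \<gamma> fs M)" if j: "j \<noteq> n" for j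
  proof
    fix \<mu> assume "\<mu> \<in> Supp (gTor R F d (base_gmodule S n \<gamma>) j)"
    then obtain i I where I: "I \<subseteq> {..<n}" "card I = i + j" "\<mu> - sum \<gamma> I \<in> Supp (cech_cohomology R fs M i)"
      using key by blast
    then have "j < n" using card_mono[of "{..<n}" I] j by simp
    then show "\<mu> \<in> E_set n \<gamma> (j + 1) + (- reg S n \<gamma> fs M)"
      using shifted_support_subset[OF I(1,2)] I(3) unfolding R by blast
  qed
  moreover have "Supp (gTor R F d (base_gmodule S n \<gamma>) n) \<subseteq> Supp (cech_cohomology R fs M 0) + E_set n \<gamma> n"
  proof
    fix \<mu> assume "\<mu> \<in> Supp (gTor R F d (base_gmodule S n \<gamma>) n)"
    then obtain i I where I: "I \<subseteq> {..<n}" "card I = i + n" "\<mu> - sum \<gamma> I \<in> Supp (cech_cohomology R fs M i)"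
      using key by blast
    have i: "i = 0" using I card_mono[of "{..<n}" I] by simp
    have "sum \<gamma> I \<in> E_set n \<gamma> n" using I i by (auto simp: E_set_def)
    then have "(\<mu> - sum \<gamma> I) + sum \<gamma> I \<in> Supp (cech_cohomology R fs M 0) + E_set n \<gamma> n"
      using I(3) i by (intro set_plus_intro) simp_all
    then show "\<mu> \<in> Supp (cech_cohomology R fs M 0) + E_set n \<gamma> n" by simp
  qed
  ultimately show ?thesis by blast
qed

end
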